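(* For all integers $p\ge 2$, $q\ge 1$ and every real $\gamma>0$ there exists $c>0$ such that for every $q$-degenerate $\gamma$-crumbling family $\mathcal{F}$ of connected graphs, \[ r\left(B_p(\lceil cn\rceil),G\right)=p(n-1)+1 \] for every $G\in\mathcal{F}$ of sufficiently large order $n$.
   Context: All graphs are finite and simple. The Ramsey number $r(H_1,H_2)$ is the least $n$ such that for every $2$-coloring $E(K_n)=E(R)\cup E(B)$ (a partition of the edges into the edge sets of two graphs $R,B$ on vertex set $V(K_n)$), either $H_1\subset R$ or $H_2\subset B$. The $p$-book of size $m$ is $B_p(m)=K_p+mK_1$, i.e. $m$ distinct $(p+1)$-cliques sharing a common $p$-clique (here $+$ is the join). A graph is $q$-degenerate if each of its subgraphs contains a vertex of degree at most $q$; a family is $q$-degenerate if all its members are. Given real $\gamma,\eta>0$, a graph $G$ of order $n$ is $(\gamma,\eta)$-splittable if there exists $S\subset V(G)$ with $|S|<n^{1-\gamma}$ such that the order of any component of $G-S$ is at most $\eta n$. A family $\mathcal{F}$ is $\gamma$-crumbling if for any $\eta>0$ there exists $n_0(\eta)$ such that all $G\in\mathcal{F}$ with $|G|>n_0(\eta)$ are $(\gamma,\eta)$-splittable. "Sufficiently large" may depend on $p,q,\gamma$ and $\mathcal{F}$. *)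

theory Defs
  imports
    Complex_Main
    "Graph_Theory.Pair_Digraph"
    "Graph_Theory.Digraph_Component"
    "Graph_Theory.Digraph_Isomorphism"
begin

text \<open>
  A finite simple graph is a \<open>pair_graph\<close>: a finite, loop-free, symmetric digraph whose arcs are
  ordered pairs, so that an undirected edge is a pair of opposite arcs.
  The order of \<open>G\<close> is \<open>card (pverts G)\<close>.
\<close>

definition complete_graph :: "'a set \<Rightarrow> 'a pair_pre_digraph" where
  "complete_graph V = \<lparr>pverts = V, parcs = {(u, v). u \<in> V \<and> v \<in> V \<and> u \<noteq> v}\<rparr>"

definition edgeless_graph :: "'a set \<Rightarrow> 'a pair_pre_digraph" where
  "edgeless_graph V = \<lparr>pverts = V, parcs = {}\<rparr>"

definition graph_join ::
  "'a pair_pre_digraph \<Rightarrow> 'b pair_pre_digraph \<Rightarrow> ('a + 'b) pair_pre_digraph" where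
  "graph_join G H =
     \<lparr>pverts = pverts G <+> pverts H,
      parcs = map_prod Inl Inl ` parcs G \<union> map_prod Inr Inr ` parcs H
        \<union> (Inl ` pverts G) \<times> (Inr ` pverts H) \<union> (Inr ` pverts H) \<times> (Inl ` pverts G)\<rparr>"

definition book :: "nat \<Rightarrow> nat \<Rightarrow> (nat + nat) pair_pre_digraph" where
  "book p m = graph_join (complete_graph {..<p}) (edgeless_graph {..<m})"

text \<open>\<open>H \<subset> G\<close> for graphs on unrelated vertex sets: some subgraph of \<open>G\<close> is isomorphic to \<open>H\<close>.\<close>

definition contains_copy :: "'b pair_pre_digraph \<Rightarrow> 'a pair_pre_digraph \<Rightarrow> bool" where
  "contains_copy G H \<longleftrightarrow>
     (\<exists>H'. subgraph (with_proj H') (with_proj G) \<and> digraph_iso (with_proj H) (with_proj H'))"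

definition two_coloring ::
  "nat \<Rightarrow> nat pair_pre_digraph \<Rightarrow> nat pair_pre_digraph \<Rightarrow> bool" where
  "two_coloring N R B \<longleftrightarrow> pair_graph R \<and> pair_graph B
     \<and> pverts R = {..<N} \<and> pverts B = {..<N}
     \<and> parcs R \<union> parcs B = parcs (complete_graph {..<N}) \<and> parcs R \<inter> parcs B = {}"

definition ramsey_number :: "'a pair_pre_digraph \<Rightarrow> 'b pair_pre_digraph \<Rightarrow> nat" where
  "ramsey_number H\<^sub>1 H\<^sub>2 =
     (LEAST N. \<forall>R B. two_coloring N R B \<longrightarrow> contains_copy R H\<^sub>1 \<or> contains_copy B H\<^sub>2)"

text \<open>
  In a symmetric digraph the out-degree of a vertex is its degree. Subgraphs are required to be
  nonempty and, since the library relation \<open>subgraph\<close> is about digraphs, to be graphs again.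
\<close>

definition degenerate :: "nat \<Rightarrow> 'a pair_pre_digraph \<Rightarrow> bool" where
  "degenerate q G \<longleftrightarrow>
     (\<forall>H. pair_graph H \<and> subgraph (with_proj H) (with_proj G) \<and> pverts H \<noteq> {} \<longrightarrow>
        (\<exists>v\<in>pverts H. out_degree (with_proj H) v \<le> q))"

definition degenerate_family :: "nat \<Rightarrow> 'a pair_pre_digraph set \<Rightarrow> bool" where
  "degenerate_family q \<F> \<longleftrightarrow> (\<forall>G\<in>\<F>. degenerate q G)"

text \<open>In a symmetric digraph the strongly connected components are the connected components.\<close>

definition splittable :: "real \<Rightarrow> real \<Rightarrow> 'a pair_pre_digraph \<Rightarrow> bool" where
  "splittable \<gamma> \<eta> G \<longleftrightarrow>
     (\<exists>S \<subseteq> pverts G. real (card S) < real (card (pverts G)) powr (1 - \<gamma>)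
        \<and> (\<forall>C \<in> pre_digraph.sccs (with_proj G \<restriction> (pverts G - S)).
             real (card (verts C)) \<le> \<eta> * real (card (pverts G))))"

definition crumbling :: "real \<Rightarrow> 'a pair_pre_digraph set \<Rightarrow> bool" where
  "crumbling \<gamma> \<F> \<longleftrightarrow>
     (\<forall>\<eta>>0. \<exists>n\<^sub>0::nat. \<forall>G\<in>\<F>. card (pverts G) > n\<^sub>0 \<longrightarrow> splittable \<gamma> \<eta> G)"

end

theory Submission
  imports Defs
begin

text \<open>
  For the upper bound suppose that neither the red book nor the blue \<open>G\<close> occurs, with \<open>\<kappa>\<close> tiny and
  \<open>N = p (n - 1) + 1\<close>. Since a red \<open>K\<^sub>p\<close> has at most \<open>\<kappa> n\<close> common red neighbours, every set of linear
  size contains a linear part in which all red degrees are small. If such a part \<open>Q\<close> were almost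
  completely blue to \<open>(1 + \<epsilon>) n\<close> vertices, \<open>G\<close> would embed, its separator into \<open>Q\<close> and its small
  components into nearly blue parts covering those vertices. Hence Turan's greedy argument produces
  sets \<open>Q\<^sub>1, \<dots>, Q\<^sub>p\<close>, each almost blue to only about \<open>n\<close> vertices and each vertex of \<open>Q\<^sub>j\<close> having positive
  red density to \<open>Q\<^sub>i\<close> for \<open>i < j\<close>. Choosing them one-sided regular (by a density increment, without
  the regularity lemma) makes red cliques extend, and the vertices that are almost blue to \<open>Q\<^sub>i\<close> only
  form parts \<open>D\<^sub>1, \<dots>, D\<^sub>p\<close> of size about \<open>n\<close> with small red degrees inside.

  If some \<open>D\<^sub>i\<close> sends many blue edges to its complement, a few low-degree vertices of \<open>G\<close> can be placed
  outside \<open>D\<^sub>i\<close> and \<open>G\<close> embeds. Otherwise almost all of \<open>D\<^sub>i\<close> is red to the other parts; as a red edge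
  inside would give a red book, this core is a blue clique. A vertex with few red neighbours in exactly
  one part is blue to the whole core of that part. Counting with \<open>N = p (n - 1) + 1\<close> yields a part for
  which the core, these vertices and the vertices attached to several parts suffice for a spanning
  copy of \<open>G\<close>, the exceptional vertices being used for independent vertices of low degree.
\<close>

section \<open>Degenerate graphs and greedy embeddings\<close>

text \<open>The main obstacle is the order in which the constants are chosen. The sets
  \<open>Q\<close> have size \<open>\<sigma> * n\<close>, where \<sigma> depends on the threshold
  below which a vertex counts as almost blue; the bound \<open>(1 + \<epsilon>) * n\<close> on the
  vertices almost blue to \<open>Q\<close> must therefore hold at a threshold that does not depend
  on \<sigma>. This is possible because the vertices of \<open>Q\<close> that are unsuitable for
  some block of a cover are estimated as a proportion of \<open>Q\<close>, whereas the absolute size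
  of \<open>Q\<close> matters only for hosting the separator and is paid for by \<kappa>, which is
  chosen last. A single \<kappa> bounds the pages of the book, the separator, the components and
  \<open>1 / n\<close>, so finitely many demands are met by a minimum. This \<kappa> comes from
  \<open>p\<close> and \<open>q\<close>; \<gamma> and the family enter through the size of
  \<open>n\<close>, since \<open>n powr (1 - \<gamma>)\<close> is eventually at most
  \<open>\<kappa> * n\<close>. Connectedness serves the lower bound: a connected graph of order
  \<open>n\<close> does not fit into disjoint blue cliques of order \<open>n - 1\<close>.\<close>

definition nbrs :: "('a \<Rightarrow> 'b \<Rightarrow> bool) \<Rightarrow> 'a \<Rightarrow> 'b set \<Rightarrow> 'b set" where
  "nbrs E v X = {u \<in> X. E v u}"

abbreviation rcard :: "'a set \<Rightarrow> real" where
  "rcard X \<equiv> real (card X)"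

abbreviation rdeg :: "('a \<Rightarrow> 'b \<Rightarrow> bool) \<Rightarrow> 'a \<Rightarrow> 'b set \<Rightarrow> real" where
  "rdeg E v X \<equiv> rcard (nbrs E v X)"

abbreviation (input) non :: "('a \<Rightarrow> 'b \<Rightarrow> bool) \<Rightarrow> 'a \<Rightarrow> 'b \<Rightarrow> bool" where
  "non E x y \<equiv> \<not> E x y"

lemma nbrs_subset: "nbrs E v X \<subseteq> X"
  by (auto simp: nbrs_def)

lemma nbrs_iff [simp]: "u \<in> nbrs E v X \<longleftrightarrow> u \<in> X \<and> E v u"
  by (auto simp: nbrs_def)

lemma finite_nbrs [simp]: "finite X \<Longrightarrow> finite (nbrs E v X)"
  by (simp add: nbrs_def)

lemma nbrs_mono: "X \<subseteq> Y \<Longrightarrow> nbrs E v X \<subseteq> nbrs E v Y"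
  by (auto simp: nbrs_def)

lemma card_nbrs_mono: "finite Y \<Longrightarrow> X \<subseteq> Y \<Longrightarrow> card (nbrs E v X) \<le> card (nbrs E v Y)"
  by (intro card_mono nbrs_mono) auto

lemma card_nbrs_le: "finite X \<Longrightarrow> card (nbrs E v X) \<le> card X"
  by (intro card_mono nbrs_subset)

text \<open>Double counting, with \<open>F\<close> the transpose of \<open>E\<close>. The two sides
  may have different types, so incidences such as \<open>i \<in> J v\<close> are covered
  too.\<close>

lemma sum_card_nbrs_swap:
  assumes "finite X" "finite Y" "\<And>x y. E x y = F y x"
  shows "(\<Sum>x\<in>X. card (nbrs E x Y)) = (\<Sum>y\<in>Y. card (nbrs F y X))"
proof -
  have "(\<Sum>x\<in>X. card (nbrs E x Y)) = (\<Sum>x\<in>X. \<Sum>y\<in>Y. if E x y then 1 else 0)"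
    using assms(2) by (intro sum.cong refl) (simp add: nbrs_def sum.If_cases Int_def)
  also have "\<dots> = (\<Sum>y\<in>Y. \<Sum>x\<in>X. if E x y then 1 else 0)"
    by (rule sum.swap)
  also have "\<dots> = (\<Sum>y\<in>Y. card (nbrs F y X))"
    using assms by (intro sum.cong refl) (simp add: nbrs_def sum.If_cases Int_def)
  finally show ?thesis .
qed

lemma card_UN_bound:
  fixes b :: real
  assumes "finite I" "\<And>i. i \<in> I \<Longrightarrow> rcard (S i) \<le> b"
  shows "rcard (\<Union>i\<in>I. S i) \<le> rcard I * b"
proof -
  have "rcard (\<Union>i\<in>I. S i) \<le> (\<Sum>i\<in>I. rcard (S i))"
    unfolding of_nat_sum[symmetric] of_nat_le_iff using assms(1) by (rule card_UN_le)
  also have "\<dots> \<le> rcard I * b"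
    using assms(2) by (rule sum_bounded_above)
  finally show ?thesis .
qed

lemma card_cover:
  assumes "X \<subseteq> A \<union> B" "finite A" "finite B"
  shows "rcard X \<le> rcard A + rcard B"
  using card_mono[OF _ assms(1)] card_Un_le[of A B] assms(2,3) by simp

text \<open>Markov's inequality, kept free of division by \<open>a\<close>.\<close>

lemma card_heavy_le:
  fixes f :: "'a \<Rightarrow> real"
  assumes "finite X" "(\<Sum>x\<in>X. f x) \<le> s" "\<And>x. x \<in> X \<Longrightarrow> 0 \<le> f x"
  shows "a * rcard {x \<in> X. a < f x} \<le> s"
proof -
  have "a * rcard {x \<in> X. a < f x} = (\<Sum>x | x \<in> X \<and> a < f x. a)"
    by simp
  also have "\<dots> \<le> (\<Sum>x | x \<in> X \<and> a < f x. f x)"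
    by (intro sum_mono) auto
  also have "\<dots> \<le> (\<Sum>x\<in>X. f x)"
    using assms by (intro sum_mono2) auto
  finally show ?thesis
    using assms(2) by linarith
qed

text \<open>Blue is expressed as non-red: injectivity makes the images of adjacent vertices
  distinct, so a non-red image pair is a blue edge. Restricting to \<open>U\<close> allows partial
  embeddings.\<close>

definition blue_emb :: "('a \<Rightarrow> 'a \<Rightarrow> bool) \<Rightarrow> ('b \<Rightarrow> 'b \<Rightarrow> bool) \<Rightarrow> ('a \<Rightarrow> 'b) \<Rightarrow> 'a set \<Rightarrow> bool" where
  "blue_emb A R f U \<longleftrightarrow> inj_on f U \<and> (\<forall>u\<in>U. \<forall>v\<in>U. A u v \<longrightarrow> \<not> R (f u) (f v))"

section \<open>Finite simple graphs as symmetric irreflexive relations\<close>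

locale sgraph =
  fixes V :: "'a set" and E :: "'a \<Rightarrow> 'a \<Rightarrow> bool"
  assumes fin: "finite V"
    and sym: "E x y \<Longrightarrow> E y x"
    and irrefl: "\<not> E x x"
begin

lemma sum_nbrs_remove:
  assumes "H \<subseteq> V" "v \<in> H"
  shows "(\<Sum>u\<in>H. card (nbrs E u H))
    = (\<Sum>u\<in>H - {v}. card (nbrs E u (H - {v}))) + 2 * card (nbrs E v H)"
proof -
  have fH: "finite H"
    using assms fin finite_subset by blast
  have *: "card (nbrs E u H) = card (nbrs E u (H - {v})) + (if E u v then 1 else 0)"
    if "u \<in> H - {v}" for u
  proof (cases "E u v")
    case True
    then have "nbrs E u H = insert v (nbrs E u (H - {v}))"
      using assms by auto
    then show ?thesis
      using True fH by simp
  next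
    case False
    then have "nbrs E u H = nbrs E u (H - {v})"
      using assms by auto
    then show ?thesis
      using False by simp
  qed
  have "(\<Sum>u\<in>H - {v}. if E u v then 1 else 0) = card (nbrs E v H)"
  proof -
    have "(\<Sum>u\<in>H - {v}. if E u v then 1 else 0::nat) = card {u \<in> H - {v}. E u v}"
      using fH by (simp add: sum.If_cases Int_def)
    also have "{u \<in> H - {v}. E u v} = nbrs E v H"
      using sym irrefl by auto
    finally show ?thesis .
  qed
  then have "(\<Sum>u\<in>H - {v}. card (nbrs E u H))
      = (\<Sum>u\<in>H - {v}. card (nbrs E u (H - {v}))) + card (nbrs E v H)"
    using * by (simp add: sum.distrib)
  then show ?thesis
    using fH assms by (simp add: sum.remove)
qed

lemma blue_emb_union:
  assumes "\<And>x y. R x y \<Longrightarrow> R y x" "blue_emb E R f U" "blue_emb E R g W" "U \<inter> W = {}" "f ` U \<inter> g ` W = {}"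
    and cross: "\<And>u w. u \<in> U \<Longrightarrow> w \<in> W \<Longrightarrow> E u w \<Longrightarrow> \<not> R (f u) (g w)"
  shows "blue_emb E R (\<lambda>u. if u \<in> W then g u else f u) (U \<union> W)"
proof -
  define h where "h u = (if u \<in> W then g u else f u)" for u
  have hU: "h u = f u" if "u \<in> U" for u
    using that assms(4) by (auto simp: h_def)
  have hW: "h w = g w" if "w \<in> W" for w
    using that by (simp add: h_def)
  have ne: "f u \<noteq> g w" if "u \<in> U" "w \<in> W" for u w
    using that assms(5) by blast
  have "blue_emb E R h (U \<union> W)"
    unfolding blue_emb_def
  proof (intro conjI ballI impI)
    show "inj_on h (U \<union> W)"
    proof (rule inj_onI)
      fix u v assume "u \<in> U \<union> W" "v \<in> U \<union> W" "h u = h v"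
      then show "u = v"
        using assms(2,3) hU hW ne[of u v] ne[of v u] unfolding blue_emb_def inj_on_def by (metis UnE)
    qed
    fix u v assume uv: "u \<in> U \<union> W" "v \<in> U \<union> W" "E u v"
    consider "u \<in> U" "v \<in> U" | "u \<in> U" "v \<in> W" | "u \<in> W" "v \<in> U" | "u \<in> W" "v \<in> W"
      using uv by blast
    then show "\<not> R (h u) (h v)"
    proof cases
      case 3
      then show ?thesis
        using cross[of v u] uv(3) sym[of u v] assms(1)[of "g u" "f v"] hU hW by auto
    qed (use uv assms(2,3) cross hU hW in \<open>auto simp: blue_emb_def\<close>)
  qed
  then show ?thesis
    unfolding h_def .
qed

lemma blue_emb_insert:
  assumes "\<And>x y. R x y \<Longrightarrow> R y x" "blue_emb E R f U" "a \<notin> U" "x \<notin> f ` U"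
    and "\<And>u. u \<in> U \<Longrightarrow> E a u \<Longrightarrow> \<not> R (f u) x"
  shows "blue_emb E R (f(a := x)) (insert a U)"
proof -
  have "blue_emb E R (\<lambda>_. x) {a}"
    using irrefl by (simp add: blue_emb_def)
  then have "blue_emb E R (\<lambda>u. if u \<in> {a} then x else f u) (U \<union> {a})"
    using assms(3-5) sym by (intro blue_emb_union[OF assms(1,2)]) auto
  then show ?thesis
    by (simp add: fun_upd_def)
qed

end

text \<open>Testing induced subgraphs turns degeneracy into a condition on vertex sets.\<close>

locale degenerate_graph = sgraph P A for P :: "'a set" and A +
  fixes q :: nat
  assumes degen: "H \<subseteq> P \<Longrightarrow> H \<noteq> {} \<Longrightarrow> \<exists>v\<in>H. card (nbrs A v H) \<le> q"
begin

text \<open>The vertex \<open>v\<close> is the last one in a degeneracy order of \<open>H\<close>.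
  The induction hypothesis covers all subsets of \<open>H - {v}\<close> because some arguments also
  discard the neighbours of \<open>v\<close>.\<close>

lemma degenerate_induct [consumes 1, case_names empty step]:
  assumes "H \<subseteq> P"
    and "Q {}"
    and step: "\<And>H v. H \<subseteq> P \<Longrightarrow> v \<in> H \<Longrightarrow> card (nbrs A v H) \<le> q \<Longrightarrow>
      (\<And>H'. H' \<subseteq> H - {v} \<Longrightarrow> Q H') \<Longrightarrow> Q H"
  shows "Q H"
  using assms(1)
proof (induction "card H" arbitrary: H rule: less_induct)
  case less
  show ?case
  proof (cases "H = {}")
    case False
    then obtain v where v: "v \<in> H" "card (nbrs A v H) \<le> q"
      using degen less.prems by blast
    have fH: "finite H"
      using less.prems fin finite_subset by blast
    have "Q H'" if "H' \<subseteq> H - {v}" for H'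
      using that v fH less.prems by (intro less.hyps psubset_card_mono) auto
    then show ?thesis
      using step less.prems v by blast
  qed (use assms(2) in simp)
qed

text \<open>Deleting a vertex of degree at most \<open>q\<close> removes at most \<open>q\<close>
  edges, hence \<open>2 * q\<close> from the degree sum.\<close>

lemma sum_nbrs_le:
  assumes "H \<subseteq> P"
  shows "(\<Sum>v\<in>H. card (nbrs A v H)) \<le> 2 * q * card H"
  using assms
proof (induction rule: degenerate_induct)
  case (step H v)
  have "finite H"
    using step.hyps(1) fin finite_subset by blast
  then have "card H = Suc (card (H - {v}))"
    using step.hyps(2) by (metis card.remove)
  then show ?case
    using sum_nbrs_remove[OF step.hyps(1,2)] step.hyps(3) step.IH[of "H - {v}"] by simp
qed simp

text \<open>Adding a vertex with more than \<open>2 q\<close> neighbours in the current set adds more edges than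
  degeneracy allows on average, so only \<open>card S\<^sub>0\<close> vertices can be added.\<close>

lemma closure_exists:
  assumes "C \<subseteq> P" "S\<^sub>0 \<subseteq> C"
  obtains S where "S\<^sub>0 \<subseteq> S" "S \<subseteq> C" "card S \<le> 2 * card S\<^sub>0"
    "\<And>v. v \<in> C - S \<Longrightarrow> card (nbrs A v S) \<le> 2 * q"
proof -
  \<comment> \<open>A new vertex with at least \<open>2 * q + 1\<close> neighbours in
    \<open>S\<close> raises the degree sum by at least \<open>4 * q + 2\<close>, to be played off
    against the bound \<open>2 * q * card S\<close>.\<close>
  define good where "good S \<longleftrightarrow> S\<^sub>0 \<subseteq> S \<and> S \<subseteq> C \<and>
    (4 * q + 2) * (card S - card S\<^sub>0) \<le> (\<Sum>v\<in>S. card (nbrs A v S))" for S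
  have fC: "finite C"
    using assms fin finite_subset by blast
  have "good S\<^sub>0"
    using assms by (simp add: good_def)
  moreover have "\<forall>S. good S \<longrightarrow> card S < Suc (card C)"
    using fC by (auto simp: good_def less_Suc_eq_le intro: card_mono)
  ultimately have "\<exists>S. good S \<and> (\<forall>S'. good S' \<longrightarrow> card S' \<le> card S)"
    by (rule ex_has_greatest_nat)
  then obtain S where S: "good S" and max: "\<And>S'. good S' \<Longrightarrow> card S' \<le> card S"
    by blast
  have SC: "S\<^sub>0 \<subseteq> S" "S \<subseteq> C" "S \<subseteq> P" and fS: "finite S"
    using S assms fC finite_subset by (auto simp: good_def)
  show thesis
  proof
    have c: "card S\<^sub>0 \<le> card S"
      using SC fS by (intro card_mono)
    define y where "y = card S - card S\<^sub>0"
    have "(4 * q + 2) * y \<le> 2 * q * (card S\<^sub>0 + y)"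
      using S sum_nbrs_le[OF SC(3)] c by (simp add: good_def y_def)
    then have "(2 * q + 2) * y \<le> (2 * q + 2) * card S\<^sub>0"
      by (simp add: algebra_simps)
    then have "y \<le> card S\<^sub>0"
      by (rule mult_left_le_imp_le) simp
    then show "card S \<le> 2 * card S\<^sub>0"
      using c by (simp add: y_def)
    show "card (nbrs A v S) \<le> 2 * q" if v: "v \<in> C - S" for v
    proof (rule ccontr)
      assume *: "\<not> card (nbrs A v S) \<le> 2 * q"
      have "nbrs A v (insert v S) = nbrs A v S"
        using irrefl by auto
      then have "(\<Sum>u\<in>insert v S. card (nbrs A u (insert v S)))
          = (\<Sum>u\<in>S. card (nbrs A u S)) + 2 * card (nbrs A v S)"
        using sum_nbrs_remove[of "insert v S" v] v SC assms by auto
      moreover have "card (insert v S) - card S\<^sub>0 = Suc (card S - card S\<^sub>0)"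
        using v fS c by simp
      ultimately have "good (insert v S)"
        using S v * by (auto simp: good_def)
      then show False
        using max[of "insert v S"] v fS by simp
    qed
  qed (use SC in auto)
qed

text \<open>Greedy choice: keeping a vertex of degree at most \<open>q\<close> costs that vertex and
  at most \<open>q\<close> neighbours.\<close>

lemma independent_subset:
  assumes "H \<subseteq> P"
  shows "\<exists>I\<subseteq>H. card H \<le> (q + 1) * card I \<and> (\<forall>u\<in>I. \<forall>v\<in>I. \<not> A u v)"
  using assms
proof (induction rule: degenerate_induct)
  case (step H v)
  define H' where "H' = H - insert v (nbrs A v H)"
  have fH: "finite H"
    using step.hyps(1) fin finite_subset by blast
  have "H' \<subseteq> H - {v}"
    by (auto simp: H'_def)
  from step.IH[OF this] obtain I where I: "I \<subseteq> H'" "card H' \<le> (q + 1) * card I"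
    "\<forall>u\<in>I. \<forall>w\<in>I. \<not> A u w"
    by blast
  have "card H \<le> card H' + card (insert v (nbrs A v H))"
    using fH step.hyps(2) by (simp add: H'_def card_Diff_subset insert_absorb nbrs_subset card_mono)
  also have "card (insert v (nbrs A v H)) \<le> q + 1"
    using step.hyps(3) fH by (simp add: card_insert_if)
  finally have "card H \<le> card H' + (q + 1)"
    by simp
  moreover have "v \<notin> I" "finite I"
    using I fH by (auto simp: H'_def intro: finite_subset)
  ultimately have "card H \<le> (q + 1) * card (insert v I)"
    using I by simp
  moreover have "\<forall>u\<in>insert v I. \<forall>w\<in>insert v I. \<not> A u w"
    using I sym irrefl by (auto simp: H'_def)
  moreover have "insert v I \<subseteq> H"
    using I step.hyps by (auto simp: H'_def)
  ultimately show ?case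
    by blast
qed simp

text \<open>The average degree is at most \<open>2 * q\<close>, so at least half of the vertices
  have degree at most \<open>4 * q\<close>; an independent set is taken among these. Its vertices
  are later sent to exceptional places of the host, where few adjacent vertices have to be
  respected.\<close>

lemma independent_low_degree_set:
  obtains I where "I \<subseteq> P" "card P \<le> 2 * (q + 1) * card I" "\<And>u v. u \<in> I \<Longrightarrow> v \<in> I \<Longrightarrow> \<not> A u v"
    "\<And>v. v \<in> I \<Longrightarrow> card (nbrs A v P) \<le> 4 * q"
proof -
  define L where "L = {v \<in> P. card (nbrs A v P) \<le> 4 * q}"
  have "(4 * q + 1) * card (P - L) = (\<Sum>v\<in>P - L. 4 * q + 1)"
    by simp
  also have "\<dots> \<le> (\<Sum>v\<in>P - L. card (nbrs A v P))"
    by (intro sum_mono) (auto simp: L_def)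
  also have "\<dots> \<le> (\<Sum>v\<in>P. card (nbrs A v P))"
    using fin by (intro sum_mono2) auto
  also have "\<dots> \<le> 2 * q * card P"
    by (rule sum_nbrs_le) simp
  finally have *: "(4 * q + 1) * card (P - L) \<le> 2 * q * card P" .
  have "card P = card (P - L) + card L"
    using fin by (metis (no_types, lifting) L_def card_Diff_subset card_mono finite_subset
        le_add_diff_inverse2 mem_Collect_eq subsetI)
  with * have "(2 * q + 1) * card (P - L) \<le> 2 * q * card L"
    by (simp add: algebra_simps)
  also have "\<dots> \<le> (2 * q + 1) * card L"
    by simp
  finally have "card (P - L) \<le> card L"
    by (rule mult_left_le_imp_le) simp
  then have L: "card P \<le> 2 * card L"
    using \<open>card P = card (P - L) + card L\<close> by simp
  obtain I where "I \<subseteq> L" "card L \<le> (q + 1) * card I" "\<forall>u\<in>I. \<forall>v\<in>I. \<not> A u v"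
    using independent_subset[of L] by (auto simp: L_def)
  then show thesis
    using L by (intro that[of I]) (auto simp: L_def)
qed

text \<open>Placing \<open>W\<close> in a degeneracy order ensures that each vertex meets at most
  \<open>q\<close> neighbours of \<open>W\<close> placed before it. Neighbours in the already
  embedded \<open>U\<close> are not controlled by the order and are left to the hypothesis
  \<open>step\<close>.\<close>

lemma extend_blue_emb:
  assumes "W \<subseteq> P" "U \<inter> W = {}" "blue_emb A R \<phi> U"
    and symR: "\<And>x y. R x y \<Longrightarrow> R y x"
    and step: "\<And>w W' \<psi>. w \<in> W \<Longrightarrow> W' \<subseteq> W - {w} \<Longrightarrow> card (nbrs A w W') \<le> q \<Longrightarrow>
      blue_emb A R \<psi> (U \<union> W') \<Longrightarrow> (\<forall>u\<in>U. \<psi> u = \<phi> u) \<Longrightarrow> (\<forall>u\<in>W'. \<psi> u \<in> T u) \<Longrightarrow>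
      \<exists>x\<in>T w. x \<notin> \<psi> ` (U \<union> W') \<and> (\<forall>u\<in>U \<union> W'. A w u \<longrightarrow> \<not> R (\<psi> u) x)"
  shows "\<exists>\<psi>. blue_emb A R \<psi> (U \<union> W) \<and> (\<forall>u\<in>U. \<psi> u = \<phi> u) \<and> (\<forall>u\<in>W. \<psi> u \<in> T u)"
proof -
  have "H \<subseteq> W \<longrightarrow>
    (\<exists>\<psi>. blue_emb A R \<psi> (U \<union> H) \<and> (\<forall>u\<in>U. \<psi> u = \<phi> u) \<and> (\<forall>u\<in>H. \<psi> u \<in> T u))"
    if "H \<subseteq> P" for H
    using that
  proof (induction rule: degenerate_induct)
    case empty
    then show ?case
      using assms(3) by auto
  next
    case (step H w)
    show ?case
    proof
      assume HW: "H \<subseteq> W"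
      define W' where "W' = H - {w}"
      obtain \<psi> where \<psi>: "blue_emb A R \<psi> (U \<union> W')" "\<forall>u\<in>U. \<psi> u = \<phi> u" "\<forall>u\<in>W'. \<psi> u \<in> T u"
        using step.IH[of W'] HW by (auto simp: W'_def)
      have "finite H"
        using step.hyps fin finite_subset by blast
      then have "card (nbrs A w W') \<le> q"
        using step.hyps(3) card_nbrs_mono[of H W' A w] by (auto simp: W'_def)
      then obtain x where x: "x \<in> T w" "x \<notin> \<psi> ` (U \<union> W')"
          "\<forall>u\<in>U \<union> W'. A w u \<longrightarrow> \<not> R (\<psi> u) x"
        using assms(5)[of w W' \<psi>] \<psi> step.hyps(2) HW by (auto simp: W'_def)
      have w: "w \<notin> U \<union> W'" "U \<union> H = insert w (U \<union> W')"
        using step.hyps(2) HW assms(2) by (auto simp: W'_def)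
      have "blue_emb A R (\<psi>(w := x)) (U \<union> H)"
        unfolding w(2) using x(2,3) w(1) by (intro blue_emb_insert[OF symR \<psi>(1)]) auto
      moreover have "\<forall>u\<in>U. (\<psi>(w := x)) u = \<phi> u" "\<forall>u\<in>H. (\<psi>(w := x)) u \<in> T u"
        using \<psi> x w by (auto simp: W'_def)
      ultimately show "\<exists>\<psi>. blue_emb A R \<psi> (U \<union> H) \<and> (\<forall>u\<in>U. \<psi> u = \<phi> u) \<and> (\<forall>u\<in>H. \<psi> u \<in> T u)"
        by blast
    qed
  qed
  then show ?thesis
    using assms(1) by blast
qed

text \<open>Four kinds of places in \<open>T w\<close> are forbidden: images of \<open>U\<close>,
  images of vertices of \<open>W\<close> competing for \<open>T w\<close>, red neighbours of images
  of neighbours in \<open>U\<close> (at most \<open>a w\<close>), and red neighbours of at most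
  \<open>q\<close> newly placed neighbours (at most \<open>b w\<close> each). The hypothesis
  \<open>room\<close> says that they do not exhaust \<open>T w\<close>.\<close>

lemma extend_blue_emb_count:
  fixes a b :: "'a \<Rightarrow> real"
  assumes "W \<subseteq> P" "U \<inter> W = {}" "blue_emb A R \<phi> U" "finite U"
    and symR: "\<And>x y. R x y \<Longrightarrow> R y x"
    and finT: "\<And>w. w \<in> W \<Longrightarrow> finite (T w)"
    and room: "\<And>w. w \<in> W \<Longrightarrow> rcard (\<phi> ` U \<inter> T w)
      + rcard {w' \<in> W - {w}. T w' \<inter> T w \<noteq> {}} + a w + real q * b w < rcard (T w)"
    and old: "\<And>w. w \<in> W \<Longrightarrow> rcard {x \<in> T w. \<exists>u\<in>U. A w u \<and> R (\<phi> u) x} \<le> a w"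
    and new: "\<And>w w' y. w \<in> W \<Longrightarrow> w' \<in> W \<Longrightarrow> A w w' \<Longrightarrow> y \<in> T w' \<Longrightarrow>
      rdeg R y (T w) \<le> b w"
    and b0: "\<And>w. w \<in> W \<Longrightarrow> 0 \<le> b w"
  shows "\<exists>\<psi>. blue_emb A R \<psi> (U \<union> W) \<and> (\<forall>u\<in>U. \<psi> u = \<phi> u) \<and> (\<forall>u\<in>W. \<psi> u \<in> T u)"
proof (rule extend_blue_emb[OF assms(1-3) symR])
  fix w W' \<psi>
  assume w: "w \<in> W" and W': "W' \<subseteq> W - {w}" and deg: "card (nbrs A w W') \<le> q"
    and \<psi>: "blue_emb A R \<psi> (U \<union> W')" "\<forall>u\<in>U. \<psi> u = \<phi> u" "\<forall>u\<in>W'. \<psi> u \<in> T u"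
  have fW: "finite W" "finite W'"
    using assms(1) W' fin by (auto intro: finite_subset)
  define B1 where "B1 = \<phi> ` U \<inter> T w"
  define B2 where "B2 = \<psi> ` {w' \<in> W - {w}. T w' \<inter> T w \<noteq> {}}"
  define B3 where "B3 = {x \<in> T w. \<exists>u\<in>U. A w u \<and> R (\<phi> u) x}"
  define B4 where "B4 = (\<Union>w'\<in>nbrs A w W'. nbrs R (\<psi> w') (T w))"
  have "card B2 \<le> card {w' \<in> W - {w}. T w' \<inter> T w \<noteq> {}}"
    unfolding B2_def using fW by (intro card_image_le) auto
  moreover have "rcard B4 \<le> real q * b w"
  proof -
    have "rcard B4 \<le> rdeg A w W' * b w"
      unfolding B4_def
    proof (rule card_UN_bound)
      fix w' assume "w' \<in> nbrs A w W'"
      then show "rdeg R (\<psi> w') (T w) \<le> b w"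
        using \<psi>(3) W' w by (intro new[of w w']) auto
    qed (use fW in simp)
    also have "\<dots> \<le> real q * b w"
      using deg b0[OF w] by (simp add: mult_right_mono)
    finally show ?thesis .
  qed
  moreover have "card (B1 \<union> B2 \<union> B3 \<union> B4) \<le> card B1 + card B2 + card B3 + card B4"
    using card_Un_le[of "B1 \<union> B2 \<union> B3" B4] card_Un_le[of "B1 \<union> B2" B3] card_Un_le[of B1 B2]
    by linarith
  ultimately have "card (B1 \<union> B2 \<union> B3 \<union> B4) < card (T w)"
    using room[OF w] old[OF w] unfolding B1_def B3_def by linarith
  moreover have "finite (B1 \<union> B2 \<union> B3 \<union> B4)"
    using fW finT[OF w] assms(4) by (auto simp: B1_def B2_def B3_def B4_def)
  ultimately obtain x where x: "x \<in> T w" "x \<notin> B1 \<union> B2 \<union> B3 \<union> B4"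
    by (metis card_mono leD subsetI)
  have "x \<notin> \<psi> ` (U \<union> W')"
  proof
    assume "x \<in> \<psi> ` (U \<union> W')"
    then obtain u where u: "u \<in> U \<union> W'" "x = \<psi> u"
      by blast
    show False
    proof (cases "u \<in> U")
      case True
      then show False
        using u x \<psi>(2) by (auto simp: B1_def)
    next
      case False
      then have "u \<in> {w' \<in> W - {w}. T w' \<inter> T w \<noteq> {}}"
        using u \<psi>(3) W' x(1) by auto
      then show False
        using u x by (auto simp: B2_def)
    qed
  qed
  moreover have "\<not> R (\<psi> u) x" if "u \<in> U \<union> W'" "A w u" for u
    using that x \<psi>(2) by (auto simp: B3_def B4_def)
  ultimately show "\<exists>x\<in>T w. x \<notin> \<psi> ` (U \<union> W') \<and> (\<forall>u\<in>U \<union> W'. A w u \<longrightarrow> \<not> R (\<psi> u) x)"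
    using x(1) by blast
qed

end

section \<open>Red cliques and nearly blue sets\<close>

text \<open>A vertex of \<open>V\<close> outside this set sees more than a proportion
  \<open>t\<close> of \<open>Q\<close> in red, so adding it to a red clique keeps that proportion of
  \<open>Q\<close> available.\<close>

definition dominated :: "'b set \<Rightarrow> ('b \<Rightarrow> 'b \<Rightarrow> bool) \<Rightarrow> real \<Rightarrow> 'b set \<Rightarrow> 'b set" where
  "dominated V R t Q = {y \<in> V. rdeg R y Q \<le> t * rcard Q}"

definition nearly_blue :: "('b \<Rightarrow> 'b \<Rightarrow> bool) \<Rightarrow> real \<Rightarrow> 'b set \<Rightarrow> bool" where
  "nearly_blue R a Q \<longleftrightarrow> (\<forall>x\<in>Q. rdeg R x Q \<le> a * rcard Q)"

definition common_nbrs :: "'b set \<Rightarrow> ('b \<Rightarrow> 'b \<Rightarrow> bool) \<Rightarrow> 'b set \<Rightarrow> 'b set" where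
  "common_nbrs V R X = {y \<in> V. \<forall>x\<in>X. R x y}"

definition red_clique :: "('b \<Rightarrow> 'b \<Rightarrow> bool) \<Rightarrow> 'b set \<Rightarrow> bool" where
  "red_clique R X \<longleftrightarrow> (\<forall>x\<in>X. \<forall>y\<in>X. x \<noteq> y \<longrightarrow> R x y)"

text \<open>A one-sided form of regularity: passing to a large subset of \<open>Q\<close> leaves almost every vertex
  outside \<open>dominated V R t Q\<close> outside.\<close>

definition stable :: "'b set \<Rightarrow> ('b \<Rightarrow> 'b \<Rightarrow> bool) \<Rightarrow> nat \<Rightarrow> real \<Rightarrow> real \<Rightarrow> 'b set \<Rightarrow> bool" where
  "stable V R p e t Q \<longleftrightarrow> (\<forall>Q'\<subseteq>Q. t ^ p * rcard Q \<le> rcard Q' \<longrightarrow>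
     rcard (dominated V R t Q' - dominated V R t Q) \<le> e * rcard V)"

lemma dominated_subset: "dominated V R t Q \<subseteq> V"
  by (auto simp: dominated_def)

lemma dominated_mono: "s \<le> t \<Longrightarrow> dominated V R s Q \<subseteq> dominated V R t Q"
  using mult_right_mono[of s t "rcard Q"] by (auto simp: dominated_def)

lemma common_nbrs_subset: "common_nbrs V R X \<subseteq> V"
  by (auto simp: common_nbrs_def)

lemma common_nbrs_insert: "common_nbrs V R (insert x X) = nbrs R x (common_nbrs V R X)"
  by (auto simp: common_nbrs_def)

context sgraph
begin

lemma red_clique_insert:
  assumes "red_clique E X" "x \<in> common_nbrs V E X"
  shows "red_clique E (insert x X)" "x \<notin> X"
  using assms sym irrefl unfolding red_clique_def common_nbrs_def by blast+

lemma finite_dominated: "finite (dominated V E t Q)"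
  using fin dominated_subset finite_subset by metis

text \<open>Each failure of stability moves \<open>e |V|\<close> vertices into the dominated set at the next larger
  threshold, so this can happen only boundedly often.\<close>

lemma stable_step:
  fixes d e :: real and p k :: nat
  defines "T \<equiv> \<lambda>k. d ^ ((p + 1) ^ k)"
  assumes d: "0 < d" "d \<le> 1" and Q: "Q\<^sub>0 \<subseteq> V" "Q\<^sub>0 \<noteq> {}"
  shows "(\<exists>Q\<subseteq>Q\<^sub>0. \<exists>t. (\<Prod>j<k. T j ^ p) * rcard Q\<^sub>0 \<le> rcard Q \<and> T k \<le> t \<and> t \<le> d
      \<and> stable V E p e t Q) \<or> rcard (dominated V E (T k) Q\<^sub>0) + real k * e * rcard V \<le> rcard V"
  using Q
proof (induction k arbitrary: Q\<^sub>0)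
  case 0
  have "card (dominated V E (T 0) Q\<^sub>0) \<le> card V"
    using fin by (intro card_mono dominated_subset)
  then show ?case
    by simp
next
  case (Suc k)
  have T: "0 < T i" "T i \<le> 1" "T i \<le> d" "T (Suc i) \<le> T i" for i
  proof -
    show "0 < T i" "T i \<le> 1"
      using d by (auto simp: T_def intro: power_le_one)
    show "T i \<le> d"
      using d power_decreasing[of 1 "(p + 1) ^ i" d] by (simp add: T_def)
    show "T (Suc i) \<le> T i"
      using d power_decreasing[of "(p + 1) ^ i" "(p + 1) ^ Suc i" d] by (simp add: T_def)
  qed
  \<comment> \<open>The reason for the exponents \<open>(p + 1) ^ k\<close>: restricting to a subset
    with share \<open>T k ^ p\<close> of the set raises a relative degree of at most
    \<open>T (Suc k)\<close> to at most \<open>T k\<close>.\<close>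
  have TSuc: "T (Suc i) = T i ^ p * T i" for i
  proof -
    have "T (Suc i) = T i ^ (p + 1)"
      unfolding T_def by (metis power_Suc2 power_mult)
    then show ?thesis
      by simp
  qed
  have fQ: "finite Q\<^sub>0"
    using Suc.prems fin finite_subset by blast
  have T0: "0 \<le> T i" for i
    using T(1)[of i] by simp
  have prod1: "(\<Prod>j<i. T j ^ p) \<le> 1" "0 \<le> (\<Prod>j<i. T j ^ p)" for i
    using T(2) T0 by (auto intro!: prod_le_1 power_le_one prod_nonneg zero_le_power)
  show ?case
  proof (cases "stable V E p e (T k) Q\<^sub>0")
    case True
    have "(\<Prod>j<Suc k. T j ^ p) * rcard Q\<^sub>0 \<le> rcard Q\<^sub>0"
      by (rule mult_left_le_one_le[OF _ prod1(2) prod1(1)]) simp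
    then show ?thesis
      using True T by blast
  next
    case False
    then obtain Q' where Q': "Q' \<subseteq> Q\<^sub>0" "T k ^ p * rcard Q\<^sub>0 \<le> rcard Q'"
        "e * rcard V < rcard (dominated V E (T k) Q' - dominated V E (T k) Q\<^sub>0)"
      by (auto simp: stable_def not_le)
    have "0 < T k ^ p * rcard Q\<^sub>0"
      using T fQ Suc.prems by (auto simp: card_gt_0_iff)
    then have "Q' \<noteq> {}"
      using Q'(2) by auto
    have sub: "dominated V E (T (Suc k)) Q\<^sub>0 \<subseteq> dominated V E (T k) Q'"
    proof
      fix y
      assume y: "y \<in> dominated V E (T (Suc k)) Q\<^sub>0"
      have "rdeg E y Q' \<le> rdeg E y Q\<^sub>0"
        using card_nbrs_mono[OF fQ Q'(1)] by simp
      also have "\<dots> \<le> T k * (T k ^ p * rcard Q\<^sub>0)"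
        using y by (simp add: dominated_def TSuc ac_simps)
      also have "\<dots> \<le> T k * rcard Q'"
        using Q'(2) T(1)[of k] by (intro mult_left_mono) auto
      finally show "y \<in> dominated V E (T k) Q'"
        using y by (simp add: dominated_def)
    qed
    have "dominated V E (T (Suc k)) Q\<^sub>0 \<inter> (dominated V E (T k) Q' - dominated V E (T k) Q\<^sub>0) = {}"
      using dominated_mono[OF T(4)[of k], of V E Q\<^sub>0] by blast
    then have "card (dominated V E (T (Suc k)) Q\<^sub>0)
        + card (dominated V E (T k) Q' - dominated V E (T k) Q\<^sub>0)
        = card (dominated V E (T (Suc k)) Q\<^sub>0 \<union> (dominated V E (T k) Q' - dominated V E (T k) Q\<^sub>0))"
      by (simp add: card_Un_disjoint finite_dominated)
    also have "\<dots> \<le> card (dominated V E (T k) Q')"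
      using sub by (intro card_mono finite_dominated) auto
    finally have grow: "rcard (dominated V E (T (Suc k)) Q\<^sub>0) + e * rcard V
        \<le> rcard (dominated V E (T k) Q')"
      using Q'(3) by linarith
    consider (a) Q t where "Q \<subseteq> Q'" "(\<Prod>j<k. T j ^ p) * rcard Q' \<le> rcard Q"
        "T k \<le> t" "t \<le> d" "stable V E p e t Q"
      | (b) "rcard (dominated V E (T k) Q') + real k * e * rcard V \<le> rcard V"
      using Suc.IH[of Q'] Q'(1) Suc.prems(1) \<open>Q' \<noteq> {}\<close> by blast
    then show ?thesis
    proof cases
      case a
      have "(\<Prod>j<Suc k. T j ^ p) * rcard Q\<^sub>0 = (\<Prod>j<k. T j ^ p) * (T k ^ p * rcard Q\<^sub>0)"
        by simp
      also have "\<dots> \<le> (\<Prod>j<k. T j ^ p) * rcard Q'"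
        using Q'(2) prod1 by (intro mult_left_mono)
      finally show ?thesis
        using a Q'(1) T(4)[of k] by (intro disjI1 exI[of _ Q] conjI exI[of _ t]) auto
    next
      case b
      then show ?thesis
        using grow by (simp add: algebra_simps)
    qed
  qed
qed

end

text \<open>Once \<open>k * e > 1\<close>, the second alternative of \<open>stable_step\<close>
  would require more than \<open>|V|\<close> vertices. The share \<open>r\<close> and the threshold
  \<open>t\<^sub>0\<close> are fixed before the graph is known.\<close>

lemma stable_subset_exists:
  fixes d e :: real and p :: nat
  assumes "0 < d" "d \<le> 1" "0 < e"
  obtains r t\<^sub>0 where "0 < r" "r \<le> 1" "0 < t\<^sub>0" "t\<^sub>0 \<le> d"
    "\<And>(V :: 'b set) R Q\<^sub>0. sgraph V R \<Longrightarrow> Q\<^sub>0 \<subseteq> V \<Longrightarrow> Q\<^sub>0 \<noteq> {} \<Longrightarrow>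
      \<exists>Q\<subseteq>Q\<^sub>0. \<exists>t. r * rcard Q\<^sub>0 \<le> rcard Q \<and> t\<^sub>0 \<le> t \<and> t \<le> d \<and> stable V R p e t Q"
proof -
  define T where "T k = d ^ ((p + 1) ^ k)" for k
  obtain k :: nat where k: "1 < real k * e"
    using assms(3) reals_Archimedean3 by blast
  have T: "0 < T i" "T i \<le> 1" for i
    using assms by (auto simp: T_def intro: power_le_one)
  show thesis
  proof (rule that[of "\<Prod>j<k. T j ^ p" "T k"])
    have T0: "0 \<le> T i" for i
      using T(1)[of i] by simp
    show "0 < (\<Prod>j<k. T j ^ p)" "(\<Prod>j<k. T j ^ p) \<le> 1"
      using T T0 by (auto intro!: prod_pos prod_le_1 power_le_one zero_le_power)
    show "0 < T k"
      by (rule T)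
    show "T k \<le> d"
      using assms power_decreasing[of 1 "(p + 1) ^ k" d] by (simp add: T_def)
    fix V :: "'b set" and R Q\<^sub>0
    assume Q: "sgraph V R" "Q\<^sub>0 \<subseteq> V" "Q\<^sub>0 \<noteq> {}"
    then have "0 < card V"
      using sgraph.fin by (fastforce simp: card_gt_0_iff)
    then have "rcard V < real k * e * rcard V"
      using k by simp
    then have "\<not> rcard (dominated V R (T k) Q\<^sub>0) + real k * e * rcard V \<le> rcard V"
      by linarith
    then show "\<exists>Q\<subseteq>Q\<^sub>0. \<exists>t. (\<Prod>j<k. T j ^ p) * rcard Q\<^sub>0 \<le> rcard Q \<and> T k \<le> t \<and> t \<le> d
        \<and> stable V R p e t Q"
      using sgraph.stable_step[OF Q(1) assms(1,2) Q(2,3), where e = e and p = p and k = k]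
      unfolding T_def by blast
  qed
qed

section \<open>Nearly blue sets and red cliques in a hypothetical counterexample\<close>

text \<open>A hypothetical failure of the upper bound, for the constant \<open>\<kappa>\<close>; the map \<open>f\<close> in the last
  assumption labels the components that remain after removing the separator \<open>S\<close>.\<close>

locale ramsey_instance = G: degenerate_graph P A q + H: sgraph V R
  for P :: "'a set" and A q and V :: "'b set" and R +
  fixes p :: nat and \<kappa> :: real
  assumes p2: "2 \<le> p"
    and card_V: "card V = p * (card P - 1) + 1"
    and large: "1 \<le> \<kappa> * rcard P"
    and book_free: "X \<subseteq> V \<Longrightarrow> red_clique R X \<Longrightarrow> card X = p \<Longrightarrow>
      rcard (common_nbrs V R X) \<le> \<kappa> * rcard P"
    and no_emb: "\<phi> ` P \<subseteq> V \<Longrightarrow> \<not> blue_emb A R \<phi> P"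
    and splits: "\<exists>S\<subseteq>P. \<exists>f :: 'a \<Rightarrow> 'a set. rcard S \<le> \<kappa> * rcard P
      \<and> (\<forall>u\<in>P - S. \<forall>v\<in>P - S. A u v \<longrightarrow> f u = f v)
      \<and> (\<forall>u\<in>P - S. rcard {v \<in> P - S. f v = f u} \<le> \<kappa> * rcard P)"
begin

abbreviation "n \<equiv> rcard P"

lemma n_pos: "0 < n"
  using large by (metis less_eq_real_def linorder_neqE_linordered_idom mult_zero_right not_one_le_zero
      of_nat_0_le_iff)

text \<open>All uses of \<kappa> are upper bounds by \<open>\<kappa> * n\<close>. An instance for a
  minimum of several constants is thus an instance for each of them.\<close>

lemma mono: "\<kappa> \<le> \<kappa>' \<Longrightarrow> ramsey_instance P A q V R p \<kappa>'"
proof -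
  assume "\<kappa> \<le> \<kappa>'"
  then have *: "\<kappa> * n \<le> \<kappa>' * n"
    using n_pos by (intro mult_right_mono) auto
  obtain S and f :: "'a \<Rightarrow> 'a set" where Sf: "S \<subseteq> P" "rcard S \<le> \<kappa> * n"
      "\<forall>u\<in>P - S. \<forall>v\<in>P - S. A u v \<longrightarrow> f u = f v"
      "\<forall>u\<in>P - S. rcard {v \<in> P - S. f v = f u} \<le> \<kappa> * n"
    using splits by blast
  show ?thesis
  proof unfold_locales
    show "1 \<le> \<kappa>' * n"
      using large * by linarith
    show "rcard (common_nbrs V R X) \<le> \<kappa>' * n" if "X \<subseteq> V" "red_clique R X" "card X = p" for X
      using book_free[OF that] * by linarith
    show "\<exists>S\<subseteq>P. \<exists>f :: 'a \<Rightarrow> 'a set. rcard S \<le> \<kappa>' * n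
      \<and> (\<forall>u\<in>P - S. \<forall>v\<in>P - S. A u v \<longrightarrow> f u = f v)
      \<and> (\<forall>u\<in>P - S. rcard {v \<in> P - S. f v = f u} \<le> \<kappa>' * n)"
      using Sf * by (intro exI[of _ S] conjI exI[of _ f]) force+
  qed (use p2 card_V no_emb in auto)
qed

lemma card_V_bounds: "rcard V \<le> real p * n" "real p * n - real p < rcard V"
proof -
  have "1 \<le> card P"
    using n_pos by (simp add: Suc_le_eq card_gt_0_iff)
  then have "rcard V = real p * (n - 1) + 1"
    using card_V by (simp add: of_nat_diff)
  then show "rcard V \<le> real p * n" "real p * n - real p < rcard V"
    using p2 by (auto simp: algebra_simps)
qed

lemma finite_sub: "Q \<subseteq> V \<Longrightarrow> finite Q"
  using H.fin finite_subset by blast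

text \<open>If \<open>U\<close> is not nearly blue, some \<open>x\<close> in \<open>U\<close> has
  more than \<open>a * |U|\<close> red neighbours there; \<open>x\<close> joins the clique
  \<open>X\<close>, and its red neighbourhood replaces \<open>U\<close>. Here \<open>j\<close>
  counts the vertices still missing from a \<open>p\<close>-clique, and at \<open>j = 0\<close> the
  size of \<open>U\<close> contradicts \<open>book_free\<close>.\<close>

lemma nearly_blue_subset_aux:
  assumes "0 < a" "a \<le> 1"
  shows "X \<subseteq> V \<Longrightarrow> red_clique R X \<Longrightarrow> card X + j = p \<Longrightarrow> U \<subseteq> common_nbrs V R X \<Longrightarrow>
    \<kappa> * n < a ^ j * rcard U \<Longrightarrow>
    \<exists>Q\<subseteq>U. nearly_blue R a Q \<and> a ^ j * rcard U \<le> rcard Q"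
proof (induction j arbitrary: X U)
  case 0
  then have "card U \<le> card (common_nbrs V R X)"
    using finite_sub[OF common_nbrs_subset] by (intro card_mono) auto
  then show ?case
    using book_free[of X] 0 by auto
next
  case (Suc j)
  show ?case
  proof (cases "nearly_blue R a U")
    case True
    have "a ^ Suc j * rcard U \<le> rcard U"
      using assms by (intro mult_left_le_one_le power_le_one) auto
    then show ?thesis
      using True by blast
  next
    case False
    then obtain x where x: "x \<in> U" "a * rcard U < rdeg R x U"
      by (auto simp: nearly_blue_def not_le)
    have xX: "red_clique R (insert x X)" "x \<notin> X"
      using H.red_clique_insert[of X x] Suc.prems x by auto
    have le: "a ^ Suc j * rcard U \<le> a ^ j * rdeg R x U"
      using x(2) assms mult_left_mono[of "a * rcard U" "rdeg R x U" "a ^ j"]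
      by (simp add: ac_simps)
    have "x \<in> V" "finite X"
      using x Suc.prems common_nbrs_subset[of V R X] finite_sub by auto
    then have "\<exists>Q\<subseteq>nbrs R x U. nearly_blue R a Q \<and> a ^ j * rdeg R x U \<le> rcard Q"
      using xX le Suc.prems common_nbrs_insert[of V R x X]
      by (intro Suc.IH[of "insert x X"]) (auto simp: subset_iff)
    then show ?thesis
      using le nbrs_subset[of R x U] by (meson order_trans)
  qed
qed

text \<open>The construction starts at the empty clique, whose common neighbourhood is all of
  \<open>V\<close>.\<close>

lemma nearly_blue_subset:
  assumes "0 < a" "a \<le> 1" "U \<subseteq> V" "\<kappa> * n < a ^ p * rcard U"
  shows "\<exists>Q\<subseteq>U. nearly_blue R a Q \<and> a ^ p * rcard U \<le> rcard Q"
  using assms by (intro nearly_blue_subset_aux[of a "{}"]) (auto simp: red_clique_def common_nbrs_def)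

text \<open>Nearly blue sets are split off as long as \<open>s\<close> vertices remain. Their sizes
  are bounded below in terms of \<open>s\<close>, not of the shrinking remainder, which later bounds
  the number of blocks.\<close>

lemma nearly_blue_cover:
  assumes "0 < a" "a \<le> 1" "0 < s" "\<kappa> * n < a ^ p * s" "U \<subseteq> V"
  shows "\<exists>\<C>. finite \<C> \<and> disjoint \<C> \<and> \<Union>\<C> \<subseteq> U \<and> rcard (U - \<Union>\<C>) < s \<and>
    (\<forall>C\<in>\<C>. nearly_blue R a C \<and> a ^ p * s \<le> rcard C)"
  using assms(5)
proof (induction "card U" arbitrary: U rule: less_induct)
  case less
  show ?case
  proof (cases "rcard U < s")
    case True
    then show ?thesis
      by (intro exI[of _ "{}"]) auto
  next
    case False
    then have le: "a ^ p * s \<le> a ^ p * rcard U"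
      using assms(1) by (intro mult_left_mono) auto
    then have "\<kappa> * n < a ^ p * rcard U"
      using assms(4) by linarith
    then obtain Q where Q: "Q \<subseteq> U" "nearly_blue R a Q" "a ^ p * rcard U \<le> rcard Q"
      using nearly_blue_subset[OF assms(1,2) less.prems] by blast
    have "0 < rcard Q"
      using large assms(4) le Q(3) by linarith
    then have "Q \<noteq> {}"
      by auto
    then have "card (U - Q) < card U"
      using Q(1) finite_sub[OF less.prems] by (intro psubset_card_mono) auto
    then obtain \<C> where \<C>: "finite \<C>" "disjoint \<C>" "\<Union>\<C> \<subseteq> U - Q" "rcard (U - Q - \<Union>\<C>) < s"
        "\<forall>C\<in>\<C>. nearly_blue R a C \<and> a ^ p * s \<le> rcard C"
      using less.hyps[of "U - Q"] less.prems by blast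
    have "U - \<Union>(insert Q \<C>) = U - Q - \<Union>\<C>"
      by auto
    moreover have "disjoint (insert Q \<C>)"
      using \<C>(2,3) by (auto simp: disjoint_def pairwise_def disjnt_def)
    ultimately show ?thesis
      using \<C> Q le by (intro exI[of _ "insert Q \<C>"]) auto
  qed
qed

text \<open>The red clique \<open>X\<close> is extended by a vertex \<open>x\<close> from the set
  with the largest index \<open>b\<close>. Since \<open>Q b\<close> avoids what the earlier sets
  dominate, \<open>x\<close> sees a share \<open>t j\<close> of each earlier \<open>Q j\<close>, and
  by stability also of its restriction to the common neighbours of \<open>X\<close>, unless
  \<open>x\<close> lies in a small exceptional set. By \<open>card X + card J = p + 1\<close>, one
  set is left when the clique has \<open>p\<close> vertices; it supplies the pages of a forbidden
  book.\<close>

lemma no_stable_chain: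
  fixes Q :: "nat \<Rightarrow> 'b set" and t e :: "nat \<Rightarrow> real"
  assumes "finite J" "J \<noteq> {}" "X \<subseteq> V" "red_clique R X" "card X + card J = p + 1"
    and "\<And>i. i \<in> J \<Longrightarrow> Q i \<subseteq> V \<and> 0 < t i \<and> t i \<le> 1 \<and> stable V R p (e i) (t i) (Q i)"
    and "\<And>i. i \<in> J \<Longrightarrow> t i ^ card X * rcard (Q i) \<le> rcard (Q i \<inter> common_nbrs V R X)"
    and "\<And>i j. i \<in> J \<Longrightarrow> j \<in> J \<Longrightarrow> j < i \<Longrightarrow> Q i \<inter> dominated V R (t j) (Q j) = {}"
    and "\<And>i j. i \<in> J \<Longrightarrow> j \<in> J \<Longrightarrow> j < i \<Longrightarrow>
      real p * (e j * rcard V) < t i ^ p * rcard (Q i)"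
    and "\<And>i. i \<in> J \<Longrightarrow> \<kappa> * n < t i ^ p * rcard (Q i)"
  shows False
  using assms
proof (induction arbitrary: X rule: finite_linorder_max_induct)
  case (insert b J)
  have fX: "finite X"
    using insert.prems(2) by (rule finite_sub)
  have "b \<notin> J"
    using insert.hyps by auto
  then have cX: "card X + card J = p"
    using insert.prems(4) insert.hyps(1) by simp
  have pw: "t i ^ p * rcard (Q i) \<le> t i ^ card X * rcard (Q i)" if "i \<in> insert b J" for i
    using insert.prems(5)[OF that] cX by (intro mult_right_mono power_decreasing) auto
  show ?case
  proof (cases "J = {}")
    case True
    then have "card X = p"
      using cX by simp
    moreover have "card (Q b \<inter> common_nbrs V R X) \<le> card (common_nbrs V R X)"
      using finite_sub[OF common_nbrs_subset] by (intro card_mono) auto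
    ultimately show False
      using book_free[of X] insert.prems(2,3) insert.prems(6)[of b] insert.prems(9)[of b] by simp
  next
    case False
    define Y where "Y j = Q j \<inter> common_nbrs V R X" for j
    define Exc where "Exc j = dominated V R (t j) (Y j) - dominated V R (t j) (Q j)" for j
    have Y: "t i ^ card X * rcard (Q i) \<le> rcard (Y i)" if "i \<in> insert b J" for i
      using insert.prems(6)[OF that] by (simp add: Y_def)
    have Exc: "rcard (Exc j) \<le> e j * rcard V" if "j \<in> J" for j
    proof -
      have "t j ^ p * rcard (Q j) \<le> rcard (Y j)"
        using pw[of j] Y[of j] that by simp
      then show ?thesis
        using insert.prems(5)[of j] that unfolding stable_def Exc_def by (auto simp: Y_def)
    qed
    \<comment> \<open>There are at most \<open>p\<close> exceptional sets, and each is smaller than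
      a \<open>p\<close>-th of the lower bound for \<open>Y b\<close>.\<close>
    have "real p * rcard (\<Union>j\<in>J. Exc j) \<le> real p * (\<Sum>j\<in>J. rcard (Exc j))"
      unfolding of_nat_sum[symmetric] using insert.hyps(1)
      by (intro mult_left_mono of_nat_mono card_UN_le) auto
    also have "\<dots> \<le> (\<Sum>j\<in>J. real p * (e j * rcard V))"
      unfolding sum_distrib_left using Exc by (intro sum_mono mult_left_mono) auto
    also have "\<dots> < (\<Sum>j\<in>J. t b ^ p * rcard (Q b))"
      using insert.prems(8)[of b] insert.hyps False by (intro sum_strict_mono) auto
    also have "\<dots> = rcard J * (t b ^ p * rcard (Q b))"
      by simp
    also have "\<dots> \<le> real p * (t b ^ p * rcard (Q b))"
      using cX insert.prems(5)[of b] by (intro mult_right_mono) auto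
    finally have "rcard (\<Union>j\<in>J. Exc j) < t b ^ p * rcard (Q b)"
      using p2 by simp
    then have "card (\<Union>j\<in>J. Exc j) < card (Y b)"
      using Y[of b] pw[of b] by simp
    moreover have "finite (\<Union>j\<in>J. Exc j)"
      using insert.hyps(1) H.finite_dominated by (auto simp: Exc_def)
    ultimately obtain x where x: "x \<in> Y b" "x \<notin> (\<Union>j\<in>J. Exc j)"
      by (metis card_mono leD subsetI)
    have xX: "red_clique R (insert x X)" "x \<notin> X"
      using H.red_clique_insert[of X x] insert.prems(3) x by (auto simp: Y_def)
    have xV: "x \<in> V"
      using x common_nbrs_subset[of V R X] by (auto simp: Y_def)
    show False
    proof (rule insert.IH[of "insert x X"])
      show "J \<noteq> {}" "insert x X \<subseteq> V" "red_clique R (insert x X)" "card (insert x X) + card J = p + 1"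
        using False xV xX insert.prems(2) fX cX by auto
      fix i assume i: "i \<in> J"
      show "Q i \<subseteq> V \<and> 0 < t i \<and> t i \<le> 1 \<and> stable V R p (e i) (t i) (Q i)"
        using insert.prems(5)[of i] i by simp
      show "\<kappa> * n < t i ^ p * rcard (Q i)"
        using insert.prems(9)[of i] i by simp
      have "x \<notin> dominated V R (t i) (Q i)"
        using insert.prems(7)[of b i] i insert.hyps x by (auto simp: Y_def)
      then have "t i * rcard (Y i) < rdeg R x (Y i)"
        using x(2) i xV by (auto simp: Exc_def dominated_def)
      moreover have "nbrs R x (Y i) = Q i \<inter> common_nbrs V R (insert x X)"
        by (auto simp: common_nbrs_insert Y_def)
      moreover have "t i ^ card (insert x X) * rcard (Q i) \<le> t i * rcard (Y i)"
        using Y[of i] i insert.prems(5)[of i] xX fX mult_left_mono[of _ _ "t i"] by simp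
      ultimately show "t i ^ card (insert x X) * rcard (Q i)
          \<le> rcard (Q i \<inter> common_nbrs V R (insert x X))"
        by simp
    next
      fix i j assume "i \<in> J" "j \<in> J" "j < i"
      then show "Q i \<inter> dominated V R (t j) (Q j) = {}"
        "real p * (e j * rcard V) < t i ^ p * rcard (Q i)"
        using insert.prems(7,8)[of i j] by simp_all
    qed
  qed
qed simp

end

text \<open>A subset with share \<open>r\<close> may multiply the relative red degrees by
  \<open>1 / r\<close>. Hence a nearly blue set for \<open>a * r\<close> is taken first and a stable
  subset of it second; the latter is still nearly blue for \<open>a\<close>.\<close>

lemma stable_nearly_blue_exists:
  fixes e d a u :: real and p :: nat
  assumes "0 < e" "0 < d" "d \<le> 1" "0 < a" "a \<le> 1" "0 < u"
  shows "\<exists>\<sigma> t\<^sub>0 \<kappa>. 0 < \<sigma> \<and> 0 < t\<^sub>0 \<and> t\<^sub>0 \<le> 1 \<and> 0 < \<kappa> \<and>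
    (\<forall>(P :: 'a set) A q (V :: 'b set) R U. ramsey_instance P A q V R p \<kappa> \<longrightarrow> U \<subseteq> V \<longrightarrow>
      u * rcard P \<le> rcard U \<longrightarrow>
      (\<exists>Q\<subseteq>U. \<exists>t. \<sigma> * rcard P \<le> rcard Q \<and> nearly_blue R a Q \<and> t\<^sub>0 \<le> t \<and> t \<le> d
        \<and> stable V R p e t Q))"
proof -
  obtain r t\<^sub>0 where r: "0 < r" "r \<le> 1" and t\<^sub>0: "0 < t\<^sub>0" "t\<^sub>0 \<le> d"
    and st: "\<And>(V :: 'b set) R Q\<^sub>0. sgraph V R \<Longrightarrow> Q\<^sub>0 \<subseteq> V \<Longrightarrow> Q\<^sub>0 \<noteq> {} \<Longrightarrow>
      \<exists>Q\<subseteq>Q\<^sub>0. \<exists>t. r * rcard Q\<^sub>0 \<le> rcard Q \<and> t\<^sub>0 \<le> t \<and> t \<le> d \<and> stable V R p e t Q"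
    using stable_subset_exists[OF assms(2,3,1), of p] by metis
  define c where "c = (a * r) ^ p"
  have c: "0 < c"
    using assms r by (simp add: c_def)
  have ar: "0 < a * r" "a * r \<le> 1"
    using assms r by (auto intro: mult_le_one)
  show ?thesis
  \<comment> \<open>Halving \<open>c * u\<close> gives the strict inequality that
    \<open>nearly_blue_subset\<close> asks for.\<close>
  proof (rule exI[of _ "r * (c * u)"], rule exI[of _ t\<^sub>0], rule exI[of _ "c * u / 2"],
      intro conjI allI impI)
    show "0 < r * (c * u)" "0 < t\<^sub>0" "t\<^sub>0 \<le> 1" "0 < c * u / 2"
      using r c t\<^sub>0 assms by auto
    fix P :: "'a set" and A q and V :: "'b set" and R U
    assume *: "ramsey_instance P A q V R p (c * u / 2)" "U \<subseteq> V" "u * rcard P \<le> rcard U"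
    interpret ramsey_instance P A q V R p "c * u / 2"
      by (fact *)
    have cU: "c * u * n \<le> c * rcard U"
      using *(3) c mult_left_mono[of "u * n" _ c] by (simp add: ac_simps)
    moreover have "0 < c * u * n"
      using c assms n_pos by simp
    ultimately have "c * u / 2 * n < (a * r) ^ p * rcard U"
      unfolding c_def[symmetric] by simp
    then obtain Q where Q: "Q \<subseteq> U" "nearly_blue R (a * r) Q" "c * rcard U \<le> rcard Q"
      using nearly_blue_subset[OF ar *(2)] by (auto simp: c_def)
    have "0 < rcard Q"
      using Q(3) cU \<open>0 < c * u * n\<close> by linarith
    then have "Q \<noteq> {}" "finite Q"
      using card_gt_0_iff[of Q] by auto
    then obtain Q' t where Q': "Q' \<subseteq> Q" "r * rcard Q \<le> rcard Q'" "t\<^sub>0 \<le> t" "t \<le> d"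
        "stable V R p e t Q'"
      using st[of V R Q] H.sgraph_axioms Q(1) *(2) by blast
    have "nearly_blue R a Q'"
      unfolding nearly_blue_def
    proof
      fix x assume "x \<in> Q'"
      then have "rdeg R x Q' \<le> a * r * rcard Q"
        using Q(2) Q'(1) card_nbrs_mono[OF \<open>finite Q\<close> Q'(1), of R x]
        unfolding nearly_blue_def by (meson of_nat_mono order_trans subsetD)
      also have "\<dots> \<le> a * rcard Q'"
        using Q'(2) assms by (simp add: mult.assoc mult_left_mono)
      finally show "rdeg R x Q' \<le> a * rcard Q'" .
    qed
    moreover have "r * (c * u) * n \<le> rcard Q'"
    proof -
      have "r * (c * u) * n \<le> r * rcard Q"
        using r cU Q(3) mult_left_mono[of "c * u * n" "rcard Q" r] by (simp add: ac_simps)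
      then show ?thesis
        using Q'(2) by linarith
    qed
    ultimately show "\<exists>Q\<subseteq>U. \<exists>t. r * (c * u) * n \<le> rcard Q \<and> nearly_blue R a Q \<and> t\<^sub>0 \<le> t \<and> t \<le> d
        \<and> stable V R p e t Q"
      using Q' Q(1) by blast
  qed
qed

section \<open>Using the separator\<close>

text \<open>Greedy packing: if an item of size at most \<open>h\<close> fits into no bin, every bin
  is filled to more than its capacity minus \<open>h\<close>, which exceeds the total size of the
  items.\<close>

lemma bin_assignment:
  fixes w :: "'l \<Rightarrow> real" and cap :: "'c \<Rightarrow> real"
  assumes "finite L" "finite \<C>" "\<C> \<noteq> {}" "\<And>l. l \<in> L \<Longrightarrow> 0 \<le> w l \<and> w l \<le> h"
    and "\<And>C. C \<in> \<C> \<Longrightarrow> 0 \<le> cap C"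
    and "(\<Sum>l\<in>L. w l) + rcard \<C> * h \<le> (\<Sum>C\<in>\<C>. cap C)"
  shows "\<exists>a. a ` L \<subseteq> \<C> \<and> (\<forall>C\<in>\<C>. (\<Sum>l | l \<in> L \<and> a l = C. w l) \<le> cap C)"
  using assms
proof (induction L rule: finite_induct)
  case empty
  then show ?case
    by auto
next
  case (insert l L)
  have wl: "0 \<le> w l" "w l \<le> h"
    using insert.prems(3)[of l] by auto
  have total: "(\<Sum>l\<in>L. w l) + w l + rcard \<C> * h \<le> (\<Sum>C\<in>\<C>. cap C)"
    using insert.prems(5) insert.hyps by simp
  obtain a where a: "a ` L \<subseteq> \<C>" "\<And>C. C \<in> \<C> \<Longrightarrow> (\<Sum>k | k \<in> L \<and> a k = C. w k) \<le> cap C"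
    using insert.IH[OF insert.prems(1,2)] insert.prems(3,4) total wl by force
  define load where "load C = (\<Sum>k | k \<in> L \<and> a k = C. w k)" for C
  have "\<exists>C\<in>\<C>. load C + w l \<le> cap C"
  proof (rule ccontr)
    assume *: "\<not> (\<exists>C\<in>\<C>. load C + w l \<le> cap C)"
    have "(\<Sum>C\<in>\<C>. cap C) < (\<Sum>C\<in>\<C>. load C + h)"
      using * wl insert.prems(1,2) by (intro sum_strict_mono) force+
    also have "\<dots> = (\<Sum>C\<in>\<C>. load C) + rcard \<C> * h"
      by (simp add: sum.distrib)
    also have "(\<Sum>C\<in>\<C>. load C) = (\<Sum>l\<in>L. w l)"
      unfolding load_def using insert.hyps insert.prems(1) a(1) by (intro sum.group)
    finally show False
      using total wl by linarith
  qed
  then obtain C where C: "C \<in> \<C>" "load C + w l \<le> cap C"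
    by blast
  have "(\<Sum>k | k \<in> insert l L \<and> (a(l := C)) k = D. w k) \<le> cap D" if "D \<in> \<C>" for D
  proof (cases "D = C")
    case True
    have "{k. k \<in> insert l L \<and> (a(l := C)) k = D} = insert l {k \<in> L. a k = C}"
      using True insert.hyps by auto
    then show ?thesis
      using C True insert.hyps by (simp add: load_def)
  next
    case False
    have "{k. k \<in> insert l L \<and> (a(l := C)) k = D} = {k \<in> L. a k = D}"
      using False insert.hyps by auto
    then show ?thesis
      using a(2)[OF that] by simp
  qed
  then show ?case
    using a(1) C(1) by (intro exI[of _ "a(l := C)"]) auto
qed

context ramsey_instance
begin

text \<open>If a nearly blue set \<open>Q\<close> dominated more than \<open>(1 + \<epsilon>) n\<close> vertices, then the separator would fit
  into \<open>Q\<close> and the small components into nearly blue blocks covering the dominated vertices.\<close>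

lemma card_dominated_less:
  fixes \<epsilon> \<sigma> :: real
  defines "g \<equiv> \<epsilon> / (64 * (real q + 1))"
  defines "\<tau> \<equiv> g ^ p * (\<epsilon> / 4)"
  assumes \<epsilon>: "0 < \<epsilon>" "\<epsilon> \<le> 1" and \<sigma>: "0 < \<sigma>"
    and \<kappa>: "\<kappa> \<le> \<sigma> / 8" "\<kappa> \<le> \<epsilon> * \<tau> / 64" "\<kappa> \<le> \<epsilon> * \<tau> / (2 * real p)"
    and Q: "Q \<subseteq> V" "\<sigma> * n \<le> rcard Q" "nearly_blue R (1 / (8 * (real q + 1))) Q"
  shows "rcard (dominated V R (g * \<tau> / (2 * real p)) Q) < (1 + \<epsilon>) * n"
proof (rule ccontr)
  define \<delta> where "\<delta> = g * \<tau> / (2 * real p)"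
  define U where "U = dominated V R \<delta> Q"
  assume "\<not> ?thesis"
  then have U: "(1 + \<epsilon>) * n \<le> rcard U" "U \<subseteq> V"
    by (auto simp: U_def \<delta>_def not_less dominated_subset)
  have p: "0 < real p"
    using p2 by simp
  have g: "0 < g" "g \<le> 1" "64 * (real q * g) \<le> \<epsilon>"
    using \<epsilon> by (auto simp: g_def field_simps)
  have \<tau>: "0 < \<tau>"
    using g \<epsilon> by (simp add: \<tau>_def)
  have \<tau>n: "0 < \<tau> * n"
    using \<tau> n_pos by simp
  have "\<epsilon> * \<tau> / 64 < \<tau>"
    using \<epsilon> \<tau> mult_right_mono[of \<epsilon> 1 \<tau>] by simp
  then have "\<kappa> < \<tau>"
    using \<kappa>(2) by linarith
  then have "\<kappa> * n < \<tau> * n"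
    using n_pos by (rule mult_strict_right_mono)
  then have "\<kappa> * n < g ^ p * (\<epsilon> / 4 * n)"
    by (simp add: \<tau>_def mult.assoc)
  moreover have "0 < \<epsilon> / 4 * n"
    using \<epsilon> n_pos by simp
  ultimately obtain \<C> where \<C>: "finite \<C>" "disjoint \<C>" "\<Union>\<C> \<subseteq> U" "rcard (U - \<Union>\<C>) < \<epsilon> / 4 * n"
    and blk: "\<And>C. C \<in> \<C> \<Longrightarrow> nearly_blue R g C" "\<And>C. C \<in> \<C> \<Longrightarrow> \<tau> * n \<le> rcard C"
    using nearly_blue_cover[OF g(1,2) _ _ U(2), of "\<epsilon> / 4 * n"] by (auto simp: \<tau>_def mult.assoc)
  have CV: "C \<subseteq> V" "C \<subseteq> U" "finite C" "0 < rcard C" if "C \<in> \<C>" for C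
    using that \<C>(3) U(2) finite_sub[of C] blk(2)[OF that] \<tau>n by (auto simp: subset_iff)
  have sumC: "(\<Sum>C\<in>\<C>. rcard C) = rcard (\<Union>\<C>)"
    using card_Union_disjoint[OF \<C>(2)] CV by simp
  have "card (\<Union>\<C>) \<le> card V"
    using \<C>(3) U(2) H.fin by (intro card_mono) auto
  then have "rcard \<C> * (\<tau> * n) \<le> real p * n"
    using sumC sum_bounded_below[of \<C> "\<tau> * n" "\<lambda>C. rcard C"] blk(2) card_V_bounds(1) by simp
  then have mC: "rcard \<C> * \<tau> \<le> real p"
    using n_pos by (simp add: mult.assoc[symmetric])
  have UC: "(1 + 3 * \<epsilon> / 4) * n \<le> rcard (\<Union>\<C>)"
  proof -
    have "card (U - \<Union>\<C>) + card (\<Union>\<C>) = card U"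
      using \<C>(3) finite_sub[OF U(2)] by (metis card_Diff_subset card_mono finite_subset le_add_diff_inverse2)
    then show ?thesis
      using U(1) \<C>(4) by (simp add: algebra_simps)
  qed
  have "0 < (1 + 3 * \<epsilon> / 4) * n"
    using \<epsilon> n_pos by simp
  then have neC: "\<C> \<noteq> {}"
    using UC by auto
  have fQ: "finite Q"
    using Q(1) by (rule finite_sub)
  have cQ: "0 < rcard Q"
    using Q(2) mult_pos_pos[OF \<sigma> n_pos] by linarith
  \<comment> \<open>Origin of the threshold \<open>g * \<tau> / (2 * p)\<close>: by Markov's
    inequality a share of at most \<open>\<tau> / (2 * p)\<close> of \<open>Q\<close> is bad for one
    block, and there are at most \<open>p / \<tau>\<close> blocks, so at least half of
    \<open>Q\<close> is good for all of them.\<close>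
  define Bad where "Bad C = {x \<in> Q. g * rcard C < rdeg R x C}" for C
  define Q' where "Q' = Q - \<Union>(Bad ` \<C>)"
  have Bad: "rcard (Bad C) \<le> \<tau> / (2 * real p) * rcard Q" if C: "C \<in> \<C>" for C
  proof -
    have "(\<Sum>x\<in>Q. rdeg R x C) = (\<Sum>y\<in>C. rdeg R y Q)"
      unfolding of_nat_sum[symmetric] using sum_card_nbrs_swap[of Q C R R] fQ CV[OF C] H.sym by metis
    also have "\<dots> \<le> (\<Sum>y\<in>C. \<delta> * rcard Q)"
      using CV(2)[OF C] by (intro sum_mono) (auto simp: U_def dominated_def)
    also have "\<dots> = rcard C * (\<delta> * rcard Q)"
      by simp
    finally have "g * rcard C * rcard (Bad C) \<le> rcard C * (\<delta> * rcard Q)"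
      unfolding Bad_def using fQ by (intro card_heavy_le) auto
    then have "g * rcard (Bad C) \<le> \<delta> * rcard Q"
      using CV(4)[OF C] by (simp add: ac_simps)
    then have "g * rcard (Bad C) \<le> g * (\<tau> / (2 * real p) * rcard Q)"
      by (simp add: \<delta>_def)
    then show ?thesis
      using g(1) by (rule mult_left_le_imp_le)
  qed
  have "rcard (\<Union>(Bad ` \<C>)) \<le> rcard \<C> * (\<tau> / (2 * real p) * rcard Q)"
    using \<C>(1) Bad by (rule card_UN_bound)
  also have "\<dots> \<le> rcard Q / 2"
    using mult_right_mono[OF mC, of "rcard Q"] p by (simp add: field_simps)
  finally have "rcard (\<Union>(Bad ` \<C>)) \<le> rcard Q / 2" .
  moreover have "card Q' + card (\<Union>(Bad ` \<C>)) = card Q"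
  proof -
    have "\<Union>(Bad ` \<C>) \<subseteq> Q"
      by (auto simp: Bad_def)
    then show ?thesis
      unfolding Q'_def using fQ
      by (metis card_Diff_subset card_mono finite_subset le_add_diff_inverse2)
  qed
  ultimately have Q': "rcard Q / 2 \<le> rcard Q'"
    by linarith
  obtain S\<^sub>0 and f :: "'a \<Rightarrow> 'a set" where S0: "S\<^sub>0 \<subseteq> P" "rcard S\<^sub>0 \<le> \<kappa> * n"
    and f: "\<forall>u\<in>P - S\<^sub>0. \<forall>v\<in>P - S\<^sub>0. A u v \<longrightarrow> f u = f v"
      "\<forall>u\<in>P - S\<^sub>0. rcard {v \<in> P - S\<^sub>0. f v = f u} \<le> \<kappa> * n"
    using splits by blast
  \<comment> \<open>Degeneracy does not bound how many neighbours a vertex has in the separator. The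
    closure does so with \<open>2 * q\<close>, at the price of doubling the separator.\<close>
  obtain S where S: "S\<^sub>0 \<subseteq> S" "S \<subseteq> P" "card S \<le> 2 * card S\<^sub>0"
    "\<And>v. v \<in> P - S \<Longrightarrow> card (nbrs A v S) \<le> 2 * q"
    using G.closure_exists[of P S\<^sub>0] S0(1) by blast
  have cS: "rcard S \<le> 2 * (\<kappa> * n)"
    using S(3) S0(2) by linarith
  have fS: "finite S"
    using S(2) G.fin finite_subset by blast
  have \<kappa>Q: "\<kappa> * n \<le> rcard Q / 8"
    using Q(2) mult_right_mono[OF \<kappa>(1), of n] by linarith
  define W where "W = P - S"
  have fW: "finite W"
    using G.fin by (simp add: W_def)
  \<comment> \<open>Nothing has been embedded yet: \<open>undefined\<close> on the empty set stands
    for the empty partial map.\<close>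
  have "\<exists>\<phi>. blue_emb A R \<phi> ({} \<union> S) \<and> (\<forall>u\<in>{}. \<phi> u = undefined u) \<and> (\<forall>u\<in>S. \<phi> u \<in> Q')"
  proof (rule G.extend_blue_emb_count[where a = "\<lambda>_. 0" and b = "\<lambda>_. rcard Q / (8 * (real q + 1))"])
    fix w assume "w \<in> S"
    have "card {w' \<in> S - {w}. Q' \<inter> Q' \<noteq> {}} \<le> card S"
      using fS by (intro card_mono) auto
    moreover have "real q * (rcard Q / (8 * (real q + 1))) \<le> rcard Q / 8"
      by (simp add: field_simps)
    ultimately show "rcard ((undefined :: 'a \<Rightarrow> 'b) ` {} \<inter> Q') + rcard {w' \<in> S - {w}. Q' \<inter> Q' \<noteq> {}} + 0 +
        real q * (rcard Q / (8 * (real q + 1))) < rcard Q'"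
      using cS \<kappa>Q Q' cQ by (simp only: image_empty Int_empty_left card.empty of_nat_0)
  next
    fix y assume "y \<in> Q'"
    then have "y \<in> Q"
      by (simp add: Q'_def)
    have "rdeg R y Q' \<le> rdeg R y Q"
      using fQ by (intro of_nat_mono card_nbrs_mono) (auto simp: Q'_def)
    then show "rdeg R y Q' \<le> rcard Q / (8 * (real q + 1))"
      using Q(3) \<open>y \<in> Q\<close> by (fastforce simp: nearly_blue_def)
  qed (use S fQ H.sym in \<open>auto simp: blue_emb_def Q'_def\<close>)
  then obtain \<phi> where \<phi>: "blue_emb A R \<phi> S" "\<And>u. u \<in> S \<Longrightarrow> \<phi> u \<in> Q'"
    by auto
  define size where "size l = rcard {v \<in> W. f v = l}" for l
  have WS: "W \<subseteq> P - S\<^sub>0"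
    using S(1) by (auto simp: W_def)
  have size: "0 \<le> size l \<and> size l \<le> \<kappa> * n" if l: "l \<in> f ` W" for l
  proof -
    obtain u where u: "u \<in> W" "l = f u"
      using l by blast
    have "card {v \<in> W. f v = l} \<le> card {v \<in> P - S\<^sub>0. f v = f u}"
      using u WS G.fin by (intro card_mono) auto
    moreover have "u \<in> P - S\<^sub>0"
      using u WS by blast
    ultimately have "size l \<le> \<kappa> * n"
      using f(2) unfolding size_def by (meson of_nat_mono order_trans)
    then show ?thesis
      by (simp add: size_def)
  qed
  have size_sum: "(\<Sum>l\<in>f ` W. size l) = rcard W"
    using sum.group[of W "f ` W" f "\<lambda>_. 1::real"] fW by (simp add: size_def)
  have "card W \<le> card P"
    using G.fin by (intro card_mono) (auto simp: W_def)
  then have "(\<Sum>l\<in>f ` W. size l) \<le> n"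
    by (simp add: size_sum)
  moreover have "rcard \<C> * (\<kappa> * n) \<le> \<epsilon> / 2 * n"
  proof -
    have "rcard \<C> * \<kappa> \<le> rcard \<C> * (\<epsilon> * \<tau> / (2 * real p))"
      using \<kappa>(3) by (intro mult_left_mono) auto
    also have "\<dots> \<le> \<epsilon> / 2"
      using mult_left_mono[OF mC, of \<epsilon>] \<epsilon> p by (simp add: field_simps)
    finally show ?thesis
      using n_pos by (simp add: mult.assoc[symmetric] mult_right_mono)
  qed
  moreover have "(1 + \<epsilon> / 2) * n \<le> (\<Sum>C\<in>\<C>. (1 - \<epsilon> / 8) * rcard C)"
  proof -
    have "\<epsilon> * \<epsilon> \<le> \<epsilon>"
      using \<epsilon> mult_left_mono[of \<epsilon> 1 \<epsilon>] by simp
    moreover have "(1 - \<epsilon> / 8) * (1 + 3 * \<epsilon> / 4) = 1 + 5 * \<epsilon> / 8 - 3 * (\<epsilon> * \<epsilon>) / 32"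
      by (simp add: field_simps)
    ultimately have "1 + \<epsilon> / 2 \<le> (1 - \<epsilon> / 8) * (1 + 3 * \<epsilon> / 4)"
      using \<epsilon> by linarith
    then have "(1 + \<epsilon> / 2) * n \<le> (1 - \<epsilon> / 8) * (1 + 3 * \<epsilon> / 4) * n"
      using n_pos by (intro mult_right_mono) auto
    also have "\<dots> = (1 - \<epsilon> / 8) * ((1 + 3 * \<epsilon> / 4) * n)"
      by simp
    also have "\<dots> \<le> (1 - \<epsilon> / 8) * rcard (\<Union>\<C>)"
      using UC \<epsilon> by (intro mult_left_mono) auto
    finally show ?thesis
      by (simp add: sumC sum_distrib_left[symmetric])
  qed
  ultimately have "(\<Sum>l\<in>f ` W. size l) + rcard \<C> * (\<kappa> * n) \<le> (\<Sum>C\<in>\<C>. (1 - \<epsilon> / 8) * rcard C)"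
    by (simp add: algebra_simps)
  \<comment> \<open>The items are the components, the bins the blocks. The share
    \<open>\<epsilon> / 8\<close> kept free in each block exceeds what is lost to images of
    \<open>S\<close> (\<open>\<epsilon> / 32\<close>) and to red neighbours of at most
    \<open>2 * q\<close> neighbours in \<open>S\<close> and \<open>q\<close> in the block
    (\<open>3 * \<epsilon> / 64\<close>).\<close>
  then have "\<exists>c. c ` (f ` W) \<subseteq> \<C> \<and> (\<forall>C\<in>\<C>. (\<Sum>l | l \<in> f ` W \<and> c l = C. size l) \<le> (1 - \<epsilon> / 8) * rcard C)"
    using fW \<C>(1) neC size \<epsilon> by (intro bin_assignment) auto
  then obtain c where c: "\<And>w. w \<in> W \<Longrightarrow> c (f w) \<in> \<C>"
      "\<And>C. C \<in> \<C> \<Longrightarrow> (\<Sum>l | l \<in> f ` W \<and> c l = C. size l) \<le> (1 - \<epsilon> / 8) * rcard C"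
    by (auto simp: image_subset_iff)
  have load: "rcard {v \<in> W. c (f v) = C} \<le> (1 - \<epsilon> / 8) * rcard C" if C: "C \<in> \<C>" for C
  proof -
    have "f ` {v \<in> W. c (f v) = C} \<subseteq> {l \<in> f ` W. c l = C}"
      by auto
    then have "(\<Sum>l | l \<in> f ` W \<and> c l = C. \<Sum>x | x \<in> {v \<in> W. c (f v) = C} \<and> f x = l. 1::real)
        = rcard {v \<in> W. c (f v) = C}"
      using sum.group[of "{v \<in> W. c (f v) = C}" "{l \<in> f ` W. c l = C}" f "\<lambda>_. 1::real"] fW by simp
    moreover have "(\<Sum>x | x \<in> {v \<in> W. c (f v) = C} \<and> f x = l. 1::real) = size l" if "c l = C" for l
      using that by (auto simp: size_def intro!: arg_cong[where f = card])
    ultimately show ?thesis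
      using c(2)[OF C] by simp
  qed
  have "\<exists>\<psi>. blue_emb A R \<psi> (S \<union> W) \<and> (\<forall>u\<in>S. \<psi> u = \<phi> u) \<and> (\<forall>u\<in>W. \<psi> u \<in> c (f u))"
  proof (rule G.extend_blue_emb_count[where a = "\<lambda>w. 2 * (real q * g) * rcard (c (f w))"
        and b = "\<lambda>w. g * rcard (c (f w))"])
    fix w assume w: "w \<in> W"
    define C where "C = c (f w)"
    have C: "C \<in> \<C>"
      using c(1)[OF w] by (simp add: C_def)
    have "{w' \<in> W - {w}. c (f w') \<inter> C \<noteq> {}} \<subseteq> {v \<in> W. c (f v) = C}"
      using c(1) C \<C>(2) by (auto simp: disjoint_def)
    then have "card {w' \<in> W - {w}. c (f w') \<inter> C \<noteq> {}} \<le> card {v \<in> W. c (f v) = C}"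
      using fW by (intro card_mono) auto
    moreover have "rcard (\<phi> ` S \<inter> C) \<le> \<epsilon> / 32 * rcard C"
    proof -
      have "card (\<phi> ` S \<inter> C) \<le> card (\<phi> ` S)"
        using fS by (intro card_mono) auto
      also have "\<dots> \<le> card S"
        using fS by (rule card_image_le)
      finally have "rcard (\<phi> ` S \<inter> C) \<le> 2 * (\<kappa> * n)"
        using cS by linarith
      also have "\<kappa> * n \<le> \<epsilon> * \<tau> / 64 * n"
        using \<kappa>(2) n_pos by (intro mult_right_mono) auto
      also have "2 * (\<epsilon> * \<tau> / 64 * n) \<le> \<epsilon> / 32 * rcard C"
        using blk(2)[OF C] \<epsilon> mult_left_mono[of "\<tau> * n" "rcard C" \<epsilon>] by (simp add: ac_simps)
      finally show ?thesis
        by simp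
    qed
    moreover have "rcard {v \<in> W. c (f v) = C} \<le> (1 - \<epsilon> / 8) * rcard C"
      by (rule load[OF C])
    moreover have "real q * g * rcard C \<le> \<epsilon> / 64 * rcard C"
      using g(3) by (intro mult_right_mono) auto
    moreover have "0 < \<epsilon> * rcard C"
      using \<epsilon> CV(4)[OF C] by simp
    moreover have "(1 - \<epsilon> / 8) * rcard C = rcard C - \<epsilon> * rcard C / 8"
      "2 * (real q * g) * rcard C + real q * (g * rcard C) = 3 * (real q * g * rcard C)"
      by (simp_all add: algebra_simps)
    ultimately show "rcard (\<phi> ` S \<inter> c (f w))
        + rcard {w' \<in> W - {w}. c (f w') \<inter> c (f w) \<noteq> {}}
        + 2 * (real q * g) * rcard (c (f w)) + real q * (g * rcard (c (f w)))
        < rcard (c (f w))"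
      unfolding C_def[symmetric] by linarith
    have "{x \<in> C. \<exists>u\<in>S. A w u \<and> R (\<phi> u) x} = (\<Union>u\<in>nbrs A w S. nbrs R (\<phi> u) C)"
      by auto
    moreover have "rcard (\<Union>u\<in>nbrs A w S. nbrs R (\<phi> u) C) \<le> rdeg A w S * (g * rcard C)"
    proof (rule card_UN_bound)
      fix u assume "u \<in> nbrs A w S"
      then have "\<phi> u \<in> Q'"
        using \<phi>(2) by simp
      then show "rdeg R (\<phi> u) C \<le> g * rcard C"
        using C by (auto simp: Q'_def Bad_def not_less)
    qed (use fS in simp)
    ultimately have "rcard {x \<in> C. \<exists>u\<in>S. A w u \<and> R (\<phi> u) x} \<le> rdeg A w S * (g * rcard C)"
      by simp
    also have "\<dots> \<le> real (2 * q) * (g * rcard C)"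
      using S(4)[of w] w g(1) by (intro mult_right_mono of_nat_mono) (auto simp: W_def)
    finally show "rcard {x \<in> c (f w). \<exists>u\<in>S. A w u \<and> R (\<phi> u) x}
        \<le> 2 * (real q * g) * rcard (c (f w))"
      unfolding C_def by (simp add: mult.assoc)
  next
    fix w w' y assume *: "w \<in> W" "w' \<in> W" "A w w'" "y \<in> c (f w')"
    then have "f w = f w'"
      using f(1) WS by blast
    then show "rdeg R y (c (f w)) \<le> g * rcard (c (f w))"
      using * blk(1)[OF c(1)[OF *(1)]] by (simp add: nearly_blue_def)
  next
    fix w assume "w \<in> W"
    then show "finite (c (f w))"
      using c(1) CV(3) by blast
  next
    show "blue_emb A R \<phi> S"
      by (rule \<phi>)
  qed (use g fS H.sym in \<open>auto simp: W_def\<close>)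
  then obtain \<psi> where \<psi>: "blue_emb A R \<psi> (S \<union> W)" "\<forall>u\<in>S. \<psi> u = \<phi> u" "\<forall>u\<in>W. \<psi> u \<in> c (f u)"
    by blast
  moreover have "S \<union> W = P"
    using S(2) by (auto simp: W_def)
  moreover have "\<psi> u \<in> V" if "u \<in> P" for u
  proof (cases "u \<in> S")
    case True
    then show ?thesis
      using \<psi>(2) \<phi>(2) Q(1) by (auto simp: Q'_def)
  next
    case False
    then have "u \<in> W"
      using that by (simp add: W_def)
    then show ?thesis
      using \<psi>(3) c(1) CV(1) by blast
  qed
  ultimately show False
    using no_emb[of \<psi>] by auto
qed

end

text \<open>The conclusion of \<open>card_dominated_less\<close>, with the order of the pattern as a
  bare number \<open>m\<close>. The density \<open>1 / (8 * (q + 1))\<close> is what a greedy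
  placement of the separator needs: \<open>q\<close> placed neighbours exclude at most an eighth of
  \<open>Q\<close>.\<close>

definition dominates_few :: "'b set \<Rightarrow> ('b \<Rightarrow> 'b \<Rightarrow> bool) \<Rightarrow> real \<Rightarrow> nat \<Rightarrow> real \<Rightarrow> real \<Rightarrow> real \<Rightarrow> bool" where
  "dominates_few V R m q \<epsilon> \<sigma> \<delta> \<longleftrightarrow> (\<forall>Q t. Q \<subseteq> V \<longrightarrow> \<sigma> * m \<le> rcard Q \<longrightarrow>
    nearly_blue R (1 / (8 * (real q + 1))) Q \<longrightarrow> t \<le> \<delta> \<longrightarrow> rcard (dominated V R t Q) < (1 + \<epsilon>) * m)"

text \<open>The order of quantifiers is the point: \<delta> precedes \<sigma>, because the size of
  the stable sets will depend on \<delta>; \<kappa> alone may depend on \<sigma>.\<close>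

lemma dominated_threshold_exists:
  fixes \<epsilon> :: real and p q :: nat
  assumes "0 < \<epsilon>" "\<epsilon> \<le> 1" "2 \<le> p"
  shows "\<exists>\<delta>>0. \<delta> \<le> 1 \<and> (\<forall>\<sigma>>0. \<exists>\<kappa>>0. \<forall>(P :: 'a set) A (V :: 'b set) R.
    ramsey_instance P A q V R p \<kappa> \<longrightarrow> dominates_few V R (rcard P) q \<epsilon> \<sigma> \<delta>)"
proof -
  define g where "g = \<epsilon> / (64 * (real q + 1))"
  define \<tau> where "\<tau> = g ^ p * (\<epsilon> / 4)"
  have g: "0 < g" "g \<le> 1"
    using assms by (auto simp: g_def field_simps)
  have \<tau>: "0 < \<tau>" "\<tau> \<le> 1"
    using g assms power_le_one[of g p] mult_le_one[of "g ^ p" "\<epsilon> / 4"] by (auto simp: \<tau>_def)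
  show ?thesis
  proof (rule exI[of _ "g * \<tau> / (2 * real p)"], intro conjI allI impI)
    show "0 < g * \<tau> / (2 * real p)"
      using g \<tau> assms by simp
    have "g * \<tau> \<le> 1"
      using g \<tau> by (intro mult_le_one) auto
    then show "g * \<tau> / (2 * real p) \<le> 1"
      using assms by (simp add: divide_simps)
    fix \<sigma> :: real
    assume \<sigma>: "0 < \<sigma>"
    define \<kappa> where "\<kappa> = min (\<sigma> / 8) (min (\<epsilon> * \<tau> / 64) (\<epsilon> * \<tau> / (2 * real p)))"
    have \<kappa>: "0 < \<kappa>" "\<kappa> \<le> \<sigma> / 8" "\<kappa> \<le> \<epsilon> * \<tau> / 64" "\<kappa> \<le> \<epsilon> * \<tau> / (2 * real p)"
      using assms \<sigma> \<tau> by (auto simp: \<kappa>_def)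
    show "\<exists>\<kappa>>0. \<forall>(P :: 'a set) A (V :: 'b set) R. ramsey_instance P A q V R p \<kappa> \<longrightarrow>
      dominates_few V R (rcard P) q \<epsilon> \<sigma> (g * \<tau> / (2 * real p))"
    proof (rule exI[of _ \<kappa>], unfold dominates_few_def, intro conjI allI impI)
      fix P :: "'a set" and A and V :: "'b set" and R Q t
      assume *: "ramsey_instance P A q V R p \<kappa>" "Q \<subseteq> V" "\<sigma> * rcard P \<le> rcard Q"
        "nearly_blue R (1 / (8 * (real q + 1))) Q" "t \<le> g * \<tau> / (2 * real p)"
      interpret ramsey_instance P A q V R p \<kappa>
        by (fact *)
      have "card (dominated V R t Q) \<le> card (dominated V R (g * \<tau> / (2 * real p)) Q)"
        using *(5) by (intro card_mono H.finite_dominated dominated_mono)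
      then show "rcard (dominated V R t Q) < (1 + \<epsilon>) * rcard P"
        using card_dominated_less[OF assms(1,2) \<sigma>, of Q] \<kappa> * unfolding g_def[symmetric] \<tau>_def[symmetric]
        by linarith
    qed (rule \<kappa>)
  qed
qed

section \<open>The approximate structure\<close>

lemma common_lower_bound:
  fixes g :: "nat \<Rightarrow> real"
  assumes "\<And>k. 0 < g k"
  obtains s where "0 < s" "\<And>k. k < m \<Longrightarrow> s \<le> g k"
proof
  show "0 < Min (insert 1 (g ` {..<m}))"
    using assms by (subst Min_gr_iff) auto
  show "Min (insert 1 (g ` {..<m})) \<le> g k" if "k < m" for k
    using that by (intro Min_le) auto
qed

text \<open>The data consumed by \<open>no_stable_chain\<close>, with uniform bounds
  \<open>s\<close>, \<open>t\<^sub>0\<close>, \<open>d\<close>, \<open>e\<^sub>0\<close> added;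
  \<open>k\<close> is the bound on the size of a red book.\<close>

definition stable_chain :: "'b set \<Rightarrow> ('b \<Rightarrow> 'b \<Rightarrow> bool) \<Rightarrow> nat \<Rightarrow> real \<Rightarrow> real \<Rightarrow> real \<Rightarrow> real \<Rightarrow> real \<Rightarrow>
    real \<Rightarrow> (nat \<Rightarrow> 'b set) \<Rightarrow> (nat \<Rightarrow> real) \<Rightarrow> (nat \<Rightarrow> real) \<Rightarrow> bool" where
  "stable_chain V R p a s t\<^sub>0 d e\<^sub>0 k Q t e \<longleftrightarrow> (\<forall>i<p. s \<le> rcard (Q i) \<and> nearly_blue R a (Q i) \<and>
    t\<^sub>0 \<le> t i \<and> t i \<le> d \<and> stable V R p (e i) (t i) (Q i) \<and> e i \<le> e\<^sub>0 \<and> k < t i ^ p * rcard (Q i) \<and>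
    (\<forall>j<i. Q i \<inter> dominated V R (t j) (Q j) = {} \<and>
      real p * (e j * rcard V) < t i ^ p * rcard (Q i)))"

lemma stable_chainD:
  assumes "stable_chain V R p a s t\<^sub>0 d e\<^sub>0 k Q t e" "i < p"
  shows "s \<le> rcard (Q i)" "nearly_blue R a (Q i)" "t\<^sub>0 \<le> t i" "t i \<le> d" "stable V R p (e i) (t i) (Q i)"
    "e i \<le> e\<^sub>0" "k < t i ^ p * rcard (Q i)" "j < i \<Longrightarrow> Q i \<inter> dominated V R (t j) (Q j) = {}"
    "j < i \<Longrightarrow> real p * (e j * rcard V) < t i ^ p * rcard (Q i)"
  using assms unfolding stable_chain_def by blast+

text \<open>The sets are to be found inside prescribed hosts \<open>U i\<close>. Each earlier set
  takes at most \<open>b\<close> vertices away from \<open>U i\<close> by domination, so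
  \<open>(p - 1) * b\<close> pays for all of them and \<open>u * m\<close> vertices remain to choose
  from.\<close>

definition chains_exist :: "'b set \<Rightarrow> ('b \<Rightarrow> 'b \<Rightarrow> bool) \<Rightarrow> nat \<Rightarrow> real \<Rightarrow> real \<Rightarrow> real \<Rightarrow> real \<Rightarrow> real \<Rightarrow> real \<Rightarrow>
    real \<Rightarrow> real \<Rightarrow> bool" where
  "chains_exist V R p m a u e\<^sub>0 d \<sigma> t\<^sub>0 \<kappa> \<longleftrightarrow> (\<forall>U b. (\<forall>i<p. U i \<subseteq> V \<and> u * m + (real p - 1) * b \<le> rcard (U i)) \<longrightarrow>
    0 \<le> b \<longrightarrow> (\<forall>i<p. \<forall>j<i. \<forall>Q\<subseteq>U j. \<forall>t. \<sigma> * m \<le> rcard Q \<longrightarrow> nearly_blue R a Q \<longrightarrow>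
      t\<^sub>0 \<le> t \<longrightarrow> t \<le> d \<longrightarrow> rcard (dominated V R t Q \<inter> U i) \<le> b) \<longrightarrow>
    (\<exists>Q t e. (\<forall>i<p. Q i \<subseteq> U i) \<and> stable_chain V R p a (\<sigma> * m) t\<^sub>0 d e\<^sub>0 (\<kappa> * m) Q t e))"

text \<open>The sets are chosen in increasing order of the tolerances \<open>e\<close>, so that the exceptional sets of
  all earlier choices are small compared with each later set.\<close>

lemma stable_chain_exists:
  fixes d a u e\<^sub>0 :: real and p q :: nat
  assumes "0 < d" "d \<le> 1" "0 < a" "a \<le> 1" "0 < u" "0 < e\<^sub>0" "2 \<le> p"
  shows "\<exists>\<sigma> t\<^sub>0 \<kappa>. 0 < \<sigma> \<and> 0 < t\<^sub>0 \<and> t\<^sub>0 \<le> 1 \<and> 0 < \<kappa> \<and>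
    (\<forall>(P :: 'a set) A (V :: 'b set) R. ramsey_instance P A q V R p \<kappa> \<longrightarrow>
      chains_exist V R p (rcard P) a u e\<^sub>0 d \<sigma> t\<^sub>0 \<kappa>)"
proof -
  define good where "good e \<sigma> t\<^sub>0 \<kappa> \<longleftrightarrow> 0 < \<sigma> \<and> 0 < t\<^sub>0 \<and> t\<^sub>0 \<le> 1 \<and> 0 < \<kappa> \<and>
    (\<forall>(P :: 'a set) A q (V :: 'b set) R U. ramsey_instance P A q V R p \<kappa> \<longrightarrow> U \<subseteq> V \<longrightarrow>
      u * rcard P \<le> rcard U \<longrightarrow>
      (\<exists>Q\<subseteq>U. \<exists>t. \<sigma> * rcard P \<le> rcard Q \<and> nearly_blue R a Q \<and> t\<^sub>0 \<le> t \<and> t \<le> d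
        \<and> stable V R p e t Q))" for e \<sigma> t\<^sub>0 \<kappa>
  have "\<exists>\<sigma> t\<^sub>0 \<kappa>. good e \<sigma> t\<^sub>0 \<kappa>" if "0 < e" for e
    unfolding good_def by (rule stable_nearly_blue_exists[OF that assms(1-5)])
  then obtain sg tz kp where good: "\<And>e. 0 < e \<Longrightarrow> good e (sg e) (tz e) (kp e)"
    by metis
  \<comment> \<open>\<open>E (Suc k)\<close> is small compared with \<open>t ^ p * |Q|\<close> for a
    set \<open>Q\<close> found with tolerance \<open>E k\<close>. In \<open>2 * p\<^sup>2\<close>
    one factor \<open>p\<close> comes from the chain condition, one from
    \<open>|V| \<le> p * n\<close>, and the 2 gives strictness.\<close>
  define E where "E = rec_nat e\<^sub>0 (\<lambda>_ x. min x (tz x ^ p * sg x / (2 * (real p)\<^sup>2)))"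
  have E0: "E 0 = e\<^sub>0" and ES: "E (Suc k) = min (E k) (tz (E k) ^ p * sg (E k) / (2 * (real p)\<^sup>2))" for k
    by (simp_all add: E_def)
  have Epos: "0 < E k" for k
  proof (induction k)
    case (Suc k)
    then show ?case
      using good[OF Suc] assms(7) by (simp add: ES good_def)
  qed (use assms E0 in auto)
  have sgE: "0 < sg (E k)" "0 < tz (E k)" "tz (E k) \<le> 1" "0 < kp (E k)" for k
    using good[OF Epos[of k]] by (auto simp: good_def)
  have "decseq E"
    by (rule decseq_SucI) (simp add: ES)
  then have Emono: "E j \<le> E i" if "i \<le> j" for i j
    using that by (simp add: decseq_def)
  obtain \<sigma> where \<sigma>: "0 < \<sigma>" "\<And>k. k < p \<Longrightarrow> \<sigma> \<le> sg (E k)"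
    using common_lower_bound[of "\<lambda>k. sg (E k)" p] sgE by blast
  obtain t\<^sub>0 where t0: "0 < t\<^sub>0" "\<And>k. k < p \<Longrightarrow> t\<^sub>0 \<le> tz (E k)"
    using common_lower_bound[of "\<lambda>k. tz (E k)" p] sgE by blast
  obtain k0 where k0: "0 < k0" "\<And>k. k < p \<Longrightarrow> k0 \<le> kp (E k)"
    using common_lower_bound[of "\<lambda>k. kp (E k)" p] sgE by blast
  define \<kappa> where "\<kappa> = min k0 (t\<^sub>0 ^ p * \<sigma> / 2)"
  have \<kappa>: "0 < \<kappa>" "\<kappa> \<le> k0" "\<kappa> < t\<^sub>0 ^ p * \<sigma>"
    using k0 t0 \<sigma> by (auto simp: \<kappa>_def min_less_iff_disj)
  have t01: "t\<^sub>0 \<le> 1"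
    using t0(2)[of 0] sgE(3)[of 0] assms(7) by simp
  show ?thesis
  proof (rule exI[of _ \<sigma>], rule exI[of _ t\<^sub>0], rule exI[of _ \<kappa>], unfold chains_exist_def, intro conjI allI impI)
    fix P :: "'a set" and A and V :: "'b set" and R and U :: "nat \<Rightarrow> 'b set" and b
    assume inst: "ramsey_instance P A q V R p \<kappa>"
      and U: "\<forall>i<p. U i \<subseteq> V \<and> u * rcard P + (real p - 1) * b \<le> rcard (U i)"
      and b: "0 \<le> b"
      and dom: "\<forall>i<p. \<forall>j<i. \<forall>Q\<subseteq>U j. \<forall>t. \<sigma> * rcard P \<le> rcard Q \<longrightarrow> nearly_blue R a Q \<longrightarrow>
        t\<^sub>0 \<le> t \<longrightarrow> t \<le> d \<longrightarrow> rcard (dominated V R t Q \<inter> U i) \<le> b"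
    interpret ramsey_instance P A q V R p \<kappa>
      by (fact inst)
    \<comment> \<open>The sequence \<open>E\<close> decreases, so it is read backwards: the set
      chosen first gets the smallest tolerance.\<close>
    define e where "e i = E (p - 1 - i)" for i
    define ok where "ok Q t i \<longleftrightarrow> Q i \<subseteq> U i \<and> sg (e i) * n \<le> rcard (Q i) \<and> nearly_blue R a (Q i)
        \<and> tz (e i) \<le> t i \<and> t i \<le> d \<and> stable V R p (e i) (t i) (Q i)
        \<and> (\<forall>j<i. Q i \<inter> dominated V R (t j) (Q j) = {})" for Q t i
    have sgi: "\<sigma> \<le> sg (e i)" "t\<^sub>0 \<le> tz (e i)" "k0 \<le> kp (e i)" for i
      using \<sigma>(2) t0(2) k0(2) assms(7) by (auto simp: e_def)
    have \<sigma>n: "\<sigma> * n \<le> sg (e i) * n" for i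
      using sgi(1) n_pos by (intro mult_right_mono) auto
    have "m \<le> p \<Longrightarrow> \<exists>Q t. \<forall>i<m. ok Q t i" for m
    proof (induction m)
      case (Suc m)
      then obtain Q t where ok: "\<And>i. i < m \<Longrightarrow> ok Q t i"
        by auto
      \<comment> \<open>Choosing inside \<open>U'\<close> enforces disjointness from everything
        dominated by the earlier sets.\<close>
      define U' where "U' = U m - (\<Union>j<m. dominated V R (t j) (Q j))"
      have "rcard (\<Union>j<m. dominated V R (t j) (Q j) \<inter> U m) \<le> rcard {..<m} * b"
      proof (rule card_UN_bound)
        fix j assume "j \<in> {..<m}"
        then show "rcard (dominated V R (t j) (Q j) \<inter> U m) \<le> b"
          using dom[rule_format, of m j "Q j" "t j"] ok[of j] Suc.prems \<sigma>n[of j] sgi(2)[of j]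
          by (auto simp: ok_def)
      qed simp
      also have "\<dots> \<le> (real p - 1) * b"
        using Suc.prems b by (simp add: mult_right_mono)
      finally have 1: "rcard (\<Union>j<m. dominated V R (t j) (Q j) \<inter> U m) \<le> (real p - 1) * b" .
      have fU: "finite (U m)"
        using U Suc.prems finite_sub by auto
      have "U m \<subseteq> U' \<union> (\<Union>j<m. dominated V R (t j) (Q j) \<inter> U m)"
        by (auto simp: U'_def)
      then have "rcard (U m) \<le> rcard U' + rcard (\<Union>j<m. dominated V R (t j) (Q j) \<inter> U m)"
        using fU by (intro card_cover) (auto simp: U'_def)
      moreover have "u * n + (real p - 1) * b \<le> rcard (U m)"
        using U Suc.prems by simp
      ultimately have "u * n \<le> rcard U'"
        using 1 by linarith
      moreover have "U' \<subseteq> V"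
        using U[rule_format, of m] Suc.prems by (auto simp: U'_def)
      moreover have "ramsey_instance P A q V R p (kp (e m))"
        using mono sgi(3)[of m] \<kappa>(2) by force
      moreover have "good (e m) (sg (e m)) (tz (e m)) (kp (e m))"
        unfolding e_def by (rule good[OF Epos])
      ultimately obtain Q' t' where Q': "Q' \<subseteq> U'" "sg (e m) * n \<le> rcard Q'" "nearly_blue R a Q'"
          "tz (e m) \<le> t'" "t' \<le> d" "stable V R p (e m) t' Q'"
        unfolding good_def by blast
      have "ok (Q(m := Q')) (t(m := t')) i" if "i < Suc m" for i
      proof (cases "i = m")
        case True
        have "Q' \<subseteq> U m" "\<forall>j<m. Q' \<inter> dominated V R (t j) (Q j) = {}"
          using Q'(1) by (auto simp: U'_def)
        then show ?thesis
          using Q' True by (simp add: ok_def)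
      next
        case False
        then show ?thesis
          using ok[of i] that by (simp add: ok_def)
      qed
      then show ?case
        by blast
    qed auto
    from this[of p] obtain Q t where ok: "\<And>i. i < p \<Longrightarrow> ok Q t i"
      by auto
    have "stable_chain V R p a (\<sigma> * n) t\<^sub>0 d e\<^sub>0 (\<kappa> * n) Q t e"
      unfolding stable_chain_def
    proof (intro allI impI)
      fix i assume i: "i < p"
      have oki: "Q i \<subseteq> U i" "sg (e i) * n \<le> rcard (Q i)" "nearly_blue R a (Q i)"
          "tz (e i) \<le> t i" "t i \<le> d" "stable V R p (e i) (t i) (Q i)"
          "\<forall>j<i. Q i \<inter> dominated V R (t j) (Q j) = {}"
        using ok[OF i] by (auto simp: ok_def)
      have lower: "tz (e i) ^ p * sg (e i) * n \<le> t i ^ p * rcard (Q i)"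
      proof -
        have "tz (e i) ^ p * (sg (e i) * n) \<le> t i ^ p * rcard (Q i)"
          using oki sgE[of "p - 1 - i"] n_pos by (intro mult_mono power_mono) (auto simp: e_def)
        then show ?thesis
          by (simp add: mult.assoc)
      qed
      have "t\<^sub>0 ^ p * \<sigma> \<le> tz (e i) ^ p * sg (e i)"
        using sgi t0 \<sigma> sgE[of "p - 1 - i"] by (intro mult_mono power_mono) (auto simp: e_def)
      then have "\<kappa> * n < tz (e i) ^ p * sg (e i) * n"
        using \<kappa>(3) n_pos by (intro mult_strict_right_mono) auto
      moreover have "real p * (e j * rcard V) < t i ^ p * rcard (Q i)" if j: "j < i" for j
      proof -
        have "e j \<le> E (Suc (p - 1 - i))"
          unfolding e_def using j i by (intro Emono) auto
        also have "\<dots> \<le> tz (e i) ^ p * sg (e i) / (2 * (real p)\<^sup>2)"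
          by (simp add: ES e_def)
        finally have "2 * (real p)\<^sup>2 * e j \<le> tz (e i) ^ p * sg (e i)"
          using assms(7) by (simp add: field_simps)
        then have "2 * (real p)\<^sup>2 * e j * n \<le> tz (e i) ^ p * sg (e i) * n"
          using n_pos by (intro mult_right_mono) auto
        moreover have "real p * (e j * rcard V) \<le> real p * (e j * (real p * n))"
          using card_V_bounds(1) Epos[of "p - 1 - j"] by (intro mult_left_mono) (auto simp: e_def)
        moreover have "0 < (real p)\<^sup>2 * e j * n"
          using Epos[of "p - 1 - j"] assms(7) n_pos by (simp add: e_def)
        moreover have "real p * (e j * (real p * n)) = (real p)\<^sup>2 * e j * n"
          by (simp add: power2_eq_square)
        ultimately show ?thesis
          using lower by linarith
      qed
      moreover have "e i \<le> e\<^sub>0"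
        using Emono[of 0 "p - 1 - i"] E0 by (simp add: e_def)
      ultimately show "\<sigma> * n \<le> rcard (Q i) \<and> nearly_blue R a (Q i) \<and> t\<^sub>0 \<le> t i \<and> t i \<le> d \<and>
        stable V R p (e i) (t i) (Q i) \<and> e i \<le> e\<^sub>0 \<and> \<kappa> * n < t i ^ p * rcard (Q i) \<and>
        (\<forall>j<i. Q i \<inter> dominated V R (t j) (Q j) = {} \<and>
          real p * (e j * rcard V) < t i ^ p * rcard (Q i))"
        using oki \<sigma>n[of i] sgi(2)[of i] lower by auto
    qed
    moreover have "\<forall>i<p. Q i \<subseteq> U i"
      using ok by (simp add: ok_def)
    ultimately show "\<exists>Q t e. (\<forall>i<p. Q i \<subseteq> U i) \<and> stable_chain V R p a (\<sigma> * n) t\<^sub>0 d e\<^sub>0 (\<kappa> * n) Q t e"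
      by blast
  qed (use \<sigma> t0 t01 \<kappa> in auto)
qed

definition blue_parts :: "'b set \<Rightarrow> ('b \<Rightarrow> 'b \<Rightarrow> bool) \<Rightarrow> nat \<Rightarrow> real \<Rightarrow> real \<Rightarrow> (nat \<Rightarrow> 'b set) \<Rightarrow> bool" where
  "blue_parts V R p \<xi> m D \<longleftrightarrow>
    (\<forall>i<p. D i \<subseteq> V \<and> (1 - \<xi>) * m \<le> rcard (D i) \<and> (\<forall>y\<in>D i. rdeg R y (D i) \<le> \<xi> * m))
    \<and> (\<forall>i<p. \<forall>j<p. i \<noteq> j \<longrightarrow> D i \<inter> D j = {})"

lemma blue_parts_mono:
  assumes "blue_parts V R p \<xi> m D" "\<xi> \<le> \<xi>'" "0 \<le> m"
  shows "blue_parts V R p \<xi>' m D"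
proof -
  have "(1 - \<xi>') * m \<le> (1 - \<xi>) * m" "\<xi> * m \<le> \<xi>' * m"
    using assms by (auto intro: mult_right_mono)
  then show ?thesis
    using assms(1) unfolding blue_parts_def by (meson order_trans)
qed

text \<open>Each vertex \<open>v\<close> lies in a dominated set \<open>B i\<close>: otherwise the
  clique \<open>{v}\<close> keeps a share of all \<open>p\<close> sets of the chain, against
  \<open>no_stable_chain\<close>. As each \<open>B j\<close> has at most
  \<open>(1 + \<epsilon>) * n\<close> vertices, about \<open>n\<close> vertices avoid all
  \<open>B j\<close> with \<open>j \<noteq> i\<close>. A red edge between two of these would be a
  clique keeping a share of the \<open>p - 1\<close> other sets, unless one end is exceptional for
  the other; stability makes such exceptions rare.\<close>

lemma blue_parts_exist:
  fixes \<xi> :: real and p q :: nat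
  assumes "0 < \<xi>" "\<xi> \<le> 1" "2 \<le> p"
  shows "\<exists>\<kappa>>0. \<forall>(P :: 'a set) A (V :: 'b set) R. ramsey_instance P A q V R p \<kappa> \<longrightarrow>
    (\<exists>D. blue_parts V R p \<xi> (rcard P) D)"
proof -
  define \<epsilon> where "\<epsilon> = \<xi> / (8 * real p)"
  have p: "2 \<le> real p"
    using assms(3) by simp
  have \<epsilon>: "0 < \<epsilon>" "\<epsilon> \<le> 1" "real p * \<epsilon> = \<xi> / 8"
    using assms(1,2) p by (auto simp: \<epsilon>_def field_simps)
  define a :: real where "a = 1 / (8 * (real q + 1))"
  have a: "0 < a" "a \<le> 1"
    by (auto simp: a_def field_simps)
  obtain \<delta> where \<delta>: "0 < \<delta>" "\<delta> \<le> 1"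
    and star: "\<And>\<sigma>. 0 < \<sigma> \<Longrightarrow> \<exists>\<kappa>>0. \<forall>(P :: 'a set) A (V :: 'b set) R. ramsey_instance P A q V R p \<kappa> \<longrightarrow>
      dominates_few V R (rcard P) q \<epsilon> \<sigma> \<delta>"
    using dominated_threshold_exists[OF \<epsilon>(1,2) assms(3)] by blast
  \<comment> \<open>A red neighbourhood inside a part will be covered by at most \<open>p\<close>
    exceptional sets of size at most \<open>e0 * |V| \<le> e0 * (p * n)\<close>, which adds up to
    \<open>\<xi> * n\<close>.\<close>
  define e0 where "e0 = \<xi> / (real p)\<^sup>2"
  have e0: "0 < e0" "real p * (real p * e0) = \<xi>"
    using assms(1) p by (auto simp: e0_def power2_eq_square)
  obtain \<sigma> t\<^sub>0 \<kappa>\<^sub>1 where \<sigma>: "0 < \<sigma>" "0 < t\<^sub>0" "t\<^sub>0 \<le> 1" "0 < \<kappa>\<^sub>1"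
    and chain: "\<forall>(P :: 'a set) A (V :: 'b set) R. ramsey_instance P A q V R p \<kappa>\<^sub>1 \<longrightarrow>
      chains_exist V R p (rcard P) a (1 / 2) e0 \<delta> \<sigma> t\<^sub>0 \<kappa>\<^sub>1"
    using stable_chain_exists[OF \<delta> a half_gt_zero[OF zero_less_one] e0(1) assms(3), of q]
    by (elim exE conjE) (rule that; assumption)
  obtain \<kappa>\<^sub>2 where "0 < \<kappa>\<^sub>2" and dom': "\<forall>(P :: 'a set) A (V :: 'b set) R. ramsey_instance P A q V R p \<kappa>\<^sub>2 \<longrightarrow>
      dominates_few V R (rcard P) q \<epsilon> \<sigma> \<delta>"
    using star \<sigma>(1) by blast
  define \<kappa> where "\<kappa> = min \<kappa>\<^sub>1 (min \<kappa>\<^sub>2 (\<xi> / (8 * real p)))"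
  have \<kappa>: "0 < \<kappa>" "\<kappa> \<le> \<kappa>\<^sub>1" "\<kappa> \<le> \<kappa>\<^sub>2" "\<kappa> \<le> \<xi> / (8 * real p)"
    using \<sigma> \<open>0 < \<kappa>\<^sub>2\<close> assms p by (auto simp: \<kappa>_def)
  have "\<exists>D. blue_parts V R p \<xi> (rcard P) D"
    if inst: "ramsey_instance P A q V R p \<kappa>" for P :: "'a set" and A and V :: "'b set" and R
  proof -
    interpret ramsey_instance P A q V R p \<kappa>
      by (fact inst)
    note dom = dom'[rule_format, OF mono[OF \<kappa>(3)], unfolded dominates_few_def, rule_format, folded a_def]
      and chain = chain[rule_format, OF mono[OF \<kappa>(2)], unfolded chains_exist_def]
    have pn: "8 * real p \<le> \<xi> * n"
    proof -
      have "1 \<le> \<xi> / (8 * real p) * n"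
        using large \<kappa>(4) n_pos mult_right_mono[OF \<kappa>(4), of n] by linarith
      then show ?thesis
        using p by (simp add: field_simps)
    qed
    have \<xi>n: "\<xi> * n \<le> n"
      using assms n_pos mult_right_mono[of \<xi> 1 n] by simp
    define b where "b = (1 + \<epsilon>) * n"
    have b: "0 \<le> b" "(real p - 1) * b \<le> (real p - 1) * n + \<xi> / 8 * n"
    proof -
      show "0 \<le> b"
        using \<epsilon> n_pos by (simp add: b_def)
      have "(real p - 1) * b = (real p - 1) * n + (real p * \<epsilon>) * n - \<epsilon> * n"
        by (simp add: b_def algebra_simps)
      then show "(real p - 1) * b \<le> (real p - 1) * n + \<xi> / 8 * n"
        using \<epsilon> n_pos by simp
    qed
    have room: "real p * n - real p - (real p - 1) * b \<ge> n - \<xi> / 4 * n"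
      using b(2) pn by (simp add: algebra_simps)
    have "\<exists>Q t e. (\<forall>i<p. Q i \<subseteq> V) \<and> stable_chain V R p a (\<sigma> * n) t\<^sub>0 \<delta> e0 (\<kappa>\<^sub>1 * n) Q t e"
    proof (rule chain[THEN spec[of _ "\<lambda>_. V"], THEN spec[of _ b], THEN mp, THEN mp, THEN mp])
      show "\<forall>i<p. V \<subseteq> V \<and> 1 / 2 * n + (real p - 1) * b \<le> rcard V"
      proof (intro allI impI conjI order_refl)
        show "1 / 2 * n + (real p - 1) * b \<le> rcard V"
          using room card_V_bounds(2) \<xi>n n_pos by linarith
      qed
      show "\<forall>i<p. \<forall>j<i. \<forall>Q\<subseteq>V. \<forall>t. \<sigma> * n \<le> rcard Q \<longrightarrow> nearly_blue R a Q \<longrightarrow>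
        t\<^sub>0 \<le> t \<longrightarrow> t \<le> \<delta> \<longrightarrow> rcard (dominated V R t Q \<inter> V) \<le> b"
        using dom dominated_subset[of V R] by (auto simp: b_def Int_absorb2 less_imp_le)
    qed (rule b)
    then obtain Q t e where QV: "\<forall>i<p. Q i \<subseteq> V"
      and Q': "stable_chain V R p a (\<sigma> * n) t\<^sub>0 \<delta> e0 (\<kappa>\<^sub>1 * n) Q t e"
      by (elim exE conjE) (rule that)
    note Q = QV[rule_format] stable_chainD[OF Q']
    define B where "B i = dominated V R (t i) (Q i)" for i
    have B: "rcard (B i) \<le> b" if "i < p" for i
      using dom[OF Q(1-3,5)[OF that]] by (simp add: b_def B_def)
    have ti: "0 < t i" "t i \<le> 1" if "i < p" for i
      using Q(4,5)[OF that] \<sigma> \<delta> by linarith+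
    have \<kappa>t: "\<kappa> * n < t i ^ p * rcard (Q i)" if "i < p" for i
      using Q(8)[OF that] mult_right_mono[OF \<kappa>(2), of n] by linarith
    define Y where "Y y j = nbrs R y (Q j)" for y j
    have Ycommon: "Q j \<inter> common_nbrs V R {y} = Y y j" if "j < p" for y j
      using Q(1)[OF that] by (auto simp: Y_def common_nbrs_def)
    have Ybig: "t j * rcard (Q j) < rcard (Y y j)" if "y \<in> V - B j" for y j
      using that by (auto simp: Y_def B_def dominated_def)
    have cover: "\<exists>i<p. v \<in> B i" if v: "v \<in> V" for v
    proof (rule ccontr)
      assume "\<not> (\<exists>i<p. v \<in> B i)"
      then have vB: "v \<in> V - B i" if "i < p" for i
        using v that by auto
      show False
      proof (rule no_stable_chain[of "{..<p}" "{v}" Q t e])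
        show "{..<p} \<noteq> {}"
          using assms(3) by (auto simp: lessThan_empty_iff)
      qed (use v Q ti \<kappa>t Ybig[OF vB] Ycommon in \<open>auto simp: red_clique_def less_imp_le\<close>)
    qed
    \<comment> \<open>By \<open>cover\<close> this is the part of \<open>B i\<close> outside the
      other dominated sets. The present form gives the lower bound on its size directly, and
      \<open>cover\<close> gives disjointness.\<close>
    define D where "D i = V - (\<Union>j\<in>{..<p} - {i}. B j)" for i
    have DV: "D i \<subseteq> V" for i
      by (auto simp: D_def)
    have D_card: "(1 - \<xi>) * n \<le> rcard (D i)" if i: "i < p" for i
    proof -
      have "rcard (\<Union>j\<in>{..<p} - {i}. B j) \<le> rcard ({..<p} - {i}) * b"
        using B by (intro card_UN_bound) auto
      also have "\<dots> = (real p - 1) * b"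
        using i by (simp add: of_nat_diff)
      finally have 1: "rcard (\<Union>j\<in>{..<p} - {i}. B j) \<le> (real p - 1) * b" .
      have "V = D i \<union> (\<Union>j\<in>{..<p} - {i}. B j)"
        using dominated_subset[of V R] by (auto simp: D_def B_def)
      then have "rcard V \<le> rcard (D i) + rcard (\<Union>j\<in>{..<p} - {i}. B j)"
        using H.fin by (intro card_cover) (auto simp: D_def B_def H.finite_dominated)
      then have "rcard V \<le> rcard (D i) + (real p - 1) * b"
        using 1 by linarith
      moreover have "(1 - \<xi>) * n = n - \<xi> * n" "0 \<le> \<xi> * n"
        using assms n_pos by (auto simp: algebra_simps)
      ultimately show ?thesis
        using card_V_bounds(2) room by linarith
    qed
    have D_red: "rdeg R y (D i) \<le> \<xi> * n" if i: "i < p" and y: "y \<in> D i" for i y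
    proof -
      define Exc where "Exc j = dominated V R (t j) (Y y j) - B j" for j
      have yB: "y \<in> V - B j" if "j \<in> {..<p} - {i}" for j
        using y that by (auto simp: D_def)
      have Exc: "rcard (Exc j) \<le> e0 * (real p * n)" if j: "j \<in> {..<p} - {i}" for j
      proof -
        have "t j ^ p * rcard (Q j) \<le> t j ^ 1 * rcard (Q j)"
          using ti[of j] j assms(3) by (intro mult_right_mono power_decreasing) auto
        then have "t j ^ p * rcard (Q j) \<le> rcard (Y y j)"
          using Ybig[OF yB[OF j]] by simp
        then have "rcard (Exc j) \<le> e j * rcard V"
          using Q(6)[of j] j unfolding stable_def Exc_def B_def by (auto simp: Y_def nbrs_subset)
        also have "\<dots> \<le> e0 * rcard V"
          using Q(7)[of j] j by (intro mult_right_mono) auto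
        also have "\<dots> \<le> e0 * (real p * n)"
          using card_V_bounds(1) e0(1) by (intro mult_left_mono) auto
        finally show ?thesis .
      qed
      have "nbrs R y (D i) \<subseteq> (\<Union>j\<in>{..<p} - {i}. Exc j)"
      proof (rule ccontr)
        assume "\<not> nbrs R y (D i) \<subseteq> (\<Union>j\<in>{..<p} - {i}. Exc j)"
        then obtain x where "x \<in> nbrs R y (D i)" "x \<notin> (\<Union>j\<in>{..<p} - {i}. Exc j)"
          by blast
        then have x: "x \<in> D i" "R y x" "\<And>j. j \<in> {..<p} - {i} \<Longrightarrow> x \<notin> Exc j"
          by auto
        have xB: "x \<in> V - B j" if "j \<in> {..<p} - {i}" for j
          using x that by (auto simp: D_def)
        have xy: "x \<noteq> y" "x \<in> V" "y \<in> V"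
          using x y DV H.irrefl by auto
        have big: "t j ^ 2 * rcard (Q j) \<le> rcard (Q j \<inter> common_nbrs V R {x, y})"
          if j: "j \<in> {..<p} - {i}" for j
        proof -
          have "Q j \<inter> common_nbrs V R {x, y} = nbrs R x (Y y j)"
            using Q(1)[of j] j by (auto simp: Y_def common_nbrs_def)
          moreover have "t j * rcard (Y y j) < rdeg R x (Y y j)"
            using x(3)[OF j] xB[OF j] by (auto simp: Exc_def dominated_def)
          moreover have "t j * (t j * rcard (Q j)) \<le> t j * rcard (Y y j)"
            using Ybig[OF yB[OF j]] ti[of j] j by (intro mult_left_mono) auto
          ultimately show ?thesis
            by (simp add: power2_eq_square mult.assoc)
        qed
        have card_J: "card ({..<p} - {i}) = p - 1"
          using i by simp
        show False
        proof (rule no_stable_chain[of "{..<p} - {i}" "{x, y}" Q t e])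
          show "{..<p} - {i} \<noteq> {}"
          proof
            assume "{..<p} - {i} = {}"
            then have "p - 1 = 0"
              using card_J by (simp only: card.empty)
            then show False
              using assms(3) by simp
          qed
          show "card {x, y} + card ({..<p} - {i}) = p + 1"
            using card_J xy assms(3) by simp
          show "red_clique R {x, y}"
            using x(2) H.sym by (auto simp: red_clique_def)
          fix k assume k: "k \<in> {..<p} - {i}"
          show "t k ^ card {x, y} * rcard (Q k) \<le> rcard (Q k \<inter> common_nbrs V R {x, y})"
            using big[OF k] xy by (simp add: power2_eq_square)
          show "Q k \<subseteq> V \<and> 0 < t k \<and> t k \<le> 1 \<and> stable V R p (e k) (t k) (Q k)"
            using Q(1,6) ti k by simp
          show "\<kappa> * n < t k ^ p * rcard (Q k)"
            using \<kappa>t k by simp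
        next
          fix k l assume "k \<in> {..<p} - {i}" "l \<in> {..<p} - {i}" "l < k"
          then show "Q k \<inter> dominated V R (t l) (Q l) = {}"
            "real p * (e l * rcard V) < t k ^ p * rcard (Q k)"
            using Q(9,10)[of k l] by simp_all
        qed (use xy in auto)
      qed
      then have "rdeg R y (D i) \<le> rcard (\<Union>j\<in>{..<p} - {i}. Exc j)"
        by (intro of_nat_mono card_mono) (auto simp: Exc_def H.finite_dominated)
      also have "\<dots> \<le> rcard ({..<p} - {i}) * (e0 * (real p * n))"
        using Exc by (intro card_UN_bound) auto
      also have "\<dots> \<le> real p * (e0 * (real p * n))"
        using e0(1) n_pos i by (intro mult_right_mono) auto
      also have "\<dots> = \<xi> * n"
        by (subst e0(2)[symmetric]) simp
      finally show ?thesis .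
    qed
    have "D i \<inter> D j = {}" if "i \<noteq> j" for i j
      using cover that by (fastforce simp: D_def)
    then show ?thesis
      using DV D_card D_red unfolding blue_parts_def by blast
  qed
  then show ?thesis
    using \<kappa>(1) by blast
qed

text \<open>If \<open>v\<close> had many red neighbours in every part, a chain could be chosen
  inside these neighbourhoods and the clique \<open>{v}\<close> would contradict
  \<open>no_stable_chain\<close>. The chain exists because a set \<open>Q\<close> inside
  \<open>D j\<close> dominates nearly all of \<open>D j\<close>, about \<open>n\<close> vertices,
  and hence few vertices of any other part.\<close>

lemma few_red_to_some_part:
  fixes \<eta> :: real and p q :: nat
  assumes "0 < \<eta>" "\<eta> \<le> 1" "2 \<le> p"
  shows "\<exists>\<xi>>0. \<exists>\<kappa>>0. \<forall>(P :: 'a set) A (V :: 'b set) R D. ramsey_instance P A q V R p \<kappa> \<longrightarrow>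
    blue_parts V R p \<xi> (rcard P) D \<longrightarrow> (\<forall>v\<in>V. \<exists>i<p. rdeg R v (D i) < \<eta> * rcard P)"
proof -
  define \<epsilon> where "\<epsilon> = \<eta> / (8 * real p)"
  have p: "2 \<le> real p"
    using assms(3) by simp
  have \<epsilon>: "0 < \<epsilon>" "\<epsilon> \<le> 1" "real p * \<epsilon> = \<eta> / 8"
    using assms(1,2) p by (auto simp: \<epsilon>_def field_simps)
  define a :: real where "a = 1 / (8 * (real q + 1))"
  have a: "0 < a" "a \<le> 1"
    by (auto simp: a_def field_simps)
  obtain \<delta> where \<delta>: "0 < \<delta>" "\<delta> \<le> 1"
    and star: "\<And>\<sigma>. 0 < \<sigma> \<Longrightarrow> \<exists>\<kappa>>0. \<forall>(P :: 'a set) A (V :: 'b set) R. ramsey_instance P A q V R p \<kappa> \<longrightarrow>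
      dominates_few V R (rcard P) q \<epsilon> \<sigma> \<delta>"
    using dominated_threshold_exists[OF \<epsilon>(1,2) assms(3)] by blast
  obtain \<sigma> t\<^sub>0 \<kappa>\<^sub>1 where \<sigma>: "0 < \<sigma>" "0 < t\<^sub>0" "t\<^sub>0 \<le> 1" "0 < \<kappa>\<^sub>1"
    and chain: "\<forall>(P :: 'a set) A (V :: 'b set) R. ramsey_instance P A q V R p \<kappa>\<^sub>1 \<longrightarrow>
      chains_exist V R p (rcard P) a (\<eta> / 2) 1 \<delta> \<sigma> t\<^sub>0 \<kappa>\<^sub>1"
    using stable_chain_exists[OF \<delta> a half_gt_zero[OF assms(1)] zero_less_one assms(3), of q]
    by (elim exE conjE) (rule that; assumption)
  obtain \<kappa>\<^sub>2 where "0 < \<kappa>\<^sub>2" and dom': "\<forall>(P :: 'a set) A (V :: 'b set) R. ramsey_instance P A q V R p \<kappa>\<^sub>2 \<longrightarrow>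
      dominates_few V R (rcard P) q \<epsilon> \<sigma> \<delta>"
    using star \<sigma>(1) by blast
  \<comment> \<open>Double counting red pairs between \<open>Q\<close> and \<open>D j\<close> bounds
    the undominated vertices of \<open>D j\<close> by \<open>\<xi> * n / t\<close>; with
    \<open>t \<ge> t\<^sub>0\<close> this is at most \<open>\<epsilon> * n\<close>.\<close>
  define \<xi> where "\<xi> = t\<^sub>0 * \<epsilon>"
  have \<xi>: "0 < \<xi>" "\<xi> \<le> \<epsilon>" "\<xi> / t\<^sub>0 = \<epsilon>"
    using \<sigma> \<epsilon> mult_right_mono[of t\<^sub>0 1 \<epsilon>] by (auto simp: \<xi>_def)
  define \<kappa> where "\<kappa> = min \<kappa>\<^sub>1 \<kappa>\<^sub>2"
  have \<kappa>: "0 < \<kappa>" "\<kappa> \<le> \<kappa>\<^sub>1" "\<kappa> \<le> \<kappa>\<^sub>2"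
    using \<sigma> \<open>0 < \<kappa>\<^sub>2\<close> by (auto simp: \<kappa>_def)
  have "\<exists>i<p. rdeg R v (D i) < \<eta> * rcard P"
    if inst: "ramsey_instance P A q V R p \<kappa>" and parts: "blue_parts V R p \<xi> (rcard P) D" and v: "v \<in> V"
    for P :: "'a set" and A and V :: "'b set" and R D v
  proof (rule ccontr)
    assume *: "\<not> (\<exists>i<p. rdeg R v (D i) < \<eta> * rcard P)"
    interpret ramsey_instance P A q V R p \<kappa>
      by (fact inst)
    note dom = dom'[rule_format, OF mono[OF \<kappa>(3)], unfolded dominates_few_def, rule_format, folded a_def]
      and chain = chain[rule_format, OF mono[OF \<kappa>(2)], unfolded chains_exist_def]
    define U where "U i = nbrs R v (D i)" for i
    have D: "\<And>i. i < p \<Longrightarrow> D i \<subseteq> V" "\<And>i. i < p \<Longrightarrow> (1 - \<xi>) * n \<le> rcard (D i)"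
      "\<And>i y. i < p \<Longrightarrow> y \<in> D i \<Longrightarrow> rdeg R y (D i) \<le> \<xi> * n"
      "\<And>i j. i < p \<Longrightarrow> j < p \<Longrightarrow> i \<noteq> j \<Longrightarrow> D i \<inter> D j = {}"
      using parts by (auto simp: blue_parts_def)
    have fD: "finite (D i)" if "i < p" for i
      using D(1)[OF that] by (rule finite_sub)
    \<comment> \<open>One \<epsilon> for the excess in \<open>(1 + \<epsilon>) * n\<close>, one for
      the undominated vertices of \<open>D j\<close>, and one for the \<xi> by which
      \<open>D j\<close> may fall short of \<open>n\<close>.\<close>
    define b where "b = 3 * \<epsilon> * n"
    have U: "\<eta> * n \<le> rcard (U i)" "U i \<subseteq> D i" if "i < p" for i
    proof -
      show "\<eta> * n \<le> rcard (U i)"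
        using * that unfolding U_def by (meson not_less)
    qed (simp add: U_def nbrs_subset)
    have hU: "\<forall>i<p. U i \<subseteq> V \<and> \<eta> / 2 * n + (real p - 1) * b \<le> rcard (U i)"
    proof (intro allI impI conjI)
      fix i assume i: "i < p"
      show "U i \<subseteq> V"
        using U(2) D(1) i by blast
      have "(real p - 1) * b = 3 * (real p * \<epsilon> * n) - 3 * (\<epsilon> * n)"
        by (simp add: b_def algebra_simps)
      also have "real p * \<epsilon> * n = \<eta> / 8 * n"
        by (simp add: \<epsilon>(3))
      finally have "(real p - 1) * b = 3 * (\<eta> / 8 * n) - 3 * (\<epsilon> * n)" .
      moreover have "0 < \<epsilon> * n" "0 < \<eta> * n"
        using \<epsilon> assms n_pos by auto
      ultimately show "\<eta> / 2 * n + (real p - 1) * b \<le> rcard (U i)"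
        using U(1)[OF i] by linarith
    qed
    have hdom: "\<forall>i<p. \<forall>j<i. \<forall>Q\<subseteq>U j. \<forall>t. \<sigma> * n \<le> rcard Q \<longrightarrow> nearly_blue R a Q \<longrightarrow>
        t\<^sub>0 \<le> t \<longrightarrow> t \<le> \<delta> \<longrightarrow> rcard (dominated V R t Q \<inter> U i) \<le> b"
    proof (intro allI impI)
      fix i j Q t
      assume i: "i < p" and j: "j < i" and Q: "Q \<subseteq> U j" "\<sigma> * n \<le> rcard Q" "nearly_blue R a Q"
        and t: "t\<^sub>0 \<le> t" "t \<le> \<delta>"
      define B where "B = dominated V R t Q"
      have jp: "j < p"
        using i j by simp
      have QD: "Q \<subseteq> D j" "Q \<subseteq> V"
        using Q(1) U(2)[OF jp] D(1)[OF jp] by auto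
      have fQ: "finite Q"
        using QD(2) by (rule finite_sub)
      have "0 < \<sigma> * n"
        using \<sigma> n_pos by simp
      then have cQ: "0 < rcard Q"
        using Q(2) by linarith
      have "(\<Sum>y\<in>D j. rdeg R y Q) = (\<Sum>x\<in>Q. rdeg R x (D j))"
        unfolding of_nat_sum[symmetric] using sum_card_nbrs_swap[of "D j" Q R R] fQ fD[OF jp] H.sym by metis
      also have "\<dots> \<le> rcard Q * (\<xi> * n)"
        using D(3)[OF jp] QD by (intro sum_bounded_above) auto
      finally have "t * rcard Q * rcard {y \<in> D j. t * rcard Q < rdeg R y Q}
          \<le> rcard Q * (\<xi> * n)"
        using fD[OF jp] by (intro card_heavy_le) auto
      moreover have "{y \<in> D j. t * rcard Q < rdeg R y Q} = D j - B"
        using D(1)[OF jp] by (auto simp: B_def dominated_def)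
      ultimately have "t * rcard (D j - B) \<le> \<xi> * n"
        using cQ by (simp add: ac_simps)
      moreover have "t\<^sub>0 * rcard (D j - B) \<le> t * rcard (D j - B)"
        using t by (intro mult_right_mono) auto
      ultimately have "t\<^sub>0 * rcard (D j - B) \<le> t\<^sub>0 * (\<epsilon> * n)"
        by (simp add: \<xi>_def)
      then have 1: "rcard (D j - B) \<le> \<epsilon> * n"
        using \<sigma>(2) by (rule mult_left_le_imp_le)
      have "card (D j \<inter> B) + card (D j - B) = card (D j)"
        using fD[OF jp] by (metis card_Int_Diff)
      then have 2: "n - \<xi> * n - \<epsilon> * n \<le> rcard (D j \<inter> B)"
        using 1 D(2)[OF jp] by (simp add: algebra_simps)
      have fB: "finite B"
        unfolding B_def by (rule H.finite_dominated)
      have "(D j \<inter> B) \<inter> (B \<inter> U i) = {}"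
        using D(4)[of i j] U(2)[OF i] i j by auto
      then have "card (D j \<inter> B) + card (B \<inter> U i) = card ((D j \<inter> B) \<union> (B \<inter> U i))"
        using fB by (simp add: card_Un_disjoint)
      also have "\<dots> \<le> card B"
        using fB by (intro card_mono) auto
      finally have "rcard (D j \<inter> B) + rcard (B \<inter> U i) \<le> rcard B"
        by (simp flip: of_nat_add)
      moreover have "rcard B < n + \<epsilon> * n"
        using dom[OF QD(2) Q(2,3) t(2)] by (simp add: B_def algebra_simps)
      moreover have "\<xi> * n \<le> \<epsilon> * n"
        using \<xi> n_pos by (intro mult_right_mono) auto
      ultimately show "rcard (dominated V R t Q \<inter> U i) \<le> b"
        using 2 unfolding b_def B_def[symmetric] by linarith
    qed
    have b0: "0 \<le> b"
      using \<epsilon> n_pos by (simp add: b_def)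
    obtain Q t e where QU: "\<forall>i<p. Q i \<subseteq> U i"
      and Q': "stable_chain V R p a (\<sigma> * n) t\<^sub>0 \<delta> 1 (\<kappa>\<^sub>1 * n) Q t e"
      using chain[THEN spec[of _ U], THEN spec[of _ b], THEN mp, OF hU, THEN mp, OF b0, THEN mp, OF hdom]
      by (elim exE conjE) (rule that)
    note Q = QU[rule_format] stable_chainD[OF Q']
    have ti: "0 < t i" "t i \<le> 1" if "i < p" for i
      using Q(4,5)[OF that] \<sigma> \<delta> by linarith+
    show False
    proof (rule no_stable_chain[of "{..<p}" "{v}" Q t e])
      show "{..<p} \<noteq> {}"
        using assms(3) by (auto simp: lessThan_empty_iff)
      fix k assume "k \<in> {..<p}"
      then have k: "k < p"
        by simp
      have QV: "Q k \<subseteq> V" "Q k \<subseteq> nbrs R v (D k)"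
        using Q(1)[OF k] hU k by (auto simp: U_def)
      then have "Q k \<inter> common_nbrs V R {v} = Q k"
        by (auto simp: common_nbrs_def)
      then show "t k ^ card {v} * rcard (Q k) \<le> rcard (Q k \<inter> common_nbrs V R {v})"
        using ti[OF k] by (simp add: mult_left_le_one_le)
      show "Q k \<subseteq> V \<and> 0 < t k \<and> t k \<le> 1 \<and> stable V R p (e k) (t k) (Q k)"
        using QV(1) ti[OF k] Q(6)[OF k] by simp
      show "\<kappa> * n < t k ^ p * rcard (Q k)"
        using Q(8)[OF k] mult_right_mono[OF \<kappa>(2), of n] by linarith
    next
      fix k l assume "k \<in> {..<p}" "l \<in> {..<p}" "l < k"
      then show "Q k \<inter> dominated V R (t l) (Q l) = {}"
        "real p * (e l * rcard V) < t k ^ p * rcard (Q k)"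
        using Q(9,10)[of k l] by simp_all
    qed (use v in \<open>auto simp: red_clique_def\<close>)
  qed
  then show ?thesis
    using \<xi>(1) \<kappa>(1) by blast
qed

section \<open>Few blue edges between the parts\<close>

text \<open>An easy case of Hall's theorem: each list is as long as the number of choices, so greedy
  choice never gets stuck.\<close>

lemma injective_choice:
  assumes "finite W" "\<And>w. w \<in> W \<Longrightarrow> finite (S w) \<and> card W \<le> card (S w)"
  shows "\<exists>g. inj_on g W \<and> (\<forall>w\<in>W. g w \<in> S w)"
proof -
  have "\<exists>g. inj_on g W' \<and> (\<forall>w\<in>W'. g w \<in> S w)" if "finite W'" "W' \<subseteq> W" for W'
    using that
  proof (induction W' rule: finite_induct)
    case (insert w W')
    then obtain g where g: "inj_on g W'" "\<forall>w\<in>W'. g w \<in> S w"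
      by auto
    have "card (g ` W') \<le> card W'"
      using insert.hyps by (intro card_image_le)
    also have "\<dots> < card W"
      using insert.hyps insert.prems assms(1) by (intro psubset_card_mono) auto
    also have "\<dots> \<le> card (S w)"
      using assms(2) insert.prems by auto
    finally obtain x where x: "x \<in> S w" "x \<notin> g ` W'"
      using insert.hyps by (metis card_mono finite_imageI leD subsetI)
    have "inj_on (g(w := x)) (insert w W')"
      using g(1) x(2) insert.hyps by (auto simp: inj_on_def)
    moreover have "\<forall>w'\<in>insert w W'. (g(w := x)) w' \<in> S w'"
      using g(2) x(1) insert.hyps by auto
    ultimately show ?case
      by blast
  qed simp
  then show ?thesis
    using assms(1) by blast
qed

lemma exists_ge_average:
  fixes F :: "'a \<Rightarrow> real"
  assumes "finite X" "X \<noteq> {}" "rcard X \<le> m" "0 \<le> K" "m * K \<le> (\<Sum>x\<in>X. F x)"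
  shows "\<exists>x\<in>X. K \<le> F x"
proof (rule ccontr)
  assume "\<not> ?thesis"
  then have "(\<Sum>x\<in>X. F x) < (\<Sum>x\<in>X. K)"
    using assms by (intro sum_strict_mono) auto
  also have "\<dots> \<le> m * K"
    using assms by (simp add: mult_right_mono)
  finally show False
    using assms by linarith
qed

section \<open>Embedding guided by a potential function\<close>

context degenerate_graph
begin

text \<open>Greedy embedding of \<open>L\<close> that never decreases the potential
  \<open>\<Sum>w\<in>W. |Y\<^sub>w| \<beta>\<^bsup>-|N(w) \<inter> L|\<^esup>\<close>, where \<open>Y\<^sub>w\<close> is the set of places in \<open>Y\<close> still available for \<open>w\<close>.\<close>

lemma potential_emb:
  fixes \<beta> r :: real
  assumes "L \<subseteq> P" "finite X" "X \<noteq> {}" "finite Y" "finite W" "0 < \<beta>" "\<beta> < 1"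
    and symR: "\<And>x y. R x y \<Longrightarrow> R y x"
    and Y: "\<And>y. y \<in> Y \<Longrightarrow> 2 * \<beta> * rcard X \<le> rdeg (non R) y X"
    and X: "\<And>x. x \<in> X \<Longrightarrow> rdeg R x X \<le> r"
    and r: "0 \<le> r" "rcard L + real q * r \<le> \<beta> * rcard X"
  shows "\<exists>\<phi>. \<phi> ` L \<subseteq> X \<and> blue_emb A R \<phi> L \<and> rcard W * rcard Y \<le>
    (\<Sum>w\<in>W. rcard {y \<in> Y. \<forall>a\<in>L. A w a \<longrightarrow> \<not> R y (\<phi> a)} * (1 / \<beta>) ^ card (nbrs A w L))"
proof -
  define Yw where "Yw \<phi> H w = {y \<in> Y. \<forall>a\<in>H. A w a \<longrightarrow> \<not> R y (\<phi> a)}" for \<phi> H w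
  have fYw: "finite (Yw \<phi> H w)" for \<phi> H w
    using assms(4) by (simp add: Yw_def)
  have fL: "finite L"
    using assms(1) fin finite_subset by blast
  have "H \<subseteq> L \<longrightarrow> (\<exists>\<phi>. \<phi> ` H \<subseteq> X \<and> blue_emb A R \<phi> H \<and> rcard W * rcard Y \<le>
    (\<Sum>w\<in>W. rcard (Yw \<phi> H w) * (1 / \<beta>) ^ card (nbrs A w H)))" if "H \<subseteq> P" for H
    using that
  proof (induction rule: degenerate_induct)
    case empty
    have "nbrs A w {} = {}" for w
      by auto
    then show ?case
      by (simp add: Yw_def blue_emb_def)
  next
    case (step H a)
    show ?case
    proof
      assume HL: "H \<subseteq> L"
      define H' where "H' = H - {a}"
      obtain \<phi> where \<phi>: "\<phi> ` H' \<subseteq> X" "blue_emb A R \<phi> H'" "rcard W * rcard Y \<le>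
          (\<Sum>w\<in>W. rcard (Yw \<phi> H' w) * (1 / \<beta>) ^ card (nbrs A w H'))"
        using step.IH[of H'] HL by (auto simp: H'_def)
      have fH: "finite H" "finite H'"
        using HL fL finite_subset by (auto simp: H'_def)
      have H: "H = insert a H'" "a \<notin> H'"
        using step.hyps(2) by (auto simp: H'_def)
      define Bd where "Bd = \<phi> ` H' \<union> (\<Union>u\<in>nbrs A a H'. nbrs R (\<phi> u) X)"
      have Bd: "rcard Bd \<le> \<beta> * rcard X"
      proof -
        have "card (\<phi> ` H') \<le> card L"
          using HL by (intro order_trans[OF card_image_le[OF fH(2)]] card_mono fL) (auto simp: H'_def)
        moreover have "rcard (\<Union>u\<in>nbrs A a H'. nbrs R (\<phi> u) X) \<le> real q * r"
        proof -
          have "rcard (\<Union>u\<in>nbrs A a H'. nbrs R (\<phi> u) X) \<le> rdeg A a H' * r"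
            using \<phi>(1) fH by (intro card_UN_bound X) auto
          also have "\<dots> \<le> real q * r"
            using step.hyps(3) card_nbrs_mono[OF fH(1), of H' A a] r(1)
            by (intro mult_right_mono) (auto simp: H'_def)
          finally show ?thesis .
        qed
        ultimately show ?thesis
          using card_Un_le[of "\<phi> ` H'" "\<Union>u\<in>nbrs A a H'. nbrs R (\<phi> u) X"] r(2) unfolding Bd_def
          by linarith
      qed
      have fBd: "finite Bd"
        using fH assms(2) by (auto simp: Bd_def)
      define X' where "X' = X - Bd"
      have fX': "finite X'" "card X' \<le> card X"
        using assms(2) by (auto simp: X'_def intro: card_mono)
      have X'big: "rdeg E y X - \<beta> * rcard X \<le> rdeg E y X'"
        for E :: "'b \<Rightarrow> 'b \<Rightarrow> bool" and y
      proof -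
        have "nbrs E y X \<subseteq> nbrs E y X' \<union> Bd"
          by (auto simp: X'_def)
        then have "rdeg E y X \<le> rdeg E y X' + rcard Bd"
          using fX' fBd by (intro card_cover) auto
        then show ?thesis
          using Bd by linarith
      qed
      have "X' \<noteq> {}"
      proof
        assume "X' = {}"
        then have "card X \<le> card Bd"
          using fBd by (intro card_mono) (auto simp: X'_def)
        moreover have "\<beta> * rcard X < rcard X"
          using assms by (simp add: card_gt_0_iff)
        ultimately show False
          using Bd by linarith
      qed
      define c where "c w = (1 / \<beta>) ^ card (nbrs A w H')" for w
      have c0: "0 \<le> c w" for w
        using assms by (simp add: c_def)
      define Wa where "Wa = {w \<in> W. A w a}"
      \<comment> \<open>Placing \<open>a\<close> at \<open>x\<close> turns the weighted contribution
        of the affected vertices into \<open>F x\<close>, before the new factor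
        \<open>1 / \<beta>\<close>. Each \<open>y\<close> has \<open>2 * \<beta> * |X|\<close>
        non-red vertices in \<open>X\<close>, at most half as many places are forbidden, so
        averaging over \<open>X'\<close> yields \<open>F x \<ge> K\<close>, that is, \<beta> times
        the old contribution; the factor \<open>1 / \<beta>\<close> makes up for the loss.\<close>
      define F where "F x = (\<Sum>w\<in>Wa. c w * rdeg (\<lambda>x y. \<not> R y x) x (Yw \<phi> H' w))" for x
      define K where "K = (\<Sum>w\<in>Wa. c w * (\<beta> * rcard (Yw \<phi> H' w)))"
      have "rcard X * K = (\<Sum>w\<in>Wa. c w * (rcard (Yw \<phi> H' w) * (\<beta> * rcard X)))"
        by (simp add: K_def sum_distrib_left ac_simps)
      also have "\<dots> \<le> (\<Sum>w\<in>Wa. c w * (\<Sum>y\<in>Yw \<phi> H' w. rdeg (non R) y X'))"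
      proof (intro sum_mono mult_left_mono c0)
        fix w
        show "rcard (Yw \<phi> H' w) * (\<beta> * rcard X)
            \<le> (\<Sum>y\<in>Yw \<phi> H' w. rdeg (non R) y X')"
        proof (rule sum_bounded_below)
          fix y assume "y \<in> Yw \<phi> H' w"
          then have "y \<in> Y"
            by (simp add: Yw_def)
          then show "\<beta> * rcard X \<le> rdeg (non R) y X'"
            using Y[of y] X'big[of "non R" y] by linarith
        qed
      qed
      also have "\<dots> = (\<Sum>w\<in>Wa. c w * (\<Sum>x\<in>X'. rdeg (\<lambda>x y. \<not> R y x) x (Yw \<phi> H' w)))"
        unfolding of_nat_sum[symmetric]
        using sum_card_nbrs_swap[OF fYw fX'(1), of "non R" "\<lambda>x y. \<not> R y x" \<phi> H'] by simp
      also have "\<dots> = (\<Sum>x\<in>X'. F x)"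
        unfolding F_def sum_distrib_left by (rule sum.swap)
      finally have "rcard X * K \<le> (\<Sum>x\<in>X'. F x)" .
      moreover have "0 \<le> K"
        using assms c0 by (auto simp: K_def intro!: sum_nonneg)
      ultimately obtain x where x: "x \<in> X'" "K \<le> F x"
        using exists_ge_average[of X' "rcard X" K F] fX' \<open>X' \<noteq> {}\<close> by auto
      define \<psi> where "\<psi> = \<phi>(a := x)"
      have xX: "x \<in> X" "x \<notin> \<phi> ` H'" "\<And>u. u \<in> H' \<Longrightarrow> A a u \<Longrightarrow> \<not> R (\<phi> u) x"
        using x by (auto simp: X'_def Bd_def)
      have \<psi>: "\<psi> a = x" "\<And>u. u \<in> H' \<Longrightarrow> \<psi> u = \<phi> u"
        using H by (auto simp: \<psi>_def)
      have "blue_emb A R \<psi> H"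
        unfolding \<psi>_def H(1) using xX(2,3) H(2) by (intro blue_emb_insert[OF symR \<phi>(2)]) auto
      moreover have "\<psi> ` H \<subseteq> X"
        using \<phi>(1) xX(1) \<psi> H by auto
      moreover have "(\<Sum>w\<in>W. rcard (Yw \<phi> H' w) * c w)
          \<le> (\<Sum>w\<in>W. rcard (Yw \<psi> H w) * (1 / \<beta>) ^ card (nbrs A w H))"
      proof -
        have in_Wa: "rcard (Yw \<psi> H w) * (1 / \<beta>) ^ card (nbrs A w H)
            = c w * rdeg (\<lambda>x y. \<not> R y x) x (Yw \<phi> H' w) / \<beta>" if "w \<in> Wa" for w
        proof -
          have "Yw \<psi> H w = nbrs (\<lambda>x y. \<not> R y x) x (Yw \<phi> H' w)"
            using that H \<psi> by (auto simp: Yw_def Wa_def)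
          moreover have "nbrs A w H = insert a (nbrs A w H')"
            using that H by (auto simp: Wa_def)
          ultimately show ?thesis
            using H(2) fH by (simp add: c_def)
        qed
        have notin_Wa: "rcard (Yw \<psi> H w) * (1 / \<beta>) ^ card (nbrs A w H)
            = rcard (Yw \<phi> H' w) * c w" if "w \<in> W - Wa" for w
        proof -
          have "Yw \<psi> H w = Yw \<phi> H' w"
            using that H \<psi> by (auto simp: Yw_def Wa_def)
          moreover have "nbrs A w H = nbrs A w H'"
            using that H by (auto simp: Wa_def)
          ultimately show ?thesis
            by (simp add: c_def)
        qed
        have fWa: "Wa \<subseteq> W"
          by (auto simp: Wa_def)
        have "(\<Sum>w\<in>Wa. rcard (Yw \<phi> H' w) * c w) = K / \<beta>"
          using assms(6) by (simp add: K_def sum_divide_distrib ac_simps)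
        also have "\<dots> \<le> F x / \<beta>"
          using x(2) assms(6) by (simp add: divide_right_mono)
        also have "\<dots> = (\<Sum>w\<in>Wa. rcard (Yw \<psi> H w) * (1 / \<beta>) ^ card (nbrs A w H))"
          using in_Wa by (simp add: F_def sum_divide_distrib)
        finally have "(\<Sum>w\<in>Wa. rcard (Yw \<phi> H' w) * c w)
            \<le> (\<Sum>w\<in>Wa. rcard (Yw \<psi> H w) * (1 / \<beta>) ^ card (nbrs A w H))" .
        moreover have "(\<Sum>w\<in>W - Wa. rcard (Yw \<phi> H' w) * c w)
            = (\<Sum>w\<in>W - Wa. rcard (Yw \<psi> H w) * (1 / \<beta>) ^ card (nbrs A w H))"
          using notin_Wa by (intro sum.cong) auto
        ultimately show ?thesis
          unfolding sum.subset_diff[OF fWa assms(5)] by linarith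
      qed
      ultimately show "\<exists>\<phi>. \<phi> ` H \<subseteq> X \<and> blue_emb A R \<phi> H \<and> rcard W * rcard Y \<le>
          (\<Sum>w\<in>W. rcard (Yw \<phi> H w) * (1 / \<beta>) ^ card (nbrs A w H))"
        using \<phi>(3) unfolding c_def by (intro exI[of _ \<psi>]) linarith
    qed
  qed
  then show ?thesis
    using assms(1) unfolding Yw_def by blast
qed

end

context ramsey_instance
begin

text \<open>Since \<open>X\<close> may be slightly smaller than \<open>n\<close>, slightly more than
  the missing number of vertices has to be placed outside. Independent vertices \<open>W\<close> of
  low degree are reserved, and their neighbours are embedded into \<open>X\<close> by
  \<open>potential_emb\<close>, so that many \<open>w\<close> keep linearly many common blue
  neighbours \<open>Yw w\<close> outside. Some of \<open>W\<close> goes there, and the rest of the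
  pattern fits greedily into \<open>X\<close>.\<close>

lemma few_blue_to_outside_aux:
  fixes \<delta> \<xi> :: real
  defines "\<beta> \<equiv> \<delta> / (4 * (real p)\<^sup>2)"
  defines "\<omega> \<equiv> \<beta> / (32 * (real q + 1))"
  defines "\<mu> \<equiv> \<beta> ^ (4 * q) / 2"
  defines "m \<equiv> min (\<mu> * (\<omega> / 2)) (\<mu> * (\<delta> / (2 * real p)))"
  assumes \<delta>: "0 < \<delta>" "\<delta> \<le> 1"
    and \<xi>: "0 < \<xi>" "\<xi> \<le> 1/2" "real q * \<xi> \<le> \<beta> / 4" "(1 + 5 * real q) * \<xi> \<le> m / 2"
    and \<kappa>: "\<kappa> \<le> \<omega> / 2" "\<kappa> \<le> m / 4"
    and X: "X \<subseteq> V" "(1 - \<xi>) * n \<le> rcard X" "\<And>y. y \<in> X \<Longrightarrow> rdeg R y X \<le> \<xi> * n"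
  shows "(\<Sum>y\<in>V - X. rdeg (non R) y X) \<le> \<delta> * n\<^sup>2"
proof (rule ccontr)
  assume "\<not> ?thesis"
  then have big: "\<delta> * n\<^sup>2 < (\<Sum>y\<in>V - X. rdeg (non R) y X)"
    by simp
  have p: "2 \<le> real p"
    using p2 by simp
  have "1 < 4 * (real p)\<^sup>2"
    using p power_mono[of 2 "real p" 2] by simp
  then have \<beta>: "0 < \<beta>" "\<beta> < 1"
    using \<delta> p by (auto simp: \<beta>_def divide_simps)
  have \<omega>: "0 < \<omega>" "8 * real q * \<omega> \<le> \<beta> / 4" "2 * (real q + 1) * \<omega> \<le> 1"
  proof -
    show "0 < \<omega>"
      using \<beta> by (simp add: \<omega>_def)
    have *: "\<omega> * (32 * (real q + 1)) = \<beta>"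
      by (simp add: \<omega>_def)
    show "8 * real q * \<omega> \<le> \<beta> / 4" "2 * (real q + 1) * \<omega> \<le> 1"
      using * \<open>0 < \<omega>\<close> \<beta> by (auto simp: algebra_simps)
  qed
  have \<mu>: "0 < \<mu>"
    using \<beta> by (simp add: \<mu>_def)
  have large': "2 \<le> \<omega> * n" "4 \<le> m * n"
    using large mult_right_mono[OF \<kappa>(1), of n] mult_right_mono[OF \<kappa>(2), of n] by simp_all
  have fX: "finite X"
    using X(1) by (rule finite_sub)
  have cX: "n / 2 \<le> rcard X"
    using X(2) \<xi>(2) mult_right_mono[of \<xi> "1/2" n] by (simp add: algebra_simps)
  have cXV: "rcard X \<le> real p * n"
    using card_mono[OF H.fin X(1)] card_V_bounds(1) by linarith
  \<comment> \<open>Vertices below this density account for at most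
    \<open>p * n * (2 * \<beta> * (p * n)) = \<delta> / 2 * n\<^sup>2\<close> blue pairs; this fixes
    \<beta> and leaves half of the pairs to \<open>Y\<close>.\<close>
  define Y where "Y = {y \<in> V - X. 2 * \<beta> * rcard X \<le> rdeg (non R) y X}"
  have fY: "finite Y"
    using H.fin by (simp add: Y_def)
  have cY: "\<delta> / (2 * real p) * n \<le> rcard Y"
  proof -
    have "(\<Sum>y\<in>V - X. rdeg (non R) y X)
        = (\<Sum>y\<in>V - X - Y. rdeg (non R) y X)
          + (\<Sum>y\<in>Y. rdeg (non R) y X)"
      using H.fin by (intro sum.subset_diff) (auto simp: Y_def)
    also have "(\<Sum>y\<in>V - X - Y. rdeg (non R) y X)
        \<le> rcard (V - X - Y) * (2 * \<beta> * rcard X)"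
      by (intro sum_bounded_above) (auto simp: Y_def)
    also have "\<dots> \<le> (real p * n) * (2 * \<beta> * (real p * n))"
    proof (intro mult_mono)
      have "card (V - X - Y) \<le> card V"
        using H.fin by (intro card_mono) auto
      then show "rcard (V - X - Y) \<le> real p * n"
        using card_V_bounds(1) by linarith
    qed (use \<beta> cXV n_pos p in auto)
    also have "(\<Sum>y\<in>Y. rdeg (non R) y X) \<le> rcard Y * (real p * n)"
    proof (rule sum_bounded_above)
      fix y
      show "rdeg (non R) y X \<le> real p * n"
        using card_nbrs_le[OF fX, of "non R" y] cXV by linarith
    qed
    finally have "\<delta> * n\<^sup>2 < real p * n * (2 * \<beta> * (real p * n)) + rcard Y * (real p * n)"
      using big by linarith
    also have "real p * n * (2 * \<beta> * (real p * n)) = \<delta> / 2 * n\<^sup>2"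
      using p by (simp add: \<beta>_def power2_eq_square)
    finally have "(\<delta> / 2 * n) * n < (rcard Y * real p) * n"
      by (simp add: power2_eq_square algebra_simps)
    then have "\<delta> / 2 * n < rcard Y * real p"
      using n_pos by (simp only: mult_less_cancel_right_pos)
    then show ?thesis
      using p by (simp add: field_simps)
  qed
  obtain I where I: "I \<subseteq> P" "card P \<le> 2 * (q + 1) * card I" "\<And>u v. u \<in> I \<Longrightarrow> v \<in> I \<Longrightarrow> \<not> A u v"
    "\<And>v. v \<in> I \<Longrightarrow> card (nbrs A v P) \<le> 4 * q"
    using G.independent_low_degree_set by blast
  have fI: "finite I"
    using I(1) G.fin finite_subset by blast
  have "\<omega> * n \<le> rcard I"
  proof -
    have "rcard P \<le> real (2 * (q + 1) * card I)"
      using I(2) by (rule of_nat_mono)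
    then have "\<omega> * n \<le> \<omega> * (2 * (real q + 1) * rcard I)"
      using \<omega>(1) by (intro mult_left_mono) (auto simp: algebra_simps)
    also have "\<dots> = (2 * (real q + 1) * \<omega>) * rcard I"
      by simp
    also have "\<dots> \<le> 1 * rcard I"
      using \<omega>(3) by (intro mult_right_mono) auto
    finally show ?thesis
      by simp
  qed
  then have "nat \<lfloor>\<omega> * n\<rfloor> \<le> card I"
    by linarith
  then obtain W where W: "W \<subseteq> I" "card W = nat \<lfloor>\<omega> * n\<rfloor>"
    by (meson obtain_subset_with_card_n)
  have fW: "finite W"
    using W(1) fI finite_subset by blast
  have cW: "rcard W \<le> \<omega> * n" "\<omega> / 2 * n \<le> rcard W"
    using W(2) large'(1) by linarith+
  define S where "S = (\<Union>w\<in>W. nbrs A w P)"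
  have WP: "W \<subseteq> P"
    using W(1) I(1) by blast
  have "\<not> A w x" if "w \<in> W" "x \<in> W" for w x
    using that I(3) W(1) by blast
  then have "S \<subseteq> P - W"
    by (auto simp: S_def)
  \<comment> \<open>Closing up inside \<open>P - W\<close> keeps \<open>W\<close> out of
    \<open>L\<close>. Afterwards every vertex outside \<open>L\<close> has at most
    \<open>4 * q\<close> neighbours in \<open>L\<close>: those in \<open>W\<close> by their degree,
    the others by the closure.\<close>
  then obtain L where L: "S \<subseteq> L" "L \<subseteq> P - W" "card L \<le> 2 * card S"
    "\<And>v. v \<in> P - W - L \<Longrightarrow> card (nbrs A v L) \<le> 2 * q"
    using G.closure_exists[of "P - W" S] by blast
  have fL: "finite L"
    using L(2) G.fin finite_subset by (metis finite_Diff)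
  have cL: "rcard L \<le> \<beta> / 4 * n"
  proof -
    have "rcard S \<le> rcard W * real (4 * q)"
      unfolding S_def using fW I(4) W(1) by (intro card_UN_bound of_nat_mono) auto
    moreover have "rcard L \<le> real (2 * card S)"
      using L(3) by (rule of_nat_mono)
    ultimately have "rcard L \<le> 8 * real q * rcard W"
      by (simp add: ac_simps)
    also have "\<dots> \<le> 8 * real q * (\<omega> * n)"
      using cW(1) by (intro mult_left_mono) auto
    also have "\<dots> = (8 * real q * \<omega>) * n"
      by simp
    also have "\<dots> \<le> \<beta> / 4 * n"
      using \<omega>(2) n_pos by (intro mult_right_mono) auto
    finally show ?thesis .
  qed
  have deg4: "card (nbrs A w L) \<le> 4 * q" if "w \<in> W" for w
  proof -
    have "card (nbrs A w L) \<le> card (nbrs A w P)"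
      using L(2) G.fin by (intro card_nbrs_mono) auto
    then show ?thesis
      using I(4)[of w] W(1) that by auto
  qed
  have "\<exists>\<phi>. \<phi> ` L \<subseteq> X \<and> blue_emb A R \<phi> L \<and> rcard W * rcard Y \<le>
    (\<Sum>w\<in>W. rcard {y \<in> Y. \<forall>a\<in>L. A w a \<longrightarrow> \<not> R y (\<phi> a)} * (1 / \<beta>) ^ card (nbrs A w L))"
  proof (rule G.potential_emb[where r = "\<xi> * n"])
    show "X \<noteq> {}"
      using cX n_pos by auto
    have "real q * (\<xi> * n) \<le> \<beta> / 4 * n"
      using mult_right_mono[OF \<xi>(3), of n] by simp
    moreover have "\<beta> / 2 * n \<le> \<beta> * rcard X"
      using mult_left_mono[OF cX, of \<beta>] \<beta> by simp
    ultimately show "rcard L + real q * (\<xi> * n) \<le> \<beta> * rcard X"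
      using cL by linarith
  qed (use L(2) fX fY fW \<beta> \<xi>(1) X(3) H.sym in \<open>auto simp: Y_def\<close>)
  then obtain \<phi> where \<phi>: "\<phi> ` L \<subseteq> X" "blue_emb A R \<phi> L"
    and pot: "rcard W * rcard Y \<le>
      (\<Sum>w\<in>W. rcard {y \<in> Y. \<forall>a\<in>L. A w a \<longrightarrow> \<not> R y (\<phi> a)} * (1 / \<beta>) ^ card (nbrs A w L))"
    by blast
  define Yw where "Yw w = {y \<in> Y. \<forall>a\<in>L. A w a \<longrightarrow> \<not> R y (\<phi> a)}" for w
  have Yw: "finite (Yw w)" "card (Yw w) \<le> card Y" for w
    using fY by (auto simp: Yw_def intro: card_mono)
  have "rcard W * rcard Y \<le> (\<Sum>w\<in>W. rcard (Yw w) * (1 / \<beta>) ^ (4 * q))"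
  proof -
    have "(\<Sum>w\<in>W. rcard (Yw w) * (1 / \<beta>) ^ card (nbrs A w L))
        \<le> (\<Sum>w\<in>W. rcard (Yw w) * (1 / \<beta>) ^ (4 * q))"
      using deg4 \<beta> by (intro sum_mono mult_left_mono power_increasing) auto
    then show ?thesis
      using pot unfolding Yw_def by linarith
  qed
  also have "\<dots> = (\<Sum>w\<in>W. rcard (Yw w)) / \<beta> ^ (4 * q)"
    by (simp add: power_one_over divide_inverse power_inverse flip: sum_distrib_right)
  finally have pot': "2 * \<mu> * (rcard W * rcard Y) \<le> (\<Sum>w\<in>W. rcard (Yw w))"
    using \<beta> by (simp add: \<mu>_def field_simps)
  \<comment> \<open>The available places average at least \<open>2 * \<mu> * |Y|\<close> over
    \<open>W\<close>, so at least \<open>\<mu> * |W|\<close> vertices have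
    \<open>\<mu> * |Y|\<close> of them.\<close>
  define W\<^sub>1 where "W\<^sub>1 = {w \<in> W. \<mu> * rcard Y \<le> rcard (Yw w)}"
  have cY0: "0 < rcard Y"
  proof -
    have "0 < \<delta> / (2 * real p) * n"
      using \<delta> p n_pos by simp
    then show ?thesis
      using cY by linarith
  qed
  have cW1: "\<mu> * rcard W \<le> rcard W\<^sub>1"
  proof -
    have "(\<Sum>w\<in>W. rcard (Yw w)) = (\<Sum>w\<in>W - W\<^sub>1. rcard (Yw w)) + (\<Sum>w\<in>W\<^sub>1. rcard (Yw w))"
      using fW by (intro sum.subset_diff) (auto simp: W\<^sub>1_def)
    also have "(\<Sum>w\<in>W - W\<^sub>1. rcard (Yw w)) \<le> rcard (W - W\<^sub>1) * (\<mu> * rcard Y)"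
      by (intro sum_bounded_above) (auto simp: W\<^sub>1_def)
    also have "\<dots> \<le> rcard W * (\<mu> * rcard Y)"
      using \<mu> fW by (intro mult_right_mono of_nat_mono card_mono) auto
    also have "(\<Sum>w\<in>W\<^sub>1. rcard (Yw w)) \<le> rcard W\<^sub>1 * rcard Y"
      using Yw by (intro sum_bounded_above) auto
    finally have "(\<mu> * rcard W) * rcard Y \<le> rcard W\<^sub>1 * rcard Y"
      using pot' by (simp add: algebra_simps)
    then show ?thesis
      using cY0 by (rule mult_right_le_imp_le)
  qed
  \<comment> \<open>Moving \<open>k\<close> vertices out of \<open>X\<close> has to outweigh the
    \<open>\<xi> * n\<close> vertices missing from \<open>X\<close> and the red neighbours of
    \<open>4 * q\<close> old and \<open>q\<close> new neighbours; the final 1 makes the inequality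
    strict.\<close>
  define k where "k = nat \<lceil>(1 + 5 * real q) * \<xi> * n\<rceil> + 1"
  have k: "(1 + 5 * real q) * \<xi> * n < real k" "real k \<le> m * n"
  proof -
    have 0: "0 \<le> (1 + 5 * real q) * \<xi> * n"
      using \<xi> by simp
    show "(1 + 5 * real q) * \<xi> * n < real k"
      unfolding k_def using 0 by linarith
    have "(1 + 5 * real q) * \<xi> * n \<le> m / 2 * n"
      using \<xi>(4) n_pos by (intro mult_right_mono) auto
    then show "real k \<le> m * n"
      unfolding k_def using large'(2) 0 by linarith
  qed
  have "m * n \<le> rcard W\<^sub>1"
  proof -
    have "m * n \<le> \<mu> * (\<omega> / 2) * n"
      using n_pos by (intro mult_right_mono) (auto simp: m_def)
    also have "\<dots> \<le> \<mu> * rcard W"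
      using cW(2) \<mu> mult_left_mono[of "\<omega> / 2 * n" "rcard W" \<mu>] by (simp add: mult.assoc)
    finally show ?thesis
      using cW1 by linarith
  qed
  then have "k \<le> card W\<^sub>1"
    using k(2) by linarith
  then obtain W\<^sub>2 where W2: "W\<^sub>2 \<subseteq> W\<^sub>1" "card W\<^sub>2 = k" "finite W\<^sub>2"
    by (meson obtain_subset_with_card_n)
  have W2W: "W\<^sub>2 \<subseteq> W"
    using W2(1) by (auto simp: W\<^sub>1_def)
  have "\<exists>g. inj_on g W\<^sub>2 \<and> (\<forall>w\<in>W\<^sub>2. g w \<in> Yw w)"
  proof (rule injective_choice[OF W2(3)])
    fix w assume "w \<in> W\<^sub>2"
    then have "\<mu> * rcard Y \<le> rcard (Yw w)"
      using W2(1) by (auto simp: W\<^sub>1_def)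
    moreover have "m * n \<le> \<mu> * rcard Y"
    proof -
      have "m * n \<le> \<mu> * (\<delta> / (2 * real p)) * n"
        using n_pos by (intro mult_right_mono) (auto simp: m_def)
      also have "\<dots> \<le> \<mu> * rcard Y"
        using mult_left_mono[OF cY, of \<mu>] \<mu> by (simp add: mult.assoc)
      finally show ?thesis .
    qed
    ultimately have "real k \<le> rcard (Yw w)"
      using k(2) by linarith
    then show "finite (Yw w) \<and> card W\<^sub>2 \<le> card (Yw w)"
      using Yw(1) W2(2) by simp
  qed
  then obtain g where g: "inj_on g W\<^sub>2" "\<And>w. w \<in> W\<^sub>2 \<Longrightarrow> g w \<in> Yw w"
    by blast
  define \<phi>' where "\<phi>' = (\<lambda>u. if u \<in> W\<^sub>2 then g u else \<phi> u)"
  define U where "U = L \<union> W\<^sub>2"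
  have LW: "L \<inter> W\<^sub>2 = {}"
    using L(2) W2W by blast
  have gY: "g w \<in> Y" "g w \<notin> X" "g w \<in> V" if "w \<in> W\<^sub>2" for w
    using g(2)[OF that] by (auto simp: Yw_def Y_def)
  have \<phi>'L: "\<phi>' u = \<phi> u" "\<phi> u \<in> X" if "u \<in> L" for u
    using that LW \<phi>(1) by (auto simp: \<phi>'_def)
  have \<phi>'W: "\<phi>' w = g w" if "w \<in> W\<^sub>2" for w
    using that by (simp add: \<phi>'_def)
  have emb: "blue_emb A R \<phi>' U"
    unfolding U_def \<phi>'_def
  proof (rule G.blue_emb_union[OF H.sym \<phi>(2) _ LW])
    have "\<not> A u v" if "u \<in> W\<^sub>2" "v \<in> W\<^sub>2" for u v
      using that I(3) W2W W(1) by blast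
    then show "blue_emb A R g W\<^sub>2"
      using g(1) by (simp add: blue_emb_def)
    have "g ` W\<^sub>2 \<inter> X = {}"
      using gY(2) by auto
    then show "\<phi> ` L \<inter> g ` W\<^sub>2 = {}"
      using \<phi>(1) by blast
    show "\<not> R (\<phi> a) (g w)" if "a \<in> L" "w \<in> W\<^sub>2" "A a w" for a w
      using g(2)[OF that(2)] that(1) G.sym[OF that(3)] H.sym by (auto simp: Yw_def)
  qed
  define Z where "Z = P - U"
  have fU: "finite U"
    using fL W2(3) by (simp add: U_def)
  have UP: "U \<subseteq> P"
    using L(2) W2W WP by (auto simp: U_def)
  have "\<exists>\<psi>. blue_emb A R \<psi> (U \<union> Z) \<and> (\<forall>u\<in>U. \<psi> u = \<phi>' u) \<and> (\<forall>u\<in>Z. \<psi> u \<in> X)"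
  proof (rule G.extend_blue_emb_count[where a = "\<lambda>_. 4 * real q * (\<xi> * n)" and b = "\<lambda>_. \<xi> * n"])
    fix v assume v: "v \<in> Z"
    have "\<phi>' ` U \<inter> X \<subseteq> \<phi> ` L"
      using \<phi>'L(1) \<phi>'W gY(2) by (auto simp: U_def)
    then have "card (\<phi>' ` U \<inter> X) \<le> card (\<phi> ` L)"
      using fL by (intro card_mono) auto
    also have "\<dots> \<le> card L"
      using fL by (rule card_image_le)
    finally have 1: "card (\<phi>' ` U \<inter> X) \<le> card L" .
    have 2: "card {w' \<in> Z - {v}. X \<inter> X \<noteq> {}} \<le> card Z"
      using G.fin by (intro card_mono) (auto simp: Z_def)
    have "card U = card L + k"
      using LW fL W2 by (simp add: U_def card_Un_disjoint)
    moreover have "card Z + card U = card P"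
      unfolding Z_def using UP fU G.fin by (simp add: card_Diff_subset card_mono)
    ultimately have 3: "rcard L + rcard Z + real k = n"
      by (simp flip: of_nat_add)
    have 4: "\<xi> * n + 5 * (real q * (\<xi> * n)) < real k"
      using k(1) by (simp add: algebra_simps)
    have 5: "n - \<xi> * n \<le> rcard X"
      using X(2) by (simp add: algebra_simps)
    have "4 * real q * (\<xi> * n) = 4 * (real q * (\<xi> * n))"
      by simp
    then show "rcard (\<phi>' ` U \<inter> X) + rcard {w' \<in> Z - {v}. X \<inter> X \<noteq> {}}
        + 4 * real q * (\<xi> * n) + real q * (\<xi> * n) < rcard X"
      using 1 2 3 4 5 by linarith
    have vW: "v \<notin> W\<^sub>2" "v \<in> P" "v \<notin> L"
      using v by (auto simp: Z_def U_def)
    have noW: "\<not> A v w" if "w \<in> W\<^sub>2" for w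
    proof
      assume "A v w"
      then have "v \<in> S"
        using that W2W vW(2) G.sym by (auto simp: S_def)
      then show False
        using L(1) vW(3) by blast
    qed
    have deg: "card (nbrs A v L) \<le> 4 * q"
    proof (cases "v \<in> W")
      case True
      then show ?thesis
        by (rule deg4)
    next
      case False
      then show ?thesis
        using L(4)[of v] vW by auto
    qed
    have "{x \<in> X. \<exists>u\<in>U. A v u \<and> R (\<phi>' u) x} \<subseteq> (\<Union>u\<in>nbrs A v L. nbrs R (\<phi> u) X)"
      using noW \<phi>'L(1) by (auto simp: U_def)
    then have "rcard {x \<in> X. \<exists>u\<in>U. A v u \<and> R (\<phi>' u) x}
        \<le> rcard (\<Union>u\<in>nbrs A v L. nbrs R (\<phi> u) X)"
      using fL fX by (intro of_nat_mono card_mono) auto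
    also have "\<dots> \<le> rdeg A v L * (\<xi> * n)"
      using \<phi>'L(2) X(3) fL by (intro card_UN_bound) auto
    also have "\<dots> \<le> real (4 * q) * (\<xi> * n)"
      using deg \<xi>(1) n_pos by (intro mult_right_mono of_nat_mono) auto
    finally show "rcard {x \<in> X. \<exists>u\<in>U. A v u \<and> R (\<phi>' u) x} \<le> 4 * real q * (\<xi> * n)"
      by simp
  qed (use emb fU fX X(3) \<xi>(1) H.sym in \<open>auto simp: Z_def\<close>)
  then obtain \<psi> where \<psi>: "blue_emb A R \<psi> (U \<union> Z)" "\<forall>u\<in>U. \<psi> u = \<phi>' u" "\<forall>u\<in>Z. \<psi> u \<in> X"
    by blast
  moreover have "U \<union> Z = P"
    using UP by (auto simp: Z_def)
  moreover have "\<psi> u \<in> V" if u: "u \<in> U \<union> Z" for u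
  proof -
    consider "u \<in> L" | "u \<in> W\<^sub>2" | "u \<in> Z"
      using u unfolding U_def by blast
    then show ?thesis
      using \<psi>(2,3) \<phi>'L[of u] \<phi>'W[of u] gY(3)[of u] X(1) by cases (auto simp: U_def)
  qed
  ultimately show False
    using no_emb[of \<psi>] by auto
qed

end

lemma few_blue_to_outside:
  fixes \<delta> :: real and p q :: nat
  assumes "0 < \<delta>" "\<delta> \<le> 1" "2 \<le> p"
  shows "\<exists>\<xi>>0. \<exists>\<kappa>>0. \<forall>(P :: 'a set) A (V :: 'b set) R X. ramsey_instance P A q V R p \<kappa> \<longrightarrow>
    X \<subseteq> V \<longrightarrow> (1 - \<xi>) * rcard P \<le> rcard X \<longrightarrow>
    (\<forall>y\<in>X. rdeg R y X \<le> \<xi> * rcard P) \<longrightarrow>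
    (\<Sum>y\<in>V - X. rdeg (non R) y X) \<le> \<delta> * (rcard P)\<^sup>2"
proof -
  define \<beta> where "\<beta> = \<delta> / (4 * (real p)\<^sup>2)"
  define \<omega> where "\<omega> = \<beta> / (32 * (real q + 1))"
  define \<mu> where "\<mu> = \<beta> ^ (4 * q) / 2"
  define m where "m = min (\<mu> * (\<omega> / 2)) (\<mu> * (\<delta> / (2 * real p)))"
  have pos: "0 < \<beta>" "0 < \<omega>" "0 < \<mu>" "0 < m"
    using assms by (auto simp: \<beta>_def \<omega>_def \<mu>_def m_def)
  define \<xi> where "\<xi> = min (1/2) (min (\<beta> / (4 * (real q + 1))) (m / (2 * (1 + 5 * real q))))"
  have \<xi>0: "0 < \<xi>"
    using pos by (auto simp: \<xi>_def intro!: divide_pos_pos add_pos_nonneg)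
  have \<xi>: "0 < \<xi>" "\<xi> \<le> 1/2" "real q * \<xi> \<le> \<beta> / 4" "(1 + 5 * real q) * \<xi> \<le> m / 2"
  proof -
    have "\<xi> \<le> \<beta> / (4 * (real q + 1))"
      by (simp add: \<xi>_def)
    then have "\<xi> * (real q + 1) \<le> \<beta> / 4"
      by (simp add: field_simps)
    then show "real q * \<xi> \<le> \<beta> / 4"
      using \<xi>0 by (simp add: algebra_simps)
    have "\<xi> \<le> m / (2 * (1 + 5 * real q))"
      by (simp add: \<xi>_def)
    then show "(1 + 5 * real q) * \<xi> \<le> m / 2"
      by (simp add: field_simps)
    show "\<xi> \<le> 1/2"
      unfolding \<xi>_def by (rule min.cobounded1)
  qed (rule \<xi>0)
  define \<kappa> where "\<kappa> = min (\<omega> / 2) (m / 4)"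
  have \<kappa>: "0 < \<kappa>" "\<kappa> \<le> \<omega> / 2" "\<kappa> \<le> m / 4"
    using pos by (auto simp: \<kappa>_def)
  have "(\<Sum>y\<in>V - X. rdeg (non R) y X) \<le> \<delta> * (rcard P)\<^sup>2"
    if "ramsey_instance P A q V R p \<kappa>" and X: "X \<subseteq> V" "(1 - \<xi>) * rcard P \<le> rcard X"
      "\<forall>y\<in>X. rdeg R y X \<le> \<xi> * rcard P"
    for P :: "'a set" and A and V :: "'b set" and R X
  proof -
    interpret ramsey_instance P A q V R p \<kappa>
      by (fact that(1))
    show ?thesis
      using assms(1,2) \<xi> \<kappa>(2,3) X
      unfolding m_def \<mu>_def \<omega>_def \<beta>_def by (intro few_blue_to_outside_aux) auto
  qed
  then show ?thesis
    using \<xi>0 \<kappa>(1) by blast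
qed

section \<open>Spanning copies\<close>

context degenerate_graph
begin

text \<open>If the blue clique \<open>K\<close> is too small, exactly \<open>card P - card K\<close>
  independent low-degree vertices \<open>W\<close> are sent to \<open>E \<union> T\<close>, and the
  others fill \<open>K\<close>. Every place in \<open>E\<close> is safe. For \<open>T\<close> the
  neighbours of \<open>W\<close> are put on vertices of \<open>K\<close> with few red neighbours in
  \<open>T\<close>, which leaves each \<open>w\<close> at least nine tenths of
  \<open>T\<close>.\<close>

lemma embed_in_core:
  fixes K E T :: "'b set" and R
  defines "\<theta> \<equiv> 1 / (40 * (real q + 1))"
  assumes symR: "\<And>x y. R x y \<Longrightarrow> R y x"
    and fin_host: "finite K" "finite E" "finite T"
    and disj: "K \<inter> E = {}" "K \<inter> T = {}" "E \<inter> T = {}"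
    and K: "\<And>x y. x \<in> K \<Longrightarrow> y \<in> K \<Longrightarrow> \<not> R x y"
    and E: "\<And>x y. x \<in> K \<Longrightarrow> y \<in> E \<Longrightarrow> \<not> R y x"
    and T: "\<And>y. y \<in> T \<Longrightarrow> rdeg R y K \<le> \<theta> / 8 * rcard P"
    and cK: "(1 - 1 / (8 * (real q + 1))) * rcard P \<le> rcard K"
    and cT: "2 * (card P - (card K + card E)) \<le> card T + 1"
  shows "\<exists>\<phi>. \<phi> ` P \<subseteq> K \<union> E \<union> T \<and> blue_emb A R \<phi> P"
proof (cases "card P \<le> card K")
  case True
  then obtain \<phi> where "\<phi> ` P \<subseteq> K" "inj_on \<phi> P"
    using card_le_inj[OF fin fin_host(1)] by blast
  then show ?thesis
    using K by (intro exI[of _ \<phi>]) (auto simp: blue_emb_def image_subset_iff)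
next
  case False
  define n where "n = rcard P"
  define k where "k = card P - card K"
  have k: "card P = card K + k" "0 < k"
    using False by (auto simp: k_def)
  have n0: "0 < n"
    using k by (simp add: n_def)
  have \<theta>: "0 < \<theta>" "40 * (real q * \<theta>) \<le> 1"
    by (auto simp: \<theta>_def field_simps)
  have kn: "8 * (real q + 1) * real k \<le> n"
  proof -
    have "(1 - 1 / (8 * (real q + 1))) * n = n - n / (8 * (real q + 1))"
      by (simp add: algebra_simps)
    then have "real k \<le> n / (8 * (real q + 1))"
      using cK k by (simp add: n_def)
    then show ?thesis
      by (simp add: field_simps)
  qed
  obtain I where I: "I \<subseteq> P" "card P \<le> 2 * (q + 1) * card I" "\<And>u v. u \<in> I \<Longrightarrow> v \<in> I \<Longrightarrow> \<not> A u v"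
    "\<And>v. v \<in> I \<Longrightarrow> card (nbrs A v P) \<le> 4 * q"
    using independent_low_degree_set by blast
  have "k \<le> card I"
  proof -
    have "real (2 * (q + 1) * k) \<le> real (8 * (q + 1) * k)"
      by (intro of_nat_mono mult_right_mono) simp_all
    also have "\<dots> \<le> rcard P"
      using kn by (simp add: n_def algebra_simps)
    also have "\<dots> \<le> real (2 * (q + 1) * card I)"
      using I(2) by (rule of_nat_mono)
    finally have "(2 * (q + 1)) * k \<le> (2 * (q + 1)) * card I"
      by (simp only: of_nat_le_iff)
    then show ?thesis
      by (rule mult_left_le_imp_le) simp
  qed
  then obtain W where W: "W \<subseteq> I" "card W = k" "finite W"
    by (meson obtain_subset_with_card_n)
  have WP: "W \<subseteq> P"
    using W(1) I(1) by blast
  define S where "S = (\<Union>w\<in>W. nbrs A w P)"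
  have noA: "\<not> A w x" if "w \<in> W" "x \<in> W" for w x
    using that I(3) W(1) by blast
  then have SP: "S \<subseteq> P - W"
    by (auto simp: S_def)
  have fS: "finite S"
    using SP fin finite_subset by blast
  have cS: "rcard S \<le> n / 2"
  proof -
    have "rcard S \<le> rcard W * real (4 * q)"
      unfolding S_def using W I(4) by (intro card_UN_bound of_nat_mono) auto
    also have "\<dots> = real (k * (4 * q))"
      by (simp add: W(2))
    also have "\<dots> \<le> n / 2"
      using kn by (simp add: algebra_simps)
    finally show ?thesis .
  qed
  \<comment> \<open>The factor 8 in the hypothesis on \<open>T\<close> makes these at most
    \<open>n / 8\<close> vertices. Avoiding them, \<open>4 * q\<close> neighbours exclude at most
    \<open>4 * q * \<theta> \<le> 1 / 10\<close> of \<open>T\<close>.\<close>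
  define Bad where "Bad = {x \<in> K. \<theta> * rcard T < rdeg R x T}"
  have cBad: "rcard Bad \<le> n / 8"
  proof (cases "T = {}")
    case True
    then have "Bad = {}"
      using \<theta> by (auto simp: Bad_def nbrs_def)
    then show ?thesis
      using n0 by simp
  next
    case False
    then have T0: "0 < rcard T"
      using fin_host(3) by (simp add: card_gt_0_iff)
    have "(\<Sum>x\<in>K. rdeg R x T) = (\<Sum>y\<in>T. rdeg R y K)"
      unfolding of_nat_sum[symmetric] using sum_card_nbrs_swap[of K T R R] fin_host symR by metis
    also have "\<dots> \<le> rcard T * (\<theta> / 8 * n)"
      unfolding n_def by (intro sum_bounded_above T)
    finally have "\<theta> * rcard T * rcard Bad \<le> rcard T * (\<theta> / 8 * n)"
      unfolding Bad_def using fin_host(1) by (intro card_heavy_le) auto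
    then have "(\<theta> * rcard T) * rcard Bad \<le> (\<theta> * rcard T) * (n / 8)"
      by (simp add: ac_simps)
    then show ?thesis
      by (rule mult_left_le_imp_le) (use T0 \<theta>(1) in simp)
  qed
  define K' where "K' = K - Bad"
  have "card K' + card Bad = card K"
    unfolding K'_def Bad_def using fin_host(1)
    by (metis (no_types, lifting) card_Diff_subset card_mono finite_subset le_add_diff_inverse2
        mem_Collect_eq subsetI)
  moreover have "n / 8 + real k \<le> n / 4"
  proof -
    have "8 * real k \<le> 8 * (real q + 1) * real k"
      by (simp add: algebra_simps)
    then show ?thesis
      using kn by linarith
  qed
  ultimately have "rcard S \<le> rcard K'"
    using cBad cS k(1) n0 unfolding n_def by linarith
  then obtain f where f: "f ` S \<subseteq> K'" "inj_on f S"
    using card_le_inj[OF fS, of K'] fin_host(1) by (auto simp: K'_def)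
  have "card (P - W - S) \<le> card (K - f ` S)"
  proof -
    have "card (P - W - S) = card P - card W - card S"
      using WP SP W(3) fS by (simp add: card_Diff_subset)
    moreover have "card (K - f ` S) = card K - card S"
      using f fS by (subst card_Diff_subset) (auto simp: K'_def card_image)
    ultimately show ?thesis
      using k W(2) by simp
  qed
  then obtain f' where f': "f' ` (P - W - S) \<subseteq> K - f ` S" "inj_on f' (P - W - S)"
    using card_le_inj[of "P - W - S" "K - f ` S"] fin fin_host(1) by auto
  define \<psi> where "\<psi> u = (if u \<in> S then f u else f' u)" for u
  have \<psi>S: "\<psi> u \<in> K'" if "u \<in> S" for u
    using that f(1) by (auto simp: \<psi>_def)
  have \<psi>K: "\<psi> u \<in> K" if "u \<in> P - W" for u
    using that f(1) f'(1) by (auto simp: \<psi>_def K'_def image_subset_iff)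
  have \<psi>inj: "inj_on \<psi> (P - W)"
  proof -
    have "\<psi> ` S = f ` S" "\<psi> ` (P - W - S) = f' ` (P - W - S)"
      by (auto simp: \<psi>_def image_def)
    then have "\<psi> ` (S - (P - W - S)) \<inter> \<psi> ` (P - W - S - S) = {}"
      using f'(1) by blast
    moreover have "inj_on \<psi> S" "inj_on \<psi> (P - W - S)"
      using f(2) f'(2) by (auto simp: \<psi>_def inj_on_def)
    ultimately have "inj_on \<psi> (S \<union> (P - W - S))"
      by (simp only: inj_on_Un simp_thms)
    then show ?thesis
      by (rule inj_on_subset) blast
  qed
  define Tw where "Tw w = {y \<in> T. \<forall>a\<in>nbrs A w P. \<not> R y (\<psi> a)}" for w
  have "\<exists>g. inj_on g W \<and> (\<forall>w\<in>W. g w \<in> E \<union> Tw w)"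
  proof (rule injective_choice[OF W(3)])
    fix w assume w: "w \<in> W"
    have fTw: "finite (Tw w)"
      using fin_host(3) by (simp add: Tw_def)
    have "T \<subseteq> Tw w \<union> (\<Union>a\<in>nbrs A w P. nbrs R (\<psi> a) T)"
      using symR by (auto simp: Tw_def)
    then have "rcard T \<le> rcard (Tw w) + rcard (\<Union>a\<in>nbrs A w P. nbrs R (\<psi> a) T)"
      using fTw fin_host(3) fin by (intro card_cover) auto
    also have "rcard (\<Union>a\<in>nbrs A w P. nbrs R (\<psi> a) T) \<le> rdeg A w P * (\<theta> * rcard T)"
    proof (rule card_UN_bound)
      fix a assume "a \<in> nbrs A w P"
      then have "\<psi> a \<in> K'"
        using w by (intro \<psi>S) (auto simp: S_def)
      then show "rdeg R (\<psi> a) T \<le> \<theta> * rcard T"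
        by (auto simp: K'_def Bad_def)
    qed (use fin in simp)
    also have "\<dots> \<le> real (4 * q) * (\<theta> * rcard T)"
      using I(4)[of w] w W(1) \<theta>(1) by (intro mult_right_mono of_nat_mono) auto
    also have "\<dots> = (40 * (real q * \<theta>)) * (rcard T / 10)"
      by simp
    also have "\<dots> \<le> 1 * (rcard T / 10)"
      using \<theta>(2) by (intro mult_right_mono) auto
    finally have 1: "9 / 10 * rcard T \<le> rcard (Tw w)"
      by simp
    \<comment> \<open>\<open>x\<close> is what \<open>E\<close> cannot host, and 0 by truncation if
      \<open>E\<close> suffices. From \<open>2 * x \<le> card T + 1\<close> it follows that
      \<open>x\<close> is less than \<open>9 / 10 * card T + 1\<close>, so the extra 1 in
      \<open>cT\<close> is harmless for integers, even when \<open>T\<close> is a single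
      vertex.\<close>
    define x where "x = k - card E"
    have "2 * x \<le> card T + 1"
      using cT by (simp add: x_def k_def)
    then have "real (2 * x) \<le> real (card T + 1)"
      by (rule of_nat_mono)
    then have "2 * real x \<le> rcard T + 1"
      by simp
    then have "real x < rcard (Tw w) + 1"
      using 1 by linarith
    then have "x \<le> card (Tw w)"
      by linarith
    moreover have "card (E \<union> Tw w) = card E + card (Tw w)"
      using fin_host fTw disj(3) by (intro card_Un_disjoint) (auto simp: Tw_def)
    ultimately show "finite (E \<union> Tw w) \<and> card W \<le> card (E \<union> Tw w)"
      using fTw fin_host(2) W(2) by (auto simp: x_def)
  qed
  then obtain g where g: "inj_on g W" "\<And>w. w \<in> W \<Longrightarrow> g w \<in> E \<union> Tw w"
    by blast
  have gK: "g w \<notin> K" "g w \<in> E \<union> T" if "w \<in> W" for w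
    using g(2)[OF that] disj by (auto simp: Tw_def)
  have PW: "P - W \<union> W = P"
    using WP by blast
  have "blue_emb A R (\<lambda>u. if u \<in> W then g u else \<psi> u) (P - W \<union> W)"
  proof (rule blue_emb_union[OF symR])
    show "blue_emb A R \<psi> (P - W)"
      using \<psi>inj K[OF \<psi>K \<psi>K] by (simp add: blue_emb_def)
    show "blue_emb A R g W"
      using g(1) noA by (simp add: blue_emb_def)
    have "g ` W \<inter> K = {}" "\<psi> ` (P - W) \<subseteq> K"
      using gK(1) \<psi>K by auto
    then show "\<psi> ` (P - W) \<inter> g ` W = {}"
      by blast
    show "\<not> R (\<psi> a) (g w)" if "a \<in> P - W" "w \<in> W" "A a w" for a w
    proof -
      have "a \<in> nbrs A w P"
        using that(1) local.sym[OF that(3)] by auto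
      then have "\<not> R (g w) (\<psi> a)"
        using g(2)[OF that(2)] E[OF \<psi>K[OF that(1)]] by (auto simp: Tw_def)
      then show ?thesis
        using symR by blast
    qed
  qed auto
  moreover have "(if u \<in> W then g u else \<psi> u) \<in> K \<union> E \<union> T" if "u \<in> P" for u
    using \<psi>K[of u] gK(2)[of u] that by auto
  ultimately show ?thesis
    unfolding PW by (intro exI[of _ "\<lambda>u. if u \<in> W then g u else \<psi> u"] conjI image_subsetI)
qed

end

section \<open>Attaching vertices to the parts, and the final count\<close>

context ramsey_instance
begin

text \<open>A vertex of the core \<open>K i\<close> is red to all but \<open>\<delta> * n\<close>
  vertices outside \<open>D i\<close>, so adding it to the clique costs at most that many common
  neighbours in any other part. The invariant reserves this loss for each part of \<open>J\<close>
  and keeps \<open>\<kappa> * n\<close> for the pages of the final book.\<close>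

lemma no_red_clique_across:
  fixes D K :: "nat \<Rightarrow> 'b set" and \<delta> :: real
  assumes D: "\<And>i. i < p \<Longrightarrow> D i \<subseteq> V" "\<And>i j. i < p \<Longrightarrow> j < p \<Longrightarrow> i \<noteq> j \<Longrightarrow> D i \<inter> D j = {}"
    and K: "\<And>i x. i < p \<Longrightarrow> x \<in> K i \<Longrightarrow> rdeg (non R) x (V - D i) \<le> \<delta> * n"
      "\<And>i. i < p \<Longrightarrow> rcard (D i - K i) \<le> \<delta> * n"
    and \<delta>: "0 \<le> \<delta>"
    and J: "finite J" "J \<noteq> {}" "J \<subseteq> {..<p}" "X \<subseteq> V" "red_clique R X" "card X + card J = p + 1"
      "\<forall>i\<in>J. (rcard J * \<delta> + \<kappa>) * n < rcard (common_nbrs V R X \<inter> D i)"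
  shows False
  using J
proof (induction J arbitrary: X rule: finite_induct)
  case (insert i J)
  have i: "i < p"
    using insert.prems by simp
  have fX: "finite X"
    using insert.prems(3) by (rule finite_sub)
  have cJ: "rcard (insert i J) = rcard J + 1"
    using insert.hyps by simp
  have \<kappa>n: "0 \<le> \<kappa> * n" "0 \<le> \<delta> * n"
    using large \<delta> by auto
  have big: "rcard J * (\<delta> * n) + \<delta> * n + \<kappa> * n < rcard (common_nbrs V R X \<inter> D j)"
    if "j \<in> insert i J" for j
    using insert.prems(6)[rule_format, OF that] unfolding cJ by (simp add: algebra_simps)
  have Jn: "0 \<le> rcard J * (\<delta> * n)"
    using \<kappa>n by simp
  show False
  proof (cases "J = {}")
    case True
    then have "card X = p"
      using insert.prems(5) by simp
    moreover have "card (common_nbrs V R X \<inter> D i) \<le> card (common_nbrs V R X)"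
      using finite_sub[OF common_nbrs_subset] by (intro card_mono) auto
    ultimately show False
      using book_free[OF insert.prems(3,4)] big[of i] \<kappa>n Jn by simp
  next
    case False
    have "\<not> common_nbrs V R X \<inter> D i \<subseteq> D i - K i"
    proof
      assume "common_nbrs V R X \<inter> D i \<subseteq> D i - K i"
      then have "card (common_nbrs V R X \<inter> D i) \<le> card (D i - K i)"
        using finite_sub[OF D(1)[OF i]] by (intro card_mono) auto
      then show False
        using big[of i] K(2)[OF i] \<kappa>n Jn by simp
    qed
    then obtain x where x: "x \<in> common_nbrs V R X" "x \<in> K i"
      by blast
    have xX: "red_clique R (insert x X)" "x \<notin> X"
      using H.red_clique_insert[of X x] insert.prems(4) x(1) by auto
    have xV: "x \<in> V"
      using x(1) common_nbrs_subset[of V R X] by auto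
    show False
    proof (rule insert.IH[of "insert x X"])
      show "J \<noteq> {}" "J \<subseteq> {..<p}" "insert x X \<subseteq> V" "red_clique R (insert x X)"
        using False insert.prems xV xX by auto
      show "card (insert x X) + card J = p + 1"
        using insert.prems(5) insert.hyps fX xX(2) by simp
      show "\<forall>j\<in>J. (rcard J * \<delta> + \<kappa>) * n < rcard (common_nbrs V R (insert x X) \<inter> D j)"
      proof
        fix j assume j: "j \<in> J"
        then have jp: "j < p" "j \<noteq> i"
          using insert.prems(2) insert.hyps by auto
        have fD: "finite (D j)"
          using D(1)[OF jp(1)] by (rule finite_sub)
        have "common_nbrs V R X \<inter> D j \<subseteq> (common_nbrs V R (insert x X) \<inter> D j) \<union> nbrs (non R) x (V - D i)"
          using D(1)[OF jp(1)] D(2)[OF i jp(1)] jp(2) by (auto simp: common_nbrs_def)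
        then have "rcard (common_nbrs V R X \<inter> D j)
            \<le> rcard (common_nbrs V R (insert x X) \<inter> D j) + rdeg (non R) x (V - D i)"
          using fD H.fin by (intro card_cover) auto
        then have "rcard (common_nbrs V R X \<inter> D j) \<le> rcard (common_nbrs V R (insert x X) \<inter> D j) + \<delta> * n"
          using K(1)[OF i x(2)] by linarith
        then show "(rcard J * \<delta> + \<kappa>) * n < rcard (common_nbrs V R (insert x X) \<inter> D j)"
          using big[of j] j by (simp add: algebra_simps)
      qed
    qed
  qed
qed simp

text \<open>Vertices attached to several parts are counted at least twice, which makes up for
  \<open>|V| = p (|P| - 1) + 1\<close> being smaller than \<open>p |P|\<close>.\<close>

lemma exists_large_class:
  fixes J :: "'b \<Rightarrow> nat set"
  assumes J: "\<And>v. v \<in> V \<Longrightarrow> J v \<subseteq> {..<p} \<and> J v \<noteq> {}"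
  shows "\<exists>i<p. 2 * (card P - card {v \<in> V. J v = {i}}) \<le> card {v \<in> V. i \<in> J v \<and> J v \<noteq> {i}} + 1"
proof (rule ccontr)
  assume *: "\<not> ?thesis"
  define Vc where "Vc i = {v \<in> V. J v = {i}}" for i
  define Tc where "Tc i = {v \<in> V. i \<in> J v \<and> J v \<noteq> {i}}" for i
  define T where "T = {v \<in> V. \<forall>i. J v \<noteq> {i}}"
  have fT: "finite T"
    using H.fin by (simp add: T_def)
  have fJ: "finite (J v)" if "v \<in> V" for v
    using J[OF that] finite_subset by blast
  have "V \<subseteq> (\<Union>i<p. Vc i) \<union> T"
  proof
    fix v assume v: "v \<in> V"
    show "v \<in> (\<Union>i<p. Vc i) \<union> T"
    proof (cases "\<exists>i. J v = {i}")
      case True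
      then show ?thesis
        using J[OF v] v by (auto simp: Vc_def)
    qed (use v in \<open>auto simp: T_def\<close>)
  qed
  then have "card V \<le> card ((\<Union>i<p. Vc i) \<union> T)"
    using H.fin fT by (intro card_mono) (auto simp: Vc_def)
  also have "\<dots> \<le> card (\<Union>i<p. Vc i) + card T"
    by (rule card_Un_le)
  also have "card (\<Union>i<p. Vc i) \<le> (\<Sum>i<p. card (Vc i))"
    by (rule card_UN_le) simp
  finally have 1: "card V \<le> (\<Sum>i<p. card (Vc i)) + card T"
    by simp
  have "card T * 2 \<le> (\<Sum>v\<in>T. card (nbrs (\<lambda>v i. i \<in> J v) v {..<p}))"
  proof (rule sum_bounded_below[where 'a = nat, simplified])
    fix v assume v: "v \<in> T"
    then have vV: "v \<in> V"
      by (simp add: T_def)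
    have "nbrs (\<lambda>v i. i \<in> J v) v {..<p} = J v"
      using J[OF vV] by auto
    moreover have "card (J v) \<noteq> 0" "card (J v) \<noteq> 1"
      using J[OF vV] fJ[OF vV] v by (auto simp: T_def card_1_singleton_iff)
    ultimately show "2 \<le> card (nbrs (\<lambda>v i. i \<in> J v) v {..<p})"
      by simp
  qed
  also have "\<dots> = (\<Sum>i<p. card (nbrs (\<lambda>i v. i \<in> J v) i T))"
    using fT by (intro sum_card_nbrs_swap) auto
  also have "\<dots> \<le> (\<Sum>i<p. card (Tc i))"
    using H.fin by (intro sum_mono card_mono) (auto simp: T_def Tc_def)
  finally have 2: "card T * 2 \<le> (\<Sum>i<p. card (Tc i))" .
  have "(\<Sum>i<p. card (Tc i) + 2 + 2 * card (Vc i)) \<le> (\<Sum>i<p. 2 * card P)"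
  proof (rule sum_mono)
    fix i assume "i \<in> {..<p}"
    then have "\<not> 2 * (card P - card (Vc i)) \<le> card (Tc i) + 1"
      using * by (auto simp: Vc_def Tc_def)
    then show "card (Tc i) + 2 + 2 * card (Vc i) \<le> 2 * card P"
      by linarith
  qed
  then have "(\<Sum>i<p. card (Tc i)) + 2 * p + 2 * (\<Sum>i<p. card (Vc i)) \<le> p * (2 * card P)"
    by (simp only: sum.distrib sum_distrib_left[symmetric] sum_constant card_lessThan) simp
  \<comment> \<open>The negated claim, summed over \<open>i\<close>, bounds twice the single
    attachments plus the multiple ones by \<open>2 * p * card P - 2 * p\<close>. This equals
    \<open>2 * card V - 2\<close>, which is too small by 2.\<close>
  moreover have "p * (2 * card P) + 2 = 2 * card V + 2 * p"
  proof -
    have "1 \<le> card P"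
      using n_pos by (simp add: Suc_le_eq card_gt_0_iff)
    then show ?thesis
      by (simp add: card_V algebra_simps diff_mult_distrib2)
  qed
  ultimately show False
    using 1 2 by linarith
qed

end

text \<open>The constants are chosen backwards, from the spanning embedding at the end to the parts
  at the beginning, because each tolerance must be small for the steps that use it later.\<close>

lemma no_ramsey_instance:
  fixes p q :: nat
  assumes "2 \<le> p"
  shows "\<exists>\<kappa>>0. \<forall>(P :: 'a set) A (V :: 'b set) R. \<not> ramsey_instance P A q V R p \<kappa>"
proof -
  \<comment> \<open>This is the bound \<open>\<theta> / 8\<close> demanded by
    \<open>embed_in_core\<close> for vertices attached to several parts.\<close>
  define \<eta> :: real where "\<eta> = 1 / (40 * (real q + 1)) / 8"
  have p: "2 \<le> real p"
    using assms by simp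
  have \<eta>: "0 < \<eta>" "\<eta> \<le> 1 / 8" "\<eta> \<le> 1 / (8 * (real q + 1)) / 8"
    by (auto simp: \<eta>_def field_simps)
  \<comment> \<open>Extending a red clique through at most \<open>p\<close> parts then loses at most
    \<open>\<eta> / 8 * n\<close> common neighbours.\<close>
  define \<delta> where "\<delta> = \<eta> / (8 * real p)"
  have \<delta>: "0 < \<delta>" "\<delta> \<le> \<eta> / 8" "real p * \<delta> = \<eta> / 8" "\<delta> \<le> 1"
    using \<eta> p by (auto simp: \<delta>_def field_simps)
  \<comment> \<open>The square serves Markov's inequality:
    \<open>\<delta>\<^sup>2 * n\<^sup>2\<close> blue pairs leave at most \<open>\<delta> * n\<close>
    vertices with more than \<open>\<delta> * n\<close> blue neighbours outside the part.\<close>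
  have "0 < \<delta>\<^sup>2" "\<delta>\<^sup>2 \<le> 1"
    using \<delta> by (auto intro: power_le_one)
  then obtain \<xi>\<^sub>3 \<kappa>\<^sub>3 where 3: "0 < \<xi>\<^sub>3" "0 < \<kappa>\<^sub>3" and out: "\<forall>(P :: 'a set) A (V :: 'b set) R X.
    ramsey_instance P A q V R p \<kappa>\<^sub>3 \<longrightarrow> X \<subseteq> V \<longrightarrow> (1 - \<xi>\<^sub>3) * rcard P \<le> rcard X \<longrightarrow>
    (\<forall>y\<in>X. rdeg R y X \<le> \<xi>\<^sub>3 * rcard P) \<longrightarrow>
    (\<Sum>y\<in>V - X. rdeg (non R) y X) \<le> \<delta>\<^sup>2 * (rcard P)\<^sup>2"
    using few_blue_to_outside[of "\<delta>\<^sup>2" p q] assms by (elim meta_impE exE conjE) (assumption | rule that)+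
  have "\<eta> \<le> 1"
    using \<eta> by simp
  obtain \<xi>\<^sub>2 \<kappa>\<^sub>2 where 2: "0 < \<xi>\<^sub>2" "0 < \<kappa>\<^sub>2" and few: "\<forall>(P :: 'a set) A (V :: 'b set) R D.
    ramsey_instance P A q V R p \<kappa>\<^sub>2 \<longrightarrow> blue_parts V R p \<xi>\<^sub>2 (rcard P) D \<longrightarrow>
    (\<forall>v\<in>V. \<exists>i<p. rdeg R v (D i) < \<eta> * rcard P)"
    using few_red_to_some_part[OF \<eta>(1) \<open>\<eta> \<le> 1\<close> assms, of q] by (elim exE conjE) (rule that; assumption)
  define \<xi> where "\<xi> = min \<xi>\<^sub>2 (min \<xi>\<^sub>3 (\<eta> / 8))"
  have \<xi>: "0 < \<xi>" "\<xi> \<le> 1" "\<xi> \<le> \<xi>\<^sub>2" "\<xi> \<le> \<xi>\<^sub>3" "\<xi> \<le> \<eta> / 8"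
    using 2 3 \<eta> by (auto simp: \<xi>_def min_le_iff_disj)
  obtain \<kappa>\<^sub>1 where 1: "0 < \<kappa>\<^sub>1" and ex: "\<forall>(P :: 'a set) A (V :: 'b set) R. ramsey_instance P A q V R p \<kappa>\<^sub>1 \<longrightarrow>
    (\<exists>D. blue_parts V R p \<xi> (rcard P) D)"
    using blue_parts_exist[OF \<xi>(1,2) assms, of q] by (elim exE conjE) (rule that; assumption)
  define \<kappa> where "\<kappa> = min (min \<kappa>\<^sub>1 \<kappa>\<^sub>2) (min \<kappa>\<^sub>3 (\<eta> / 8))"
  have \<kappa>: "0 < \<kappa>" "\<kappa> \<le> \<kappa>\<^sub>1" "\<kappa> \<le> \<kappa>\<^sub>2" "\<kappa> \<le> \<kappa>\<^sub>3" "\<kappa> \<le> \<eta> / 8"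
    using 1 2 3 \<eta> by (auto simp: \<kappa>_def)
  have False if inst: "ramsey_instance P A q V R p \<kappa>" for P :: "'a set" and A and V :: "'b set" and R
  proof -
    interpret ramsey_instance P A q V R p \<kappa>
      by (fact inst)
    obtain D where parts: "blue_parts V R p \<xi> n D"
      using ex mono[OF \<kappa>(2)] by blast
    have D: "\<And>i. i < p \<Longrightarrow> D i \<subseteq> V" "\<And>i. i < p \<Longrightarrow> (1 - \<xi>) * n \<le> rcard (D i)"
      "\<And>i y. i < p \<Longrightarrow> y \<in> D i \<Longrightarrow> rdeg R y (D i) \<le> \<xi> * n"
      "\<And>i j. i < p \<Longrightarrow> j < p \<Longrightarrow> i \<noteq> j \<Longrightarrow> D i \<inter> D j = {}"
      using parts by (auto simp: blue_parts_def)
    have fD: "finite (D i)" if "i < p" for i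
      using D(1)[OF that] by (rule finite_sub)
    have D': "n - \<eta> / 8 * n \<le> rcard (D i)" if "i < p" for i
    proof -
      have "\<xi> * n \<le> \<eta> / 8 * n"
        using \<xi>(5) n_pos by (intro mult_right_mono) auto
      moreover have "n - \<xi> * n \<le> rcard (D i)"
        using D(2)[OF that] by (simp add: algebra_simps)
      ultimately show ?thesis
        by linarith
    qed
    define K where "K i = {x \<in> D i. rdeg (non R) x (V - D i) \<le> \<delta> * n}" for i
    have KD: "K i \<subseteq> D i" for i
      by (auto simp: K_def)
    have cDK: "rcard (D i - K i) \<le> \<delta> * n" if i: "i < p" for i
    proof -
      have parts3: "blue_parts V R p \<xi>\<^sub>3 n D"
        by (rule blue_parts_mono[OF parts \<xi>(4)]) simp
      have "(\<Sum>y\<in>V - D i. rdeg (non R) y (D i)) \<le> \<delta>\<^sup>2 * n\<^sup>2"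
        using out[THEN spec[of _ P], THEN spec[of _ A], THEN spec[of _ V], THEN spec[of _ R],
            THEN spec[of _ "D i"]]
          mono[OF \<kappa>(4)] parts3 i unfolding blue_parts_def by blast
      moreover have "(\<Sum>x\<in>D i. rdeg (non R) x (V - D i))
          = (\<Sum>y\<in>V - D i. rdeg (non R) y (D i))"
        unfolding of_nat_sum[symmetric] of_nat_eq_iff using fD[OF i] H.fin H.sym
        by (intro sum_card_nbrs_swap) auto
      ultimately have "\<delta> * n * rcard {x \<in> D i. \<delta> * n < rdeg (non R) x (V - D i)}
          \<le> \<delta>\<^sup>2 * n\<^sup>2"
        using fD[OF i] by (intro card_heavy_le) auto
      moreover have "{x \<in> D i. \<delta> * n < rdeg (non R) x (V - D i)} = D i - K i"
        by (auto simp: K_def)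
      ultimately have "(\<delta> * n) * rcard (D i - K i) \<le> (\<delta> * n) * (\<delta> * n)"
        by (simp add: power2_eq_square ac_simps)
      then show ?thesis
        by (rule mult_left_le_imp_le) (use \<delta>(1) n_pos in simp)
    qed
    have \<delta>n: "\<delta> * n \<le> \<eta> / 8 * n" "0 < \<eta> * n" "\<eta> * n \<le> n / 8"
      using \<delta>(2) \<eta>(1,2) n_pos mult_right_mono[of \<eta> "1/8" n] by (auto intro: mult_right_mono)
    \<comment> \<open>A red edge from \<open>v\<close> to \<open>x\<close> in the core would be a
      clique with more than \<open>(\<eta> - \<delta>) * n - 1\<close> common neighbours in each
      other part, enough for \<open>no_red_clique_across\<close>. For \<open>v\<close> in the core
      this makes the core a blue clique.\<close>
    have blue: "\<not> R v x" if i: "i < p" and v: "v \<in> V" and x: "x \<in> K i"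
      and many: "\<And>j. j < p \<Longrightarrow> j \<noteq> i \<Longrightarrow> \<eta> * n \<le> rdeg R v (D j)" for i v x
    proof
      assume red: "R v x"
      have xV: "x \<in> V" "x \<noteq> v"
        using x KD D(1)[OF i] red H.irrefl by auto
      have cJ: "card ({..<p} - {i}) = p - 1"
        using i by simp
      show False
      proof (rule no_red_clique_across[where D = D and K = K and \<delta> = \<delta> and J = "{..<p} - {i}" and X = "{v, x}"])
        show "{..<p} - {i} \<noteq> {}"
        proof
          assume "{..<p} - {i} = {}"
          then have "p - 1 = 0"
            using cJ by (simp only: card.empty)
          then show False
            using assms by simp
        qed
        show "card {v, x} + card ({..<p} - {i}) = p + 1"
          using cJ xV assms by simp
        show "red_clique R {v, x}"
          using red H.sym by (auto simp: red_clique_def)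
        show "\<forall>j\<in>{..<p} - {i}. (rcard ({..<p} - {i}) * \<delta> + \<kappa>) * n < rcard (common_nbrs V R {v, x} \<inter> D j)"
        proof
          fix j assume j: "j \<in> {..<p} - {i}"
          have "nbrs R v (D j) \<subseteq> (common_nbrs V R {v, x} \<inter> D j) \<union> nbrs (non R) x (V - D i)"
            using D(1)[of j] D(4)[of i j] i j by (auto simp: common_nbrs_def)
          then have "rdeg R v (D j)
              \<le> rcard (common_nbrs V R {v, x} \<inter> D j) + rdeg (non R) x (V - D i)"
            using fD j H.fin by (intro card_cover) auto
          then have "\<eta> * n \<le> rcard (common_nbrs V R {v, x} \<inter> D j) + \<delta> * n"
            using many[of j] j x by (auto simp: K_def)
          moreover have "(rcard ({..<p} - {i}) * \<delta> + \<kappa>) * n \<le> (\<eta> / 8 + \<eta> / 8) * n"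
          proof (intro mult_right_mono add_mono)
            have "rcard ({..<p} - {i}) * \<delta> \<le> real p * \<delta>"
              unfolding cJ using \<delta>(1) by (intro mult_right_mono) auto
            then show "rcard ({..<p} - {i}) * \<delta> \<le> \<eta> / 8"
              using \<delta>(3) by simp
          qed (use \<kappa>(5) in auto)
          moreover have "(\<eta> / 8 + \<eta> / 8) * n = \<eta> * n / 4"
            by (simp add: field_simps)
          ultimately show "(rcard ({..<p} - {i}) * \<delta> + \<kappa>) * n < rcard (common_nbrs V R {v, x} \<inter> D j)"
            using \<delta>n by linarith
        qed
      qed (use D(1,4) cDK \<delta>(1) v xV in \<open>auto simp: K_def\<close>)
    qed
    define J where "J v = {i. i < p \<and> rdeg R v (D i) < \<eta> * n}" for v
    have Jne: "J v \<noteq> {}" if "v \<in> V" for v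
      using few mono[OF \<kappa>(3)] blue_parts_mono[OF parts \<xi>(3)] that unfolding J_def by fastforce
    have Jsub: "J v \<subseteq> {..<p}" for v
      by (auto simp: J_def)
    have many: "\<eta> * n \<le> rdeg R v (D j)" if "J v = {i}" "j < p" "j \<noteq> i" for v i j
      using that by (force simp: J_def not_less)
    \<comment> \<open>A core vertex is red to almost all of every other part, hence attached to none
      of these; as it is attached somewhere, only \<open>i\<close> remains.\<close>
    have KJ: "J x = {i}" if i: "i < p" and x: "x \<in> K i" for i x
    proof -
      have "j \<notin> J x" if j: "j < p" "j \<noteq> i" for j
      proof -
        have "D j \<subseteq> nbrs R x (D j) \<union> nbrs (non R) x (V - D i)"
          using D(1)[of j] D(4)[of i j] i j by auto
        then have "rcard (D j) \<le> rdeg R x (D j) + rdeg (non R) x (V - D i)"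
          using fD[OF j(1)] H.fin by (intro card_cover) auto
        then have "rcard (D j) \<le> rdeg R x (D j) + \<delta> * n"
          using x by (auto simp: K_def)
        then have "\<not> rdeg R x (D j) < \<eta> * n"
          using D'[OF j(1)] \<delta>n n_pos by linarith
        then show ?thesis
          by (simp add: J_def)
      qed
      moreover have "x \<in> V"
        using x KD D(1)[OF i] by auto
      ultimately show ?thesis
        using Jne[of x] Jsub[of x] by blast
    qed
    obtain i where i: "i < p"
      and cls: "2 * (card P - card {v \<in> V. J v = {i}}) \<le> card {v \<in> V. i \<in> J v \<and> J v \<noteq> {i}} + 1"
      using exists_large_class[of J] Jne Jsub by blast
    define E where "E = {v \<in> V. J v = {i}} - K i"
    define T where "T = {v \<in> V. i \<in> J v \<and> J v \<noteq> {i}}"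
    have KV: "K i \<subseteq> {v \<in> V. J v = {i}}"
      using KJ[OF i] KD[of i] D(1)[OF i] by blast
    have fK: "finite (K i)"
      using fD[OF i] KD finite_subset by blast
    have "\<exists>\<phi>. \<phi> ` P \<subseteq> K i \<union> E \<union> T \<and> blue_emb A R \<phi> P"
    proof (rule G.embed_in_core)
      show "finite (K i)" "finite E" "finite T"
        using fK H.fin by (auto simp: E_def T_def)
      show "K i \<inter> E = {}" "K i \<inter> T = {}" "E \<inter> T = {}"
        using KV by (auto simp: E_def T_def)
      show "\<not> R x y" if "x \<in> K i" "y \<in> K i" for x y
        using blue[OF i _ that(2), of x] many KJ[OF i that(1)] that KV by auto
      show "\<not> R y x" if "x \<in> K i" "y \<in> E" for x y
        using blue[OF i _ that(1), of y] many[of y i] that(2) by (auto simp: E_def)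
      show "rdeg R y (K i) \<le> 1 / (40 * (real q + 1)) / 8 * n" if "y \<in> T" for y
      proof -
        have "card (nbrs R y (K i)) \<le> card (nbrs R y (D i))"
          using fD[OF i] KD by (rule card_nbrs_mono)
        then show ?thesis
          using that unfolding \<eta>_def[symmetric] by (auto simp: T_def J_def)
      qed
      show "(1 - 1 / (8 * (real q + 1))) * n \<le> rcard (K i)"
      proof -
        have "card (D i - K i) + card (K i) = card (D i)"
          using KD fK fD[OF i] by (metis card_Diff_subset card_mono le_add_diff_inverse2)
        then have "n - \<eta> / 8 * n - \<delta> * n \<le> rcard (K i)"
          using D'[OF i] cDK[OF i] by linarith
        moreover define z where "z = 1 / (8 * (real q + 1))"
        have "\<eta> * n \<le> z / 8 * n"
          unfolding z_def using \<eta>(3) n_pos by (intro mult_right_mono) auto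
        moreover have "(1 - z) * n = n - z * n"
          by (simp add: algebra_simps)
        ultimately show ?thesis
          using \<delta>n unfolding z_def[symmetric] by linarith
      qed
      have "card (K i) + card E = card {v \<in> V. J v = {i}}"
        unfolding E_def using KV H.fin fK by (simp add: card_Diff_subset card_mono)
      then show "2 * (card P - (card (K i) + card E)) \<le> card T + 1"
        using cls by (simp add: T_def)
    qed (use H.sym in auto)
    moreover have "K i \<union> E \<union> T \<subseteq> V"
      using KD D(1)[OF i] by (auto simp: E_def T_def)
    ultimately show False
      using no_emb by (meson subset_trans)
  qed
  then show ?thesis
    using \<kappa>(1) by blast
qed

section \<open>Ramsey numbers\<close>

abbreviation arc_rel :: "'a pair_pre_digraph \<Rightarrow> 'a \<Rightarrow> 'a \<Rightarrow> bool" where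
  "arc_rel G u v \<equiv> (u, v) \<in> parcs G"

section \<open>Translation between pair digraphs and relations\<close>

lemma arc_in_verts:
  assumes "pair_graph G" "arc_rel G u v"
  shows "u \<in> pverts G" "v \<in> pverts G"
proof -
  interpret pair_graph G
    by (fact assms)
  show "u \<in> pverts G" "v \<in> pverts G"
    using wellformed'[OF assms(2)] by auto
qed

lemma sgraph_pair_graph:
  assumes "pair_graph G"
  shows "sgraph (pverts G) (arc_rel G)"
proof -
  interpret pair_graph G
    by (fact assms)
  show ?thesis
  proof
    show "finite (pverts G)"
      by (rule pair_finite_verts)
    show "arc_rel G v u" if "arc_rel G u v" for u v
      using that arcs_symmetric by blast
    show "\<not> arc_rel G u u" for u
      using pair_no_loops by fastforce
  qed
qed

lemma pair_graphI:
  assumes "finite V" "\<And>u v. (u, v) \<in> E \<Longrightarrow> u \<in> V \<and> v \<in> V \<and> u \<noteq> v \<and> (v, u) \<in> E"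
  shows "pair_graph \<lparr>pverts = V, parcs = E\<rparr>"
proof -
  have "E \<subseteq> V \<times> V"
    using assms(2) by auto
  then have "finite E"
    using assms(1) finite_subset by blast
  then show ?thesis
    using assms by unfold_locales (force simp: symmetric_def intro: symI)+
qed

text \<open>Copies need not be induced, so preservation of arcs is enough: the copy is the image of
  \<open>H\<close>, with arcs moved by \<open>map_prod \<phi> \<phi>\<close>.\<close>

lemma contains_copyI:
  assumes "pair_graph G" "pair_graph H" "inj_on \<phi> (pverts H)" "\<phi> ` pverts H \<subseteq> pverts G"
    and "\<And>u v. arc_rel H u v \<Longrightarrow> arc_rel G (\<phi> u) (\<phi> v)"
  shows "contains_copy G H"
proof -
  interpret G: pair_graph G
    by (fact assms)
  interpret H: pair_graph H
    by (fact assms)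
  define H' where "H' = \<lparr>pverts = \<phi> ` pverts H, parcs = map_prod \<phi> \<phi> ` parcs H\<rparr>"
  define hom where "hom = \<lparr>iso_verts = \<phi>, iso_arcs = map_prod \<phi> \<phi>, iso_head = snd, iso_tail = fst\<rparr>"
  have "parcs H \<subseteq> pverts H \<times> pverts H"
    using H.wellformed' by auto
  then have "inj_on (map_prod \<phi> \<phi>) (parcs H)"
    using map_prod_inj_on[OF assms(3,3)] inj_on_subset by blast
  then have "pre_digraph.digraph_isomorphism (with_proj H) hom"
    using assms(3) H.wf_digraph_axioms by (simp add: H.digraph_isomorphism_def hom_def)
  moreover have "with_proj H' = app_iso hom (with_proj H)"
    by (simp add: H'_def hom_def app_iso_def with_proj_def)
  ultimately have "digraph_iso (with_proj H) (with_proj H')"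
    unfolding digraph_iso_def by blast
  moreover have "wf_digraph (with_proj H')"
    unfolding wf_digraph_wp_iff using H.wellformed'
    by unfold_locales (auto simp: H'_def)
  then have "subgraph (with_proj H') (with_proj G)"
    using assms(4,5) G.wf_digraph_axioms by (auto simp: subgraph_def H'_def)
  ultimately show ?thesis
    unfolding contains_copy_def by blast
qed

lemma contains_copyD:
  assumes "contains_copy G H"
  shows "\<exists>\<phi>. inj_on \<phi> (pverts H) \<and> \<phi> ` pverts H \<subseteq> pverts G
    \<and> (\<forall>u v. arc_rel H u v \<longrightarrow> arc_rel G (\<phi> u) (\<phi> v))"
proof -
  obtain H' hom where sub: "subgraph (with_proj H') (with_proj G)"
    and hom: "pre_digraph.digraph_isomorphism (with_proj H) hom" "with_proj H' = app_iso hom (with_proj H)"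
    using assms by (auto simp: contains_copy_def digraph_iso_def)
  have iso: "inj_on (iso_verts hom) (pverts H)"
    "\<And>e. e \<in> parcs H \<Longrightarrow> iso_verts hom (fst e) = iso_tail hom (iso_arcs hom e)
      \<and> iso_verts hom (snd e) = iso_head hom (iso_arcs hom e)"
    using hom(1) by (auto simp: pre_digraph.digraph_isomorphism_def)
  \<comment> \<open>An isomorphism carries its own tail and head functions. As its image is a pair
    digraph, these are \<open>fst\<close> and \<open>snd\<close>, which forces the arc map to act on
    pairs as the vertex map does.\<close>
  have H': "pverts H' = iso_verts hom ` pverts H" "parcs H' = iso_arcs hom ` parcs H"
    "fst = iso_tail hom" "snd = iso_head hom"
    using arg_cong[OF hom(2), of verts] arg_cong[OF hom(2), of arcs] arg_cong[OF hom(2), of tail]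
      arg_cong[OF hom(2), of head] by (simp_all add: app_iso_def)
  show ?thesis
  proof (intro exI conjI allI impI)
    show "inj_on (iso_verts hom) (pverts H)"
      by (rule iso)
    show "iso_verts hom ` pverts H \<subseteq> pverts G"
      using sub H'(1) by (auto simp: subgraph_def)
    fix u v assume uv: "arc_rel H u v"
    then have "iso_arcs hom (u, v) = (iso_verts hom u, iso_verts hom v)"
      using iso(2)[OF uv] H'(3,4) by (metis fst_conv snd_conv prod.collapse)
    moreover have "iso_arcs hom (u, v) \<in> parcs G"
      using uv sub H'(2) by (auto simp: subgraph_def)
    ultimately show "arc_rel G (iso_verts hom u) (iso_verts hom v)"
      by simp
  qed
qed

lemma pair_graph_induced:
  assumes "pair_graph G" "X \<subseteq> pverts G"
  shows "pair_graph \<lparr>pverts = X, parcs = {(u, v). u \<in> X \<and> v \<in> X \<and> arc_rel G u v}\<rparr>"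
proof -
  interpret sgraph "pverts G" "arc_rel G"
    using assms(1) by (rule sgraph_pair_graph)
  show ?thesis
    using fin assms(2) finite_subset sym irrefl by (intro pair_graphI) auto
qed

lemma degenerate_graph_pair_graph:
  assumes "pair_graph G" "degenerate q G"
  shows "degenerate_graph (pverts G) (arc_rel G) q"
proof -
  interpret G: pair_graph G
    by (fact assms)
  interpret sgraph "pverts G" "arc_rel G"
    using assms(1) by (rule sgraph_pair_graph)
  show ?thesis
  proof
    fix X assume X: "X \<subseteq> pverts G" "X \<noteq> {}"
    define H where "H = \<lparr>pverts = X, parcs = {(u, v). u \<in> X \<and> v \<in> X \<and> arc_rel G u v}\<rparr>"
    have H: "pair_graph H"
      unfolding H_def by (rule pair_graph_induced[OF assms(1) X(1)])
    interpret H: pair_graph H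
      by (fact H)
    have "subgraph (with_proj H) (with_proj G)"
      using X(1) G.wf_digraph_axioms H.wf_digraph_axioms by (auto simp: subgraph_def H_def)
    moreover have "pverts H = X"
      by (simp add: H_def)
    ultimately have "\<exists>v\<in>X. out_degree (with_proj H) v \<le> q"
      using assms(2) H X(2) unfolding degenerate_def by (metis (no_types, lifting))
    then obtain v where v: "v \<in> X" "out_degree (with_proj H) v \<le> q"
      by blast
    have "out_arcs (with_proj H) v = Pair v ` nbrs (arc_rel G) v X"
      using v(1) by (auto simp: out_arcs_def H_def)
    then have "card (nbrs (arc_rel G) v X) = out_degree (with_proj H) v"
      by (simp add: out_degree_def card_image inj_on_def)
    then have "card (nbrs (arc_rel G) v X) \<le> q"
      using v(2) by (simp only:)
    then show "\<exists>v\<in>X. card (nbrs (arc_rel G) v X) \<le> q"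
      using v(1) by blast
  qed
qed

text \<open>A vertex is labelled by the set of vertices reachable from it; this explains the label
  type. In a symmetric digraph these sets carry the strongly connected components and are constant
  along arcs.\<close>

lemma splittable_components:
  assumes "pair_graph G" "splittable \<gamma> \<eta> G"
  shows "\<exists>S\<subseteq>pverts G. \<exists>f :: 'a \<Rightarrow> 'a set. rcard S < rcard (pverts G) powr (1 - \<gamma>)
    \<and> (\<forall>u\<in>pverts G - S. \<forall>v\<in>pverts G - S. arc_rel G u v \<longrightarrow> f u = f v)
    \<and> (\<forall>u\<in>pverts G - S. rcard {v \<in> pverts G - S. f v = f u} \<le> \<eta> * rcard (pverts G))"
proof -
  interpret sgraph "pverts G" "arc_rel G"
    using assms(1) by (rule sgraph_pair_graph)
  obtain S where S: "S \<subseteq> pverts G" "rcard S < rcard (pverts G) powr (1 - \<gamma>)"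
    "\<And>C. C \<in> pre_digraph.sccs (with_proj G \<restriction> (pverts G - S)) \<Longrightarrow>
      rcard (verts C) \<le> \<eta> * rcard (pverts G)"
    using assms(2) by (auto simp: splittable_def)
  define X where "X = pverts G - S"
  define H where "H = \<lparr>pverts = X, parcs = {(u, v). u \<in> X \<and> v \<in> X \<and> arc_rel G u v}\<rparr>"
  have "pair_graph H"
    unfolding H_def X_def by (intro pair_graph_induced[OF assms(1)]) auto
  then interpret H: pair_graph H .
  have GH: "with_proj G \<restriction> X = with_proj H"
    by (auto simp: induce_subgraph_def with_proj_def H_def)
  define f where "f u = {v. u \<rightarrow>\<^sup>*\<^bsub>with_proj H\<^esub> v}" for u
  have "f u = f v" if "u \<in> X" "v \<in> X" "arc_rel G u v" for u v
  proof -
    have arcs: "arc_rel H u v" "arc_rel H v u"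
      using that sym by (auto simp: H_def)
    show ?thesis
      unfolding f_def using H.reachable_trans[OF H.reachable_adjI[OF arcs(1)]]
        H.reachable_trans[OF H.reachable_adjI[OF arcs(2)]] by (intro Collect_cong iffI)
  qed
  moreover have "rcard {v \<in> X. f v = f u} \<le> \<eta> * rcard (pverts G)" if u: "u \<in> X" for u
  proof -
    have "{v \<in> X. f v = f u} \<subseteq> f u"
    proof
      fix v assume v: "v \<in> {v \<in> X. f v = f u}"
      then have "v \<in> pverts H"
        by (simp add: H_def)
      then have "v \<in> f v"
        unfolding f_def mem_Collect_eq by (rule H.reachable_refl)
      then show "v \<in> f u"
        using v by simp
    qed
    moreover have "f u \<subseteq> X"
    proof
      fix v assume "v \<in> f u"
      then have "v \<in> pverts H"
        unfolding f_def mem_Collect_eq by (rule H.reachable_in_verts(2))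
      then show "v \<in> X"
        by (simp add: H_def)
    qed
    then have "finite (f u)"
      using fin finite_subset by (auto simp: X_def)
    ultimately have "card {v \<in> X. f v = f u} \<le> card (f u)"
      by (intro card_mono)
    moreover have "with_proj H \<restriction> f u \<in> pre_digraph.sccs (with_proj G \<restriction> X)"
      unfolding GH f_def using u by (intro H.induce_reachable_is_in_sccs) (simp add: H_def)
    then have "rcard (f u) \<le> \<eta> * rcard (pverts G)"
      using S(3)[of "with_proj H \<restriction> f u"] by (simp add: X_def)
    ultimately show ?thesis
      by linarith
  qed
  ultimately show ?thesis
    using S(1,2) unfolding X_def by blast
qed

text \<open>Connectedness is strong connectedness of the symmetric closure, so a path may run
  against an arc; equality of values is insensitive to the direction.\<close>

lemma connected_constant:
  assumes "Digraph_Component.connected (with_proj G)"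
    and step: "\<And>u v. arc_rel G u v \<Longrightarrow> f u = f v"
    and "u \<in> pverts G" "v \<in> pverts G"
  shows "f u = f v"
proof -
  have "u \<rightarrow>\<^sup>*\<^bsub>with_proj (mk_symmetric (with_proj G))\<^esub> v"
    using assms(1,3,4) by (simp add: connected_def strongly_connected_def mk_symmetric_def)
  then have "(u, v) \<in> rtrancl_on (pverts G) (\<Union>e\<in>parcs G. {(fst e, snd e), (snd e, fst e)})"
    by (simp add: reachable_def mk_symmetric_def)
  then show ?thesis
  proof (induction rule: rtrancl_on_induct)
    case (step y z)
    then have "f y = f z"
      using assms(2) by fastforce
    then show ?case
      using step.IH by simp
  qed simp
qed

section \<open>Books, colourings and the two bounds\<close>

lemma book_simps:
  "pverts (book p m) = {..<p} <+> {..<m}"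
  "arc_rel (book p m) x y \<longleftrightarrow>
    (\<exists>i<p. (\<exists>j<p. i \<noteq> j \<and> x = Inl i \<and> y = Inl j)
      \<or> (\<exists>j<m. x = Inl i \<and> y = Inr j \<or> x = Inr j \<and> y = Inl i))"
  by (auto simp: book_def graph_join_def complete_graph_def edgeless_graph_def image_iff)

lemma pair_graph_book: "pair_graph (book p m)"
proof -
  have "pair_graph \<lparr>pverts = pverts (book p m), parcs = parcs (book p m)\<rparr>"
    by (rule pair_graphI) (force simp: book_simps)+
  then show ?thesis
    by (cases "book p m") simp
qed

lemma two_coloring_blue:
  assumes "two_coloring N R B" "x < N" "y < N" "x \<noteq> y" "\<not> arc_rel R x y"
  shows "arc_rel B x y"
proof -
  have "(x, y) \<in> parcs R \<union> parcs B"
    using assms by (simp add: two_coloring_def complete_graph_def)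
  then show ?thesis
    using assms(5) by blast
qed

text \<open>A colouring with neither copy would be a \<open>ramsey_instance\<close>. Having more
  than \<open>\<kappa> * n\<close> common red neighbours means having at least the ceiling of
  \<open>\<kappa> * n\<close>, so a \<open>p\<close>-clique violating \<open>book_free\<close>
  yields a whole red book.\<close>

lemma ramsey_upper:
  assumes no_inst: "\<And>(P :: 'a set) A (V :: nat set) R. \<not> ramsey_instance P A q V R p \<kappa>"
    and "2 \<le> p" "pair_graph G" "degenerate q G" "splittable \<gamma> \<kappa> G"
    and n: "n = card (pverts (G :: 'a pair_pre_digraph))" "1 \<le> \<kappa> * real n" "real n powr (1 - \<gamma>) \<le> \<kappa> * real n"
    and col: "two_coloring (p * (n - 1) + 1) R B"
  shows "contains_copy R (book p (nat \<lceil>\<kappa> * real n\<rceil>)) \<or> contains_copy B G"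
proof (rule ccontr)
  assume none: "\<not> ?thesis"
  define N where "N = p * (n - 1) + 1"
  have R: "pair_graph R" "pverts R = {..<N}" and B: "pair_graph B" "pverts B = {..<N}"
    using col by (auto simp: two_coloring_def N_def)
  interpret G: degenerate_graph "pverts G" "arc_rel G" q
    using assms by (intro degenerate_graph_pair_graph)
  interpret R: sgraph "{..<N}" "arc_rel R"
    using sgraph_pair_graph[OF R(1)] R(2) by simp
  define m where "m = nat \<lceil>\<kappa> * real n\<rceil>"
  have "ramsey_instance (pverts G) (arc_rel G) q {..<N} (arc_rel R) p \<kappa>"
  proof
    show "2 \<le> p"
      by (fact assms)
    show "card {..<N} = p * (card (pverts G) - 1) + 1"
      by (simp add: N_def n)
    show "1 \<le> \<kappa> * rcard (pverts G)"
      using n by simp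
    show "\<not> blue_emb (arc_rel G) (arc_rel R) \<phi> (pverts G)" if \<phi>: "\<phi> ` pverts G \<subseteq> {..<N}" for \<phi>
    proof
      assume emb: "blue_emb (arc_rel G) (arc_rel R) \<phi> (pverts G)"
      have "contains_copy B G"
      proof (rule contains_copyI[OF B(1) assms(3)])
        show inj: "inj_on \<phi> (pverts G)"
          using emb by (simp add: blue_emb_def)
        show "\<phi> ` pverts G \<subseteq> pverts B"
          using \<phi> B by simp
        fix u v assume uv: "arc_rel G u v"
        then have uvP: "u \<in> pverts G" "v \<in> pverts G" "u \<noteq> v"
          using arc_in_verts[OF assms(3)] G.irrefl by auto
        show "arc_rel B (\<phi> u) (\<phi> v)"
        proof (rule two_coloring_blue[OF col])
          show "\<phi> u < p * (n - 1) + 1" "\<phi> v < p * (n - 1) + 1"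
            using uvP \<phi> by (auto simp: N_def)
          show "\<phi> u \<noteq> \<phi> v"
            using inj uvP by (auto dest: inj_onD)
          show "\<not> arc_rel R (\<phi> u) (\<phi> v)"
            using emb uvP uv by (auto simp: blue_emb_def)
        qed
      qed
      then show False
        using none by blast
    qed
    show "rcard (common_nbrs {..<N} (arc_rel R) X) \<le> \<kappa> * rcard (pverts G)"
      if X: "X \<subseteq> {..<N}" "red_clique (arc_rel R) X" "card X = p" for X
    proof (rule ccontr)
      define C where "C = common_nbrs {..<N} (arc_rel R) X"
      assume "\<not> ?thesis"
      then have "\<kappa> * real n < rcard C"
        by (simp add: C_def n)
      then have "m \<le> card C"
        unfolding m_def by linarith
      then obtain C' where C': "C' \<subseteq> C" "card C' = m" "finite C'"
        by (meson obtain_subset_with_card_n)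
      have "finite X"
        using X(1) finite_subset by blast
      then obtain g where g: "bij_betw g {..<p} X"
        using X(3) ex_bij_betw_nat_finite[of X] by (auto simp: atLeast0LessThan)
      obtain h where h: "bij_betw h {..<m} C'"
        using C' ex_bij_betw_nat_finite[of C'] by (auto simp: atLeast0LessThan)
      have gX: "g i \<in> X" if "i < p" for i
        using g that by (auto simp: bij_betw_def)
      have hC: "h j \<in> C" if "j < m" for j
        using h that C'(1) by (auto simp: bij_betw_def)
      have red: "arc_rel R x y" "x \<noteq> y" if "x \<in> X" "y \<in> C" for x y
        using that R.irrefl by (auto simp: C_def common_nbrs_def)
      define \<phi> where "\<phi> = case_sum g h"
      have "contains_copy R (book p m)"
      proof (rule contains_copyI[OF R(1) pair_graph_book])
        show "\<phi> ` pverts (book p m) \<subseteq> pverts R"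
          using subsetD[OF X(1) gX] hC R(2) by (auto simp: book_simps \<phi>_def C_def common_nbrs_def)
        show "inj_on \<phi> (pverts (book p m))"
        proof (rule inj_onI)
          fix x y assume xy: "x \<in> pverts (book p m)" "y \<in> pverts (book p m)" "\<phi> x = \<phi> y"
          have ginj: "i = j" if "g i = g j" "i < p" "j < p" for i j
            using g that by (auto simp: bij_betw_def dest: inj_onD)
          have hinj: "i = j" if "h i = h j" "i < m" "j < m" for i j
            using h that by (auto simp: bij_betw_def dest: inj_onD)
          have gh: "g i \<noteq> h j" "h j \<noteq> g i" if "i < p" "j < m" for i j
            using red(2)[OF gX[OF that(1)] hC[OF that(2)]] by auto
          show "x = y"
          proof (cases x)
            case x: (Inl i)
            show ?thesis
            proof (cases y)
              case (Inl j)
              then show ?thesis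
                using x xy ginj[of i j] by (auto simp: book_simps \<phi>_def)
            next
              case (Inr j)
              then show ?thesis
                using x xy gh(1)[of i j] by (auto simp: book_simps \<phi>_def)
            qed
          next
            case x: (Inr i)
            show ?thesis
            proof (cases y)
              case (Inl j)
              then show ?thesis
                using x xy gh(2)[of j i] by (auto simp: book_simps \<phi>_def)
            next
              case (Inr j)
              then show ?thesis
                using x xy hinj[of i j] by (auto simp: book_simps \<phi>_def)
            qed
          qed
        qed
        fix x y assume xy: "arc_rel (book p m) x y"
        then consider i j where "i < p" "j < p" "i \<noteq> j" "x = Inl i" "y = Inl j"
          | i j where "i < p" "j < m" "x = Inl i" "y = Inr j"
          | i j where "i < p" "j < m" "x = Inr j" "y = Inl i"
          unfolding book_simps by blast
        then show "arc_rel R (\<phi> x) (\<phi> y)"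
        proof cases
          case 1
          then have "g i \<noteq> g j"
            using g by (auto simp: bij_betw_def dest: inj_onD)
          then show ?thesis
            using 1 gX X(2) by (auto simp: \<phi>_def red_clique_def)
        next
          case 2
          then show ?thesis
            using red(1)[OF gX hC] by (simp add: \<phi>_def)
        next
          case 3
          then show ?thesis
            using R.sym[OF red(1)[OF gX hC]] by (simp add: \<phi>_def)
        qed
      qed
      then show False
        using none by (simp add: m_def)
    qed
    show "\<exists>S\<subseteq>pverts G. \<exists>f :: 'a \<Rightarrow> 'a set. rcard S \<le> \<kappa> * rcard (pverts G)
      \<and> (\<forall>u\<in>pverts G - S. \<forall>v\<in>pverts G - S. arc_rel G u v \<longrightarrow> f u = f v)
      \<and> (\<forall>u\<in>pverts G - S. rcard {v \<in> pverts G - S. f v = f u} \<le> \<kappa> * rcard (pverts G))"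
      using splittable_components[OF assms(3,5)] n(3) unfolding n(1) by (meson less_imp_le order_trans)
  qed
  then show False
    using no_inst by blast
qed

text \<open>The colouring is given by \<open>p\<close> blue cliques of order at most \<open>n - 1\<close>.\<close>

lemma ramsey_lower:
  assumes "pair_graph G" "Digraph_Component.connected (with_proj G)" "n = card (pverts G)" "2 \<le> n" "0 < m"
    and N: "N \<le> p * (n - 1)"
  shows "\<exists>R B. two_coloring N R B \<and> \<not> contains_copy R (book p m) \<and> \<not> contains_copy B G"
proof -
  \<comment> \<open>Vertices below \<open>p * (n - 1)\<close> fall into \<open>p\<close> intervals
    of length \<open>n - 1\<close>, which is positive by \<open>2 \<le> n\<close>.\<close>
  define cls where "cls x = x div (n - 1)" for x :: nat
  define R where "R = \<lparr>pverts = {..<N}, parcs = {(x, y). x < N \<and> y < N \<and> cls x \<noteq> cls y}\<rparr>"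
  define B where "B = \<lparr>pverts = {..<N}, parcs = {(x, y). x < N \<and> y < N \<and> x \<noteq> y \<and> cls x = cls y}\<rparr>"
  have "pair_graph R" "pair_graph B"
    unfolding R_def B_def by (intro pair_graphI; auto)+
  then have "two_coloring N R B"
    by (auto simp: two_coloring_def R_def B_def complete_graph_def)
  moreover have "\<not> contains_copy R (book p m)"
  proof
    assume "contains_copy R (book p m)"
    then obtain \<phi> where \<phi>: "\<phi> ` pverts (book p m) \<subseteq> pverts R"
      "\<And>u v. arc_rel (book p m) u v \<Longrightarrow> arc_rel R (\<phi> u) (\<phi> v)"
      using contains_copyD by blast
    \<comment> \<open>A book with a page contains a clique on \<open>p + 1\<close> vertices; index
      \<open>p\<close> stands for the page \<open>Inr 0\<close>. Pairwise red vertices have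
      different classes, but only \<open>p\<close> classes exist.\<close>
    define c where "c i = cls (\<phi> (if i < p then Inl i else Inr 0))" for i
    have mem: "\<phi> (if i < p then Inl i else Inr 0) < N" for i
      using \<phi>(1) assms(5) by (auto simp: book_simps R_def)
    have ne: "c i \<noteq> c j" if "i < j" "j \<le> p" for i j
      using that \<phi>(2)[of "Inl i" "if j < p then Inl j else Inr 0"] assms(5)
      by (auto simp: book_simps c_def R_def)
    have "inj_on c {..p}"
      using ne by (intro linorder_inj_onI) auto
    moreover have "c ` {..p} \<subseteq> {..<p}"
    proof
      fix k assume "k \<in> c ` {..p}"
      then obtain i where "k = c i"
        by blast
      moreover have "\<phi> (if i < p then Inl i else Inr 0) < p * (n - 1)"
        using mem N by (rule less_le_trans)
      ultimately show "k \<in> {..<p}"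
        unfolding c_def cls_def using assms(4) by (simp only: lessThan_iff less_mult_imp_div_less)
    qed
    ultimately have "card {..p} \<le> card {..<p}"
      by (intro card_inj_on_le) auto
    then show False
      by simp
  qed
  moreover have "\<not> contains_copy B G"
  proof
    assume "contains_copy B G"
    then obtain \<phi> where \<phi>: "inj_on \<phi> (pverts G)" "\<phi> ` pverts G \<subseteq> pverts B"
      "\<And>u v. arc_rel G u v \<Longrightarrow> arc_rel B (\<phi> u) (\<phi> v)"
      using contains_copyD by blast
    have "0 < card (pverts G)"
      using assms(3,4) by simp
    then obtain w where w: "w \<in> pverts G"
      by (auto simp: card_gt_0_iff)
    define k where "k = cls (\<phi> w)"
    have step: "cls (\<phi> u) = cls (\<phi> v)" if "arc_rel G u v" for u v
      using \<phi>(3)[OF that] by (simp add: B_def)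
    have "cls (\<phi> u) = k" if "u \<in> pverts G" for u
      unfolding k_def
      by (rule connected_constant[where f = "\<lambda>u. cls (\<phi> u)", OF assms(2) step that w])
    then have "\<phi> u \<in> {k * (n - 1)..<k * (n - 1) + (n - 1)}" if "u \<in> pverts G" for u
      using that assms(4) div_times_less_eq_dividend[of "\<phi> u" "n - 1"]
        dividend_less_div_times[of "n - 1" "\<phi> u"] by (simp add: cls_def)
    then have "\<phi> ` pverts G \<subseteq> {k * (n - 1)..<k * (n - 1) + (n - 1)}"
      by blast
    then have "card (\<phi> ` pverts G) \<le> card {k * (n - 1)..<k * (n - 1) + (n - 1)}"
      by (intro card_mono) auto
    then show False
      using assms(3,4) \<phi>(1) by (simp add: card_image)
  qed
  ultimately show ?thesis
    by blast
qed

theorem theorem2p12: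
  fixes p q :: nat and \<gamma> :: real
  assumes "p \<ge> 2" and "q \<ge> 1" and "\<gamma> > 0"
  shows "\<exists>c>0. \<forall>\<F> :: 'a pair_pre_digraph set.
    (\<forall>G\<in>\<F>. pair_graph G \<and> Digraph_Component.connected (with_proj G)) \<and>
    degenerate_family q \<F> \<and> crumbling \<gamma> \<F> \<longrightarrow>
    (\<exists>n\<^sub>0. \<forall>G\<in>\<F>. \<forall>n. n = card (pverts G) \<and> n \<ge> n\<^sub>0 \<longrightarrow>
       ramsey_number (book p (nat \<lceil>c * real n\<rceil>)) G = p * (n - 1) + 1)"
proof -
  \<comment> \<open>This constant is fixed before the family is given; \<gamma> is dealt with by the
    choice of \<open>n\<^sub>0\<close> below.\<close>
  obtain c :: real where c: "0 < c"
    and no_inst: "\<And>(P :: 'a set) A (V :: nat set) R. \<not> ramsey_instance P A q V R p c"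
    using no_ramsey_instance[OF assms(1), of q] by blast
  have "\<exists>n\<^sub>0. \<forall>G\<in>\<F>. \<forall>n. n = card (pverts G) \<and> n \<ge> n\<^sub>0 \<longrightarrow>
       ramsey_number (book p (nat \<lceil>c * real n\<rceil>)) G = p * (n - 1) + 1"
    if \<F>: "\<forall>G\<in>\<F>. pair_graph G \<and> Digraph_Component.connected (with_proj G)"
      "degenerate_family q \<F>" "crumbling \<gamma> \<F>" for \<F> :: "'a pair_pre_digraph set"
  proof -
    obtain n\<^sub>1 where n1: "\<And>G. G \<in> \<F> \<Longrightarrow> card (pverts G) > n\<^sub>1 \<Longrightarrow> splittable \<gamma> c G"
      using \<F>(3) c unfolding crumbling_def by blast
    \<comment> \<open>Makes the separator bound \<open>n powr (1 - \<gamma>)\<close> at most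
      \<open>c * n\<close> for large \<open>n\<close>.\<close>
    have "((\<lambda>n. real n powr (- \<gamma>)) \<longlongrightarrow> 0) sequentially"
      using assms(3) by (intro tendsto_neg_powr filterlim_real_sequentially) auto
    then have "\<forall>\<^sub>F n in sequentially. real n powr (- \<gamma>) < c"
      using c by (rule order_tendstoD)
    moreover have "\<forall>\<^sub>F n in sequentially. 1 / c \<le> real n"
      using filterlim_real_sequentially by (rule filterlim_at_top[THEN iffD1, THEN spec])
    ultimately have "\<forall>\<^sub>F n in sequentially. real n powr (- \<gamma>) < c \<and> 1 / c \<le> real n \<and> 2 \<le> n \<and> n\<^sub>1 < n"
      using eventually_ge_at_top[of 2] eventually_gt_at_top[of n\<^sub>1] by eventually_elim simp
    then obtain n\<^sub>0 where n0: "\<And>n. n\<^sub>0 \<le> n \<Longrightarrow> real n powr (- \<gamma>) < c \<and> 1 / c \<le> real n \<and> 2 \<le> n \<and> n\<^sub>1 < n"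
      by (auto simp: eventually_sequentially)
    show ?thesis
    proof (intro exI ballI allI impI)
      fix G n assume G: "G \<in> \<F>" and n: "n = card (pverts G) \<and> n\<^sub>0 \<le> n"
      have pg: "pair_graph G" "Digraph_Component.connected (with_proj G)" "degenerate q G"
        using \<F>(1,2) G by (auto simp: degenerate_family_def)
      have large: "real n powr (- \<gamma>) < c" "1 / c \<le> real n" "2 \<le> n" "n\<^sub>1 < n"
        using n0[of n] n by auto
      have split: "splittable \<gamma> c G"
        using n1[OF G] large(4) n by simp
      have cn: "1 \<le> c * real n"
        using large(2) c by (simp add: field_simps)
      have pw: "real n powr (1 - \<gamma>) \<le> c * real n"
      proof -
        have "real n powr (1 - \<gamma>) = real n powr (- \<gamma>) * real n"
          using large(3) by (simp add: powr_diff powr_minus field_simps)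
        then show ?thesis
          using large(1) by (simp add: mult_right_mono)
      qed
      define m where "m = nat \<lceil>c * real n\<rceil>"
      have m: "0 < m"
        using cn by (simp add: m_def)
      show "ramsey_number (book p (nat \<lceil>c * real n\<rceil>)) G = p * (n - 1) + 1"
        unfolding ramsey_number_def
      proof (rule Least_equality)
        show "\<forall>R B. two_coloring (p * (n - 1) + 1) R B \<longrightarrow>
            contains_copy R (book p (nat \<lceil>c * real n\<rceil>)) \<or> contains_copy B G"
          using ramsey_upper[OF no_inst assms(1) pg(1,3) split _ cn pw] n by blast
        \<comment> \<open>Minimality concerns every smaller \<open>N\<close>;
          \<open>ramsey_lower\<close> colours each of them directly, so no monotonicity in
          \<open>N\<close> has to be proved.\<close>
        fix N assume N: "\<forall>R B. two_coloring N R B \<longrightarrow>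
            contains_copy R (book p (nat \<lceil>c * real n\<rceil>)) \<or> contains_copy B G"
        show "p * (n - 1) + 1 \<le> N"
        proof (rule ccontr)
          assume "\<not> p * (n - 1) + 1 \<le> N"
          then have "N \<le> p * (n - 1)"
            by simp
          then show False
            using ramsey_lower[OF pg(1,2) _ large(3) m, of N p] N n by (auto simp: m_def)
        qed
      qed
    qed
  qed
  then show ?thesis
    using c by blast
qed

end
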